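(* Let $y_0,\varepsilon>0$, let $X=\{z\in\mathbb{C} : |\mathrm{Im}(z)|<y_0+\varepsilon\}$ be the horizontal strip in $\mathbb{C}$ of height $2(y_0+\varepsilon)$, and let $u:X\to\mathbb{C}$ be a simply periodic solution (with period $1$) of the sinh-Gordon equation $\Delta u+\sinh(u)=0$. Let $\Sigma$ be the spectral curve corresponding to $u$, assumed to have no singularities, with branch points $\varkappa_{n,\nu}$ ($n\in\mathbb{Z}$, $\nu\in\{1,2\}$), put $\varkappa_{n,*}:=\frac12(\varkappa_{n,1}+\varkappa_{n,2})$, and let $D=\{(\lambda_n,\mu_n)\}_{n\in\mathbb{Z}}$ be the spectral divisor of $u$ with the starting point $z_0=0$. Then there exist a constant $C>0$ and a sequence $(s_n)_{n\in\mathbb{Z}}\in\ell^2_{0,0}$ of real numbers so that, for all $n\in\mathbb{Z}$, $$|\varkappa_{n,1}-\varkappa_{n,2}|\le C\,e^{-2\pi(1-s_n)|n|y_0},$$ $$|\lambda_n-\varkappa_{n,*}|\le C\,e^{-2\pi(1-s_n)|n|y_0},$$ $$|\mu_n-(-1)^n|\le C\,e^{-\pi(1-s_n)|n|y_0}.$$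
   Context: Simply periodic with period $1$: $u(z+1)=u(z)$ for all $z\in X$. With $z=x+iy$, let $$\alpha_\lambda=\frac14\begin{pmatrix} i u_y & -e^{u/2}-\lambda^{-1}e^{-u/2}\\ e^{u/2}+\lambda e^{-u/2} & -i u_y\end{pmatrix}dx+\frac i4\begin{pmatrix}-u_x & e^{u/2}-\lambda^{-1}e^{-u/2}\\ e^{u/2}-\lambda e^{-u/2} & u_x\end{pmatrix}dy\quad(\lambda\in\mathbb{C}^* ),$$ $F_\lambda$ the solution of $dF_\lambda=\alpha_\lambda F_\lambda$ with $F_\lambda(0)=\mathbf1$, and $M(\lambda)=F_\lambda(1)=\begin{pmatrix}a&b\\c&d\end{pmatrix}$ the monodromy with base point $z_0=0$ (integration along $[0,1]$). Spectral curve: $\Sigma=\{(\lambda,\mu)\in\mathbb{C}^*\times\mathbb{C}\mid\mu^2-\Delta(\lambda)\mu+1=0\}$ with $\Delta=\operatorname{tr}M$; it has no singularities iff all zeros of $\Delta^2-4$ are simple. Spectral divisor: the points $(\lambda_*,\mu_* )\in\Sigma$ with $c(\lambda_* )=0$, $\mu_*=a(\lambda_* )$, with multiplicity the order of the zero of $c$ at $\lambda_*$. Enumerations: put $\lambda_{k,0}:=8\pi^2k^2+4\pi k\sqrt{4\pi^2k^2-1}-1$, and let $\ell^2_{n,m}$ be the space of complex sequences $(a_k)_{k\in\mathbb{Z}}$ with $\sum_{k<0}|k^m a_k|^2+|a_0|^2+\sum_{k>0}|k^n a_k|^2<\infty$. The zeros of $\Delta^2-4$ (the branch points of $\Sigma$)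 are enumerated by two sequences $(\varkappa_{k,1})_{k\in\mathbb{Z}},(\varkappa_{k,2})_{k\in\mathbb{Z}}$ with $(\varkappa_{k,\nu}-\lambda_{k,0})\in\ell^2_{-1,3}$, and the points of $D$ (with multiplicity) are enumerated by a sequence $(\lambda_k,\mu_k)_{k\in\mathbb{Z}}$ with $(\lambda_k-\lambda_{k,0})\in\ell^2_{-1,3}$ and $(\mu_k-(-1)^k)\in\ell^2_{0,0}$. *)

theory Defs
  imports "HOL-Complex_Analysis.Complex_Analysis"
begin

section \<open>Periodic solutions of the sinh-Gordon equation\<close>

definition strip :: "real \<Rightarrow> complex set" where
  "strip r = {z. \<bar>Im z\<bar> < r}"

text \<open>
  Partial derivatives with respect to \<open>x = Re z\<close> and \<open>y = Im z\<close>, obtained from the real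
  Frechet derivative; the functions are complex valued but not holomorphic.
\<close>

definition pdx :: "(complex \<Rightarrow> complex) \<Rightarrow> complex \<Rightarrow> complex" where
  "pdx f z = frechet_derivative f (at z) 1"

definition pdy :: "(complex \<Rightarrow> complex) \<Rightarrow> complex \<Rightarrow> complex" where
  "pdy f z = frechet_derivative f (at z) \<i>"

definition real_C1_on :: "complex set \<Rightarrow> (complex \<Rightarrow> complex) \<Rightarrow> bool" where
  "real_C1_on X f \<longleftrightarrow>
     (\<forall>z\<in>X. f differentiable (at z)) \<and> continuous_on X (pdx f) \<and> continuous_on X (pdy f)"

definition real_C2_on :: "complex set \<Rightarrow> (complex \<Rightarrow> complex) \<Rightarrow> bool" where
  "real_C2_on X f \<longleftrightarrow> real_C1_on X f \<and> real_C1_on X (pdx f) \<and> real_C1_on X (pdy f)"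

definition sinh_gordon_solution :: "complex set \<Rightarrow> (complex \<Rightarrow> complex) \<Rightarrow> bool" where
  "sinh_gordon_solution X u \<longleftrightarrow>
     real_C2_on X u \<and> (\<forall>z\<in>X. pdx (pdx u) z + pdy (pdy u) z + sinh (u z) = 0)"

definition simply_periodic :: "complex set \<Rightarrow> (complex \<Rightarrow> complex) \<Rightarrow> bool" where
  "simply_periodic X u \<longleftrightarrow> (\<forall>z\<in>X. u (z + 1) = u z)"


section \<open>Monodromy\<close>

definition mat2 :: "complex \<Rightarrow> complex \<Rightarrow> complex \<Rightarrow> complex \<Rightarrow> complex^2^2" where
  "mat2 a b c d = vector [vector [a, b], vector [c, d]]"

definition cscale :: "complex \<Rightarrow> complex^2^2 \<Rightarrow> complex^2^2" where
  "cscale c A = (\<chi> i j. c * A $ i $ j)"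

text \<open>The spectral parameter is written \<open>l\<close>, since the Greek letter is reserved for abstraction.\<close>

definition alpha_dx :: "(complex \<Rightarrow> complex) \<Rightarrow> complex \<Rightarrow> complex \<Rightarrow> complex^2^2" where
  "alpha_dx u l z = cscale (1/4)
     (mat2 (\<i> * pdy u z)                               (- exp (u z / 2) - inverse l * exp (- u z / 2))
           (exp (u z / 2) + l * exp (- u z / 2))      (- \<i> * pdy u z))"

definition alpha_dy :: "(complex \<Rightarrow> complex) \<Rightarrow> complex \<Rightarrow> complex \<Rightarrow> complex^2^2" where
  "alpha_dy u l z = cscale (\<i>/4)
     (mat2 (- pdx u z)                                 (exp (u z / 2) - inverse l * exp (- u z / 2))
           (exp (u z / 2) - l * exp (- u z / 2))      (pdx u z))"

definition alpha :: "(complex \<Rightarrow> complex) \<Rightarrow> complex \<Rightarrow> complex \<Rightarrow> complex \<Rightarrow> complex^2^2" where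
  "alpha u l z h = Re h *\<^sub>R alpha_dx u l z + Im h *\<^sub>R alpha_dy u l z"

text \<open>
  The equation \<open>dF = \<alpha> F\<close>, \<open>F(0) = 1\<close>, pulled back to the period segment \<open>t \<mapsto> t\<close> with
  \<open>0 \<le> t \<le> 1\<close>, whose tangent vector is \<open>1\<close>.  It is deliberately not imposed on a
  two-dimensional domain: for a solution of \<open>u\<^sub>x\<^sub>x + u\<^sub>y\<^sub>y + sinh u = 0\<close> the form \<open>\<alpha>\<close>, with the
  signs used here, satisfies \<open>d\<alpha> + \<alpha> \<and> \<alpha> = 0\<close>, which is the integrability condition of
  \<open>dF = F \<alpha>\<close>, so \<open>dF = \<alpha> F\<close> is in general solvable along curves only.
\<close>

definition is_frame ::
  "(complex \<Rightarrow> complex) \<Rightarrow> complex \<Rightarrow> (real \<Rightarrow> complex^2^2) \<Rightarrow> bool" where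
  "is_frame u l F \<longleftrightarrow> F 0 = mat 1 \<and>
     (\<forall>t\<in>{0..1}. (F has_vector_derivative (alpha u l (of_real t) 1 ** F t)) (at t within {0..1}))"

definition monodromy :: "(complex \<Rightarrow> complex) \<Rightarrow> complex \<Rightarrow> complex^2^2" where
  "monodromy u l = (THE M. \<exists>F. is_frame u l F \<and> M = F 1)"

definition mon_a :: "(complex \<Rightarrow> complex) \<Rightarrow> complex \<Rightarrow> complex" where
  "mon_a u l = monodromy u l $ 1 $ 1"

definition mon_c :: "(complex \<Rightarrow> complex) \<Rightarrow> complex \<Rightarrow> complex" where
  "mon_c u l = monodromy u l $ 2 $ 1"

definition mon_tr :: "(complex \<Rightarrow> complex) \<Rightarrow> complex \<Rightarrow> complex" where
  "mon_tr u l = trace (monodromy u l)"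


section \<open>Spectral curve and spectral divisor\<close>

definition curve_fun :: "(complex \<Rightarrow> complex) \<Rightarrow> complex \<Rightarrow> complex \<Rightarrow> complex" where
  "curve_fun u l \<mu> = \<mu>\<^sup>2 - mon_tr u l * \<mu> + 1"

definition spectral_curve :: "(complex \<Rightarrow> complex) \<Rightarrow> (complex \<times> complex) set" where
  "spectral_curve u = {(l, \<mu>). l \<noteq> 0 \<and> curve_fun u l \<mu> = 0}"

definition curve_singularities :: "(complex \<Rightarrow> complex) \<Rightarrow> (complex \<times> complex) set" where
  "curve_singularities u = {(l, \<mu>) \<in> spectral_curve u.
     deriv (\<lambda>w. curve_fun u w \<mu>) l = 0 \<and> deriv (\<lambda>w. curve_fun u l w) \<mu> = 0}"

text \<open>For \<open>f\<close> holomorphic and not identically zero on the punctured plane, the vanishing order.\<close>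

definition zero_mult :: "(complex \<Rightarrow> complex) \<Rightarrow> complex \<Rightarrow> nat" where
  "zero_mult f l = (if l \<noteq> 0 \<and> f l = 0 then nat (zorder f l) else 0)"

definition spectral_divisor :: "(complex \<Rightarrow> complex) \<Rightarrow> complex \<times> complex \<Rightarrow> nat" where
  "spectral_divisor u = (\<lambda>(l, \<mu>).
     if (l, \<mu>) \<in> spectral_curve u \<and> \<mu> = mon_a u l then zero_mult (mon_c u) l else 0)"

text \<open>\<open>x\<close> lists, over the index set \<open>I\<close>, each point \<open>p\<close> exactly \<open>m p\<close> times and nothing else.\<close>

definition enumerates :: "'i set \<Rightarrow> ('i \<Rightarrow> 'a) \<Rightarrow> ('a \<Rightarrow> nat) \<Rightarrow> bool" where
  "enumerates I x m \<longleftrightarrow> (\<forall>p. finite {i\<in>I. x i = p} \<and> card {i\<in>I. x i = p} = m p)"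


section \<open>Asymptotics\<close>

text \<open>The summand at index \<open>0\<close> is finite and imposes no condition.\<close>

definition l2_space :: "int \<Rightarrow> int \<Rightarrow> (int \<Rightarrow> complex) set" where
  "l2_space n m = {a.
     (\<lambda>k. (cmod (of_int k powi m * a k))\<^sup>2) summable_on {k. k < 0} \<and>
     (\<lambda>k. (cmod (of_int k powi n * a k))\<^sup>2) summable_on {k. k > 0}}"

text \<open>At \<open>k = 0\<close> the square root of \<open>-1\<close> is multiplied by \<open>0\<close>, so the value is \<open>-1\<close>.\<close>

definition lambda0 :: "int \<Rightarrow> real" where
  "lambda0 k = 8 * pi\<^sup>2 * (of_int k)\<^sup>2
     + 4 * pi * of_int k * sqrt (4 * pi\<^sup>2 * (of_int k)\<^sup>2 - 1) - 1"

text \<open>Branch points: the zeros of \<open>\<Delta>\<^sup>2 - 4\<close>, listed as \<open>\<kappa> k \<nu>\<close> with \<open>\<nu> \<in> {1, 2}\<close>.\<close>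

definition branch_point_enumeration ::
  "(complex \<Rightarrow> complex) \<Rightarrow> (int \<Rightarrow> nat \<Rightarrow> complex) \<Rightarrow> bool" where
  "branch_point_enumeration u \<kappa> \<longleftrightarrow>
     enumerates (UNIV \<times> {1, 2}) (\<lambda>(k, \<nu>). \<kappa> k \<nu>) (zero_mult (\<lambda>l. (mon_tr u l)\<^sup>2 - 4)) \<and>
     (\<forall>\<nu>\<in>{1, 2}. (\<lambda>k. \<kappa> k \<nu> - of_real (lambda0 k)) \<in> l2_space (-1) 3)"

definition divisor_enumeration ::
  "(complex \<Rightarrow> complex) \<Rightarrow> (int \<Rightarrow> complex) \<Rightarrow> (int \<Rightarrow> complex) \<Rightarrow> bool" where
  "divisor_enumeration u lam mu \<longleftrightarrow>
     enumerates UNIV (\<lambda>k. (lam k, mu k)) (spectral_divisor u) \<and>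
     (\<lambda>k. lam k - of_real (lambda0 k)) \<in> l2_space (-1) 3 \<and>
     (\<lambda>k. mu k - (-1) powi k) \<in> l2_space 0 0"

end

theory Submission
  imports Defs
begin

text \<open>
  Write \<open>l = \<nu>\<^sup>2\<close>. The gauge \<open>r, s = v\<^sub>1 exp (- u / 4) \<plusminus> i v\<^sub>2 exp (u / 4) / \<nu>\<close> diagonalizes the leading part of the flat
  connection: \<open>r, s\<close> oscillate like \<open>exp (\<plusminus> i \<nu> x / 4)\<close> along the period and decay, respectively
  grow, like \<open>exp (\<mp> \<nu> y / 4)\<close> across it. So the monodromy \<open>M\<^sub>y\<close> at every height \<open>y\<close> is bounded for
  \<open>\<nu>\<close> near \<open>4 \<pi> n\<close>, while the quadratic form \<open>Q\<^sub>y v = det (v, M\<^sub>y v)\<close> is constant along solutions of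
  the \<open>y\<close>-equation. Following the solutions that are of unit size at \<open>y = Y\<close> or at \<open>y = - Y\<close> to
  \<open>y = 0\<close>, where they have size \<open>exp (\<nu> Y / 4)\<close>, shows that \<open>Q\<^sub>0\<close> has size \<open>exp (- \<nu> Y / 2)\<close> at two
  well separated unit vectors. At a branch point \<open>Q\<^sub>0\<close> has a double root, and at a point of the
  divisor it vanishes at a third known vector; either way all of \<open>Q\<^sub>0\<close> is small, that is, \<open>M\<^sub>0\<close> is
  a multiple of the identity up to \<open>O (exp (- 2 \<pi> n Y))\<close>. Comparing solutions for two spectral
  parameters by means of their Wronskian shows that this happens at most once near \<open>4 \<pi> n\<close>, up to an
  error of the same order. A value \<open>Y > y0\<close> absorbs the polynomial losses, so that \<open>s\<^sub>n = 0\<close> works.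
\<close>

section \<open>Linear differential equations\<close>

text \<open>The enumerations place the spectral points only within o(n) of \<open>lambda0 n\<close>,
  that is, \<open>\<nu>\<close> within o(1) of 4 \<pi> n; nothing relates the n-th divisor point to
  the n-th branch points beyond that. Exponential closeness therefore comes from a local uniqueness
  statement: any two spectral points, of whichever kind, in a disc of fixed radius around 4 \<pi> n
  are exponentially close. Every constant in it depends only on a compact period rectangle and not
  on n, so large n needs no case distinction.

  A quadratic form has three coefficients and the transport across the strip controls it at two
  vectors only; this is why the branch point or divisor condition is required as a third. The rate 2
  \<pi> n is \<nu> / 2 at \<nu> = 4 \<pi> n, where \<nu> / 2 is the growth rate of the squared
  modulus of a solution with exponent \<nu> / 4.

  For n tending to minus infinity the spectral points tend to 0. Reflecting the solution replaces
  \<open>l\<close> by \<open>1 / l\<close> and exchanges the off-diagonal entries' scaling only, so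
  the same argument applies. The bound for \<open>mu\<close> comes from the difference of the
  diagonal entries of a triangular monodromy with determinant 1.\<close>

lemma linear_ode_exists:
  fixes A :: "real \<Rightarrow> 'm::real_normed_vector" and v0 :: "'a::banach"
  assumes mv: "bounded_bilinear mv" and ab: "a \<le> b" and A: "continuous_on {a..b} A"
  shows "\<exists>v. v a = v0 \<and>
    (\<forall>t\<in>{a..b}. (v has_vector_derivative mv (A t) (v t)) (at t within {a..b}))"
proof -
  interpret mv: bounded_bilinear mv by (fact mv)
  obtain B where B: "B > 0" "\<And>m x. norm (mv m x) \<le> norm m * norm x * B"
    using mv.pos_bounded by blast
  obtain D where D: "\<And>t. t \<in> {a..b} \<Longrightarrow> norm (A t) \<le> D"
    using compact_imp_bounded[OF compact_continuous_image[OF A compact_Icc]]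
    unfolding bounded_iff by blast
  define K where "K = \<bar>D\<bar> * B + 1"
  have K0: "K > 0"
    using B(1) by (auto simp: K_def intro!: add_nonneg_pos)
  have K: "norm (mv (A t) x) \<le> K * norm x" if "t \<in> {a..b}" for t x
  proof -
    have "norm (mv (A t) x) \<le> norm (A t) * norm x * B" by (rule B)
    also have "\<dots> \<le> \<bar>D\<bar> * norm x * B"
      using D[OF that] B(1) by (intro mult_right_mono) auto
    also have "\<dots> \<le> K * norm x"
      by (simp add: K_def algebra_simps)
    finally show ?thesis .
  qed
  \<comment> \<open>Picard iteration written as a Neumann series: \<open>X n\<close> is the n-fold
    iterated integral applied to \<open>v0\<close>, and the sum of all of them solves the integral
    equation.\<close>
  define X where "X = rec_nat (\<lambda>_. v0) (\<lambda>_ f t. integral {a..t} (\<lambda>s. mv (A s) (f s)))"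
  have X0: "X 0 = (\<lambda>_. v0)"
    and XS: "X (Suc n) = (\<lambda>t. integral {a..t} (\<lambda>s. mv (A s) (X n s)))" for n
    by (simp_all add: X_def)
  have contA: "continuous_on {a..b} (\<lambda>s. mv (A s) (f s))" if "continuous_on {a..b} f" for f
    by (intro mv.continuous_on A that)
  have contX: "continuous_on {a..b} (X n)" for n
  proof (induction n)
    case (Suc n)
    then show ?case unfolding XS
      by (intro indefinite_integral_continuous_1 integrable_continuous_real contA)
  qed (simp add: X0)
  \<comment> \<open>The weight has twice the growth rate \<open>K\<close> of the equation, so each
    integration gains a factor 1/2. The series then converges geometrically on the whole interval at
    once.\<close>
  have bnd: "norm (X n t) \<le> norm v0 * exp (2 * K * (t - a)) / 2 ^ n" if "t \<in> {a..b}" for n t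
    using that
  proof (induction n arbitrary: t)
    case 0
    then show ?case using K0 by (simp add: X0 mult_le_cancel_left1)
  next
    case (Suc n)
    let ?g = "\<lambda>s. K * (norm v0 * exp (2 * K * (s - a)) / 2 ^ n)"
    let ?G = "\<lambda>s. norm v0 * exp (2 * K * (s - a)) / 2 ^ Suc n"
    have I: "(?g has_integral (?G t - ?G a)) {a..t}"
    proof (rule fundamental_theorem_of_calculus)
      show "(?G has_vector_derivative ?g x) (at x within {a..t})" for x
        unfolding has_real_derivative_iff_has_vector_derivative[symmetric]
        by (auto intro!: derivative_eq_intros simp: field_simps)
    qed (use Suc in auto)
    have "norm (X (Suc n) t) \<le> integral {a..t} ?g"
      unfolding XS
    proof (rule integral_norm_bound_integral)
      show "(\<lambda>s. mv (A s) (X n s)) integrable_on {a..t}"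
        by (rule integrable_continuous_real, rule continuous_on_subset[OF contA[OF contX]])
           (use Suc.prems in auto)
      show "?g integrable_on {a..t}" using I by blast
      show "norm (mv (A s) (X n s)) \<le> ?g s" if "s \<in> {a..t}" for s
      proof -
        have s: "s \<in> {a..b}" using that Suc.prems by auto
        have "norm (mv (A s) (X n s)) \<le> K * norm (X n s)" by (rule K[OF s])
        also have "\<dots> \<le> ?g s"
          by (rule mult_left_mono[OF Suc.IH[OF s]]) (use K0 in auto)
        finally show ?thesis .
      qed
    qed
    also have "\<dots> = ?G t - ?G a" using I by (rule integral_unique)
    also have "\<dots> \<le> ?G t" by simp
    finally show ?case .
  qed
  define S where "S t = (\<Sum>n. X n t)" for t
  have unif: "uniform_limit {a..b} (\<lambda>N t. \<Sum>n<N. X n t) S sequentially"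
    unfolding S_def
  proof (rule Weierstrass_m_test)
    show "norm (X n t) \<le> norm v0 * exp (2 * K * (b - a)) * (1/2) ^ n"
      if t: "t \<in> {a..b}" for n t
    proof -
      have "norm (X n t) \<le> norm v0 * exp (2 * K * (t - a)) * (1/2) ^ n"
        using bnd[OF t, of n] by (simp add: power_divide)
      also have "\<dots> \<le> norm v0 * exp (2 * K * (b - a)) * (1/2) ^ n"
        using t K0 by (intro mult_left_mono mult_right_mono) auto
      finally show ?thesis .
    qed
    show "summable (\<lambda>n. norm v0 * exp (2 * K * (b - a)) * (1/2) ^ n)"
      by (intro summable_mult summable_geometric) auto
  qed
  have contS: "continuous_on {a..b} S"
    by (rule uniform_limit_theorem[OF _ unif]) (auto intro!: continuous_on_sum contX always_eventually)
  have SI: "S t = v0 + integral {a..t} (\<lambda>s. mv (A s) (S s))" if t: "t \<in> {a..b}" for t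
  proof (rule LIMSEQ_unique)
    have sub: "{a..t} \<subseteq> {a..b}" using t by auto
    show "(\<lambda>N. \<Sum>n<Suc N. X n t) \<longlonglongrightarrow> S t"
      using tendsto_uniform_limitI[OF unif t] by (rule LIMSEQ_Suc)
    have eq: "(\<Sum>n<Suc N. X n t) = v0 + integral {a..t} (\<lambda>s. mv (A s) (\<Sum>n<N. X n s))" for N
    proof -
      have "(\<Sum>n<Suc N. X n t) = v0 + (\<Sum>n<N. X (Suc n) t)"
        by (subst sum.lessThan_Suc_shift) (simp add: X0)
      also have "(\<Sum>n<N. X (Suc n) t) = integral {a..t} (\<lambda>s. \<Sum>n<N. mv (A s) (X n s))"
        unfolding XS
        by (rule integral_sum[symmetric])
           (auto intro!: integrable_continuous_real continuous_on_subset[OF contA[OF contX] sub])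
      also have "\<dots> = integral {a..t} (\<lambda>s. mv (A s) (\<Sum>n<N. X n s))"
        by (simp add: mv.sum_right)
      finally show ?thesis .
    qed
    have ul: "uniform_limit {a..t} (\<lambda>N s. mv (A s) (\<Sum>n<N. X n s)) (\<lambda>s. mv (A s) (S s)) sequentially"
    proof (rule uniform_limitI)
      fix e :: real assume e: "e > 0"
      have "\<forall>\<^sub>F N in sequentially. \<forall>s\<in>{a..b}. dist (\<Sum>n<N. X n s) (S s) < e / K"
        using unif e K0 by (auto simp: uniform_limit_iff)
      then show "\<forall>\<^sub>F N in sequentially. \<forall>s\<in>{a..t}. dist (mv (A s) (\<Sum>n<N. X n s)) (mv (A s) (S s)) < e"
      proof eventually_elim
        case (elim N)
        show ?case
        proof
          fix s assume "s \<in> {a..t}"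
          with sub have s: "s \<in> {a..b}" by auto
          have "dist (mv (A s) (\<Sum>n<N. X n s)) (mv (A s) (S s)) \<le> K * dist (\<Sum>n<N. X n s) (S s)"
            using K[OF s, of "(\<Sum>n<N. X n s) - S s"] by (simp add: dist_norm mv.diff_right)
          also have "\<dots> < K * (e / K)"
            using elim s K0 by (intro mult_strict_left_mono) auto
          finally show "dist (mv (A s) (\<Sum>n<N. X n s)) (mv (A s) (S s)) < e"
            using K0 by simp
        qed
      qed
    qed
    have "(\<lambda>N. integral {a..t} (\<lambda>s. mv (A s) (\<Sum>n<N. X n s))) \<longlonglongrightarrow> integral {a..t} (\<lambda>s. mv (A s) (S s))"
    proof (rule uniform_limit_integral[OF ul])
      show "continuous_on {a..t} (\<lambda>s. mv (A s) (\<Sum>n<N. X n s))" for N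
        by (rule continuous_on_subset[OF contA sub]) (intro continuous_on_sum contX)
      fix I J
      assume I: "\<And>N. ((\<lambda>s. mv (A s) (\<Sum>n<N. X n s)) has_integral I N) {a..t}"
        and J: "((\<lambda>s. mv (A s) (S s)) has_integral J) {a..t}" and IJ: "I \<longlonglongrightarrow> J"
      have "integral {a..t} (\<lambda>s. mv (A s) (\<Sum>n<N. X n s)) = I N" for N
        using I by (rule integral_unique)
      with integral_unique[OF J] IJ show ?thesis by simp
    qed simp
    then show "(\<lambda>N. \<Sum>n<Suc N. X n t) \<longlonglongrightarrow> v0 + integral {a..t} (\<lambda>s. mv (A s) (S s))"
      unfolding eq by (intro tendsto_intros)
  qed
  have "(S has_vector_derivative mv (A t) (S t)) (at t within {a..b})" if t: "t \<in> {a..b}" for t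
  proof -
    have "((\<lambda>t. v0 + integral {a..t} (\<lambda>s. mv (A s) (S s))) has_vector_derivative 0 + mv (A t) (S t))
      (at t within {a..b})"
      by (intro has_vector_derivative_add has_vector_derivative_const
          integral_has_vector_derivative contA contS t)
    then show ?thesis
      using has_vector_derivative_transform[OF t SI] by simp
  qed
  moreover have "S a = v0" using SI[of a] ab by simp
  ultimately show ?thesis by blast
qed

lemma has_vector_derivative_reflect_interval:
  fixes f :: "real \<Rightarrow> 'a::real_normed_vector"
  assumes f: "\<And>t. t \<in> {a..b} \<Longrightarrow> (f has_vector_derivative f' t) (at t within {a..b})"
    and t: "t \<in> {a..b}"
  shows "((\<lambda>t. f (a + b - t)) has_vector_derivative - f' (a + b - t)) (at t within {a..b})"
proof -
  have im: "(\<lambda>t. a + b - t) ` {a..b} \<subseteq> {a..b}" and t': "a + b - t \<in> {a..b}"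
    using t by auto
  have "((\<lambda>t. a + b - t) has_vector_derivative - 1) (at t within {a..b})"
    by (auto intro!: derivative_eq_intros)
  from vector_diff_chain_within[OF this has_vector_derivative_within_subset[OF f[OF t'] im]]
  show ?thesis by (simp add: o_def)
qed

text \<open>Time reversal. It supplies the solution that is normalized at the top edge
  \<open>Y\<close> and followed down to 0.\<close>

lemma linear_ode_exists_terminal:
  fixes A :: "real \<Rightarrow> 'm::real_normed_vector" and v0 :: "'a::banach"
  assumes mv: "bounded_bilinear mv" and ab: "a \<le> b" and A: "continuous_on {a..b} A"
  shows "\<exists>v. v b = v0 \<and>
    (\<forall>t\<in>{a..b}. (v has_vector_derivative mv (A t) (v t)) (at t within {a..b}))"
proof -
  have "continuous_on {a..b} (A \<circ> (\<lambda>t. a + b - t))"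
    by (intro continuous_on_compose continuous_intros continuous_on_subset[OF A]) auto
  then have "continuous_on {a..b} (\<lambda>t. - A (a + b - t))"
    by (simp add: o_def continuous_on_minus)
  from linear_ode_exists[OF mv ab this, of v0] obtain v where v: "v a = v0"
    "\<And>t. t \<in> {a..b} \<Longrightarrow> (v has_vector_derivative mv (- A (a + b - t)) (v t)) (at t within {a..b})"
    by blast
  show ?thesis
    using v(1) has_vector_derivative_reflect_interval[OF v(2)]
    by (intro exI[of _ "\<lambda>t. v (a + b - t)"]) (simp add: bounded_bilinear.minus_left[OF mv])
qed

text \<open>\<open>exp (- K * (t - a)) * E t\<close> is nonincreasing. No sign of \<open>E\<close>
  enters, so the estimate can be negated to a lower bound and applied to an indefinite
  energy.\<close>

lemma gronwall_upper:
  fixes E E' :: "real \<Rightarrow> real"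
  assumes ab: "a \<le> b"
    and der: "\<And>t. t \<in> {a..b} \<Longrightarrow> (E has_vector_derivative E' t) (at t within {a..b})"
    and le: "\<And>t. t \<in> {a..b} \<Longrightarrow> E' t \<le> K * E t"
  shows "E b \<le> E a * exp (K * (b - a))"
proof -
  define g where "g t = exp (- K * (t - a)) * E t" for t
  have "(g has_derivative (*) (exp (- K * (t - a)) * (E' t - K * E t))) (at t within {a..b})"
    if "a \<le> t" "t \<le> b" for t
  proof -
    have "(E has_real_derivative E' t) (at t within {a..b})"
      using der[of t] that by (simp add: has_real_derivative_iff_has_vector_derivative)
    then have "(g has_real_derivative (exp (- K * (t - a)) * (E' t - K * E t))) (at t within {a..b})"
      unfolding g_def by (auto intro!: derivative_eq_intros simp: algebra_simps)
    then show ?thesis by (simp add: has_field_derivative_def)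
  qed
  from mvt_very_simple[OF ab this] obtain t where t: "t \<in> {a..b}"
    "g b - g a = exp (- K * (t - a)) * (E' t - K * E t) * (b - a)" by blast
  have "g b \<le> g a"
    using t le[OF t(1)] ab by (smt (verit) exp_gt_zero mult_nonneg_nonpos mult_nonpos_nonneg)
  then have "exp (- K * (b - a)) * E b \<le> E a" by (simp add: g_def)
  then have "exp (K * (b - a)) * (exp (- K * (b - a)) * E b) \<le> exp (K * (b - a)) * E a"
    by (intro mult_left_mono) auto
  moreover have "exp (K * (b - a)) * exp (- K * (b - a)) = 1"
    by (simp flip: exp_add)
  ultimately show ?thesis by (metis mult.assoc mult.commute mult_1)
qed

lemma gronwall_lower:
  fixes E E' :: "real \<Rightarrow> real"
  assumes ab: "a \<le> b"
    and der: "\<And>t. t \<in> {a..b} \<Longrightarrow> (E has_vector_derivative E' t) (at t within {a..b})"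
    and le: "\<And>t. t \<in> {a..b} \<Longrightarrow> K * E t \<le> E' t"
  shows "E a * exp (K * (b - a)) \<le> E b"
  using gronwall_upper[OF ab, of "\<lambda>t. - E t" "\<lambda>t. - E' t" K] der le
  by (simp add: has_vector_derivative_minus)

lemma has_vector_derivative_norm_sq:
  fixes f :: "real \<Rightarrow> 'a::real_inner"
  assumes "(f has_vector_derivative f') (at t within S)"
  shows "((\<lambda>t. (norm (f t))\<^sup>2) has_vector_derivative 2 * (f t \<bullet> f')) (at t within S)"
  using bounded_bilinear.has_vector_derivative[OF bounded_bilinear_inner assms assms]
  by (simp add: power2_norm_eq_inner inner_commute)

text \<open>Adding the square of the inhomogeneity to the energy makes the estimate homogeneous.\<close>

lemma perturbed_linear_ode_bound:
  fixes e :: "real \<Rightarrow> 'a::real_inner"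
  assumes "a \<le> b"
    and der: "\<And>t. t \<in> {a..b} \<Longrightarrow> (e has_vector_derivative e' t) (at t within {a..b})"
    and le: "\<And>t. t \<in> {a..b} \<Longrightarrow> e t \<bullet> e' t \<le> K * (norm (e t))\<^sup>2 + \<rho> * norm (e t)"
    and K: "K \<ge> 0" and t: "t \<in> {a..b}"
  shows "(norm (e t))\<^sup>2 \<le> ((norm (e a))\<^sup>2 + \<rho>\<^sup>2) * exp ((2 * K + 1) * (b - a))"
proof -
  define E where "E t = (norm (e t))\<^sup>2 + \<rho>\<^sup>2" for t
  have "E t \<le> E a * exp ((2 * K + 1) * (t - a))"
  proof (rule gronwall_upper)
    fix s assume s: "s \<in> {a..t}"
    then have s': "s \<in> {a..b}" using t by auto
    have "(e has_vector_derivative e' s) (at s within {a..t})"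
      using der[OF s'] by (rule has_vector_derivative_within_subset) (use t in auto)
    from has_vector_derivative_add[OF has_vector_derivative_norm_sq[OF this]
        has_vector_derivative_const[of "\<rho>\<^sup>2"]]
    show "(E has_vector_derivative 2 * (e s \<bullet> e' s)) (at s within {a..t})"
      by (simp add: E_def[abs_def])
    have "2 * \<rho> * norm (e s) \<le> \<rho>\<^sup>2 + (norm (e s))\<^sup>2"
      using sum_squares_bound[of \<rho> "norm (e s)"] by (simp add: power2_eq_square)
    moreover have "0 \<le> K * \<rho>\<^sup>2" using K by simp
    ultimately show "2 * (e s \<bullet> e' s) \<le> (2 * K + 1) * E s"
      using le[OF s'] unfolding E_def by (simp add: algebra_simps)
  qed (use t in auto)
  also have "\<dots> \<le> E a * exp ((2 * K + 1) * (b - a))"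
    using t K unfolding E_def by (intro mult_left_mono) (auto intro!: mult_left_mono)
  finally show ?thesis unfolding E_def by (smt (verit) zero_le_power2)
qed

section \<open>Flat connections over a rectangle\<close>

lemma norm_le_on_rectangle:
  fixes g :: "real \<Rightarrow> real \<Rightarrow> 'a::real_normed_vector"
  assumes "continuous_on ({a..b} \<times> {c..d}) (\<lambda>(x, y). g x y)"
  shows "\<exists>K>0. \<forall>x\<in>{a..b}. \<forall>y\<in>{c..d}. norm (g x y) \<le> K"
proof -
  have "bounded ((\<lambda>(x, y). g x y) ` ({a..b} \<times> {c..d}))"
    by (intro compact_imp_bounded compact_continuous_image assms compact_Times compact_Icc)
  then obtain K where "K > 0" "\<forall>p\<in>(\<lambda>(x, y). g x y) ` ({a..b} \<times> {c..d}). norm p \<le> K"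
    unfolding bounded_pos by blast
  then show ?thesis by (intro exI[of _ K]) auto
qed

lemma norm_le_on_interval:
  fixes g :: "real \<Rightarrow> 'a::real_normed_vector"
  assumes "\<And>x. x \<in> {a..b} \<Longrightarrow> (g has_vector_derivative g' x) (at x within {a..b})"
  shows "\<exists>K>0. \<forall>x\<in>{a..b}. norm (g x) \<le> K"
proof -
  have "continuous_on {a..b} g"
    using assms has_vector_derivative_continuous continuous_on_eq_continuous_within by blast
  then have "bounded (g ` {a..b})"
    by (intro compact_imp_bounded compact_continuous_image) auto
  then show ?thesis unfolding bounded_pos by blast
qed

text \<open>Uniform continuity of \<open>Uy\<close> on the compact rectangle makes the error uniform
  in \<open>x\<close>, as is needed when the \<open>x\<close>-equation is integrated along a whole
  side with this error as its source.\<close>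

lemma uniform_linearization:
  fixes U Uy :: "real \<Rightarrow> real \<Rightarrow> 'm::real_normed_vector"
  assumes der: "\<And>x y. x \<in> {a..b} \<Longrightarrow> y \<in> {c..d} \<Longrightarrow>
      (U x has_vector_derivative Uy x y) (at y within {c..d})"
    and cont: "continuous_on ({a..b} \<times> {c..d}) (\<lambda>(x, y). Uy x y)"
    and y: "y \<in> {c..d}" and e: "e > 0"
  shows "\<exists>\<delta>>0. \<forall>y'\<in>{c..d}. \<bar>y' - y\<bar> < \<delta> \<longrightarrow> (\<forall>x\<in>{a..b}.
    norm (U x y' - U x y - (y' - y) *\<^sub>R Uy x y) \<le> e * \<bar>y' - y\<bar> \<and> norm (U x y' - U x y) \<le> e)"
proof -
  obtain K where K: "K > 0" "\<And>x y. x \<in> {a..b} \<Longrightarrow> y \<in> {c..d} \<Longrightarrow> norm (Uy x y) \<le> K"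
    using norm_le_on_rectangle[OF cont] by blast
  have "uniformly_continuous_on ({a..b} \<times> {c..d}) (\<lambda>(x, y). Uy x y)"
    by (intro compact_uniformly_continuous cont compact_Times compact_Icc)
  then obtain \<delta> where \<delta>: "\<delta> > 0"
    "\<And>p q. p \<in> {a..b} \<times> {c..d} \<Longrightarrow> q \<in> {a..b} \<times> {c..d} \<Longrightarrow> dist q p < \<delta> \<Longrightarrow>
      dist ((\<lambda>(x, y). Uy x y) q) ((\<lambda>(x, y). Uy x y) p) < e"
    using e unfolding uniformly_continuous_on_def by meson
  \<comment> \<open>The second radius serves the plain increment, which is at most (K + e) |y' -
    y|.\<close>
  have "norm (U x y' - U x y - (y' - y) *\<^sub>R Uy x y) \<le> e * \<bar>y' - y\<bar> \<and> norm (U x y' - U x y) \<le> e"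
    if y': "y' \<in> {c..d}" "\<bar>y' - y\<bar> < min \<delta> (e / (K + e))" and x: "x \<in> {a..b}" for x y'
  proof
    have seg: "closed_segment y y' \<subseteq> {c..d}"
      using y y'(1) by (simp add: closed_segment_eq_real_ivl)
    have "norm (U x y' - U x y - (y' - y) *\<^sub>R Uy x y) \<le> norm (y' - y) * e"
    proof (rule vector_differentiable_bound_linearization)
      show "(U x has_vector_derivative Uy x t) (at t within closed_segment y y')"
        if "t \<in> closed_segment y y'" for t
        using der[OF x, of t] that seg by (blast intro: has_vector_derivative_within_subset)
      show "norm (Uy x t - Uy x y) \<le> e" if "t \<in> closed_segment y y'" for t
      proof -
        have t: "\<bar>t - y\<bar> \<le> \<bar>y' - y\<bar>" "t \<in> {c..d}"
          using that y y'(1) by (auto simp: closed_segment_eq_real_ivl split: if_splits)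
        then have "dist (x, t) (x, y) < \<delta>"
          using y'(2) by (simp add: dist_Pair_Pair dist_real_def)
        with \<delta>(2)[of "(x, y)" "(x, t)"] t x y show ?thesis
          by (auto simp: dist_norm)
      qed
    qed auto
    then show *: "norm (U x y' - U x y - (y' - y) *\<^sub>R Uy x y) \<le> e * \<bar>y' - y\<bar>"
      by (simp add: mult.commute)
    have "norm (U x y' - U x y) \<le> norm (U x y' - U x y - (y' - y) *\<^sub>R Uy x y) + norm ((y' - y) *\<^sub>R Uy x y)"
      by (metis diff_add_cancel norm_triangle_ineq)
    also have "\<dots> \<le> e * \<bar>y' - y\<bar> + \<bar>y' - y\<bar> * K"
      using * K(2)[OF x y] by (auto intro!: add_mono mult_left_mono)
    also have "\<dots> = (K + e) * \<bar>y' - y\<bar>" by (simp add: algebra_simps)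
    also have "\<dots> \<le> (K + e) * (e / (K + e))"
      using y'(2) K(1) e by (intro mult_left_mono) auto
    also have "\<dots> = e" using K(1) e by simp
    finally show "norm (U x y' - U x y) \<le> e" .
  qed
  moreover have "min \<delta> (e / (K + e)) > 0" using \<delta>(1) e K(1) by simp
  ultimately show ?thesis by blast
qed

text \<open>
  The discrepancy \<open>f x y' - f x y - (y' - y) W f\<close> satisfies the \<open>x\<close>-equation up to an error
  \<open>o(y' - y)\<close>, precisely because the curvature vanishes.
\<close>

lemma flat_transport:
  fixes U W Uy Wx :: "real \<Rightarrow> real \<Rightarrow> 'm::real_normed_vector"
    and f :: "real \<Rightarrow> real \<Rightarrow> 'a::real_inner"
  assumes mv: "bounded_bilinear mv" and ab: "a \<le> b"
    and U: "continuous_on ({a..b} \<times> {c..d}) (\<lambda>(x, y). U x y)"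
    and Uy: "\<And>x y. x \<in> {a..b} \<Longrightarrow> y \<in> {c..d} \<Longrightarrow>
      (U x has_vector_derivative Uy x y) (at y within {c..d})"
    and contUy: "continuous_on ({a..b} \<times> {c..d}) (\<lambda>(x, y). Uy x y)"
    and Wx: "\<And>x y. x \<in> {a..b} \<Longrightarrow> y \<in> {c..d} \<Longrightarrow>
      ((\<lambda>x. W x y) has_vector_derivative Wx x y) (at x within {a..b})"
    and flat: "\<And>x y v. x \<in> {a..b} \<Longrightarrow> y \<in> {c..d} \<Longrightarrow>
      mv (Uy x y) v + mv (U x y) (mv (W x y) v) = mv (Wx x y) v + mv (W x y) (mv (U x y) v)"
    and f: "\<And>x y. x \<in> {a..b} \<Longrightarrow> y \<in> {c..d} \<Longrightarrow>
      ((\<lambda>x. f x y) has_vector_derivative mv (U x y) (f x y)) (at x within {a..b})"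
    and fa: "\<And>y. y \<in> {c..d} \<Longrightarrow> (f a has_vector_derivative mv (W a y) (f a y)) (at y within {c..d})"
    and y: "y \<in> {c..d}"
  shows "(f b has_vector_derivative mv (W b y) (f b y)) (at y within {c..d})"
proof -
  interpret mv: bounded_bilinear mv by (fact mv)
  obtain B where B: "B > 0" "\<And>m x. norm (mv m x) \<le> norm m * norm x * B"
    using mv.pos_bounded by blast
  obtain D where D: "D > 0" "\<And>x y. x \<in> {a..b} \<Longrightarrow> y \<in> {c..d} \<Longrightarrow> norm (U x y) \<le> D"
    using norm_le_on_rectangle[OF U] by blast
  obtain F where F: "F > 0" "\<And>x. x \<in> {a..b} \<Longrightarrow> norm (f x y) \<le> F"
    using norm_le_on_interval[OF f[OF _ y]] by blast
  note Wf = mv.has_vector_derivative[OF Wx[OF _ y] f[OF _ y]]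
  obtain G where G: "G > 0" "\<And>x. x \<in> {a..b} \<Longrightarrow> norm (mv (W x y) (f x y)) \<le> G"
    using norm_le_on_interval[OF Wf] by blast
  \<comment> \<open>\<open>C\<close> is the amplification factor of
    \<open>perturbed_linear_ode_bound\<close> when the initial error is e |h| and the source is B (F
    + G) times that; hence \<open>e = \<epsilon> / C\<close> below.\<close>
  define C where "C = sqrt ((1 + (B * (F + G))\<^sup>2) * exp ((2 * (D * B) + 1) * (b - a)))"
  have "((1 + (B * (F + G))\<^sup>2) * exp ((2 * (D * B) + 1) * (b - a))) > 0"
    by (intro mult_pos_pos add_pos_nonneg) auto
  then have C0: "C > 0" and C2: "C\<^sup>2 = (1 + (B * (F + G))\<^sup>2) * exp ((2 * (D * B) + 1) * (b - a))"
    unfolding C_def by simp_all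
  \<comment> \<open>Differentiability of \<open>f b\<close> in \<open>y\<close> is part of the
    conclusion, so mixed derivatives of \<open>f\<close> cannot be exchanged; the definition of the
    derivative is verified directly.\<close>
  have "\<exists>\<delta>>0. \<forall>y'\<in>{c..d}. norm (y' - y) < \<delta> \<longrightarrow>
      norm (f b y' - f b y - (y' - y) *\<^sub>R mv (W b y) (f b y)) \<le> \<epsilon> * norm (y' - y)"
    if \<epsilon>: "\<epsilon> > 0" for \<epsilon>
  proof -
    define e where "e = \<epsilon> / C"
    have e: "e > 0" using \<epsilon> C0 by (simp add: e_def)
    obtain \<delta>1 where \<delta>1: "\<delta>1 > 0"
      "\<And>x y'. y' \<in> {c..d} \<Longrightarrow> \<bar>y' - y\<bar> < \<delta>1 \<Longrightarrow> x \<in> {a..b} \<Longrightarrow>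
        norm (U x y' - U x y - (y' - y) *\<^sub>R Uy x y) \<le> e * \<bar>y' - y\<bar>"
      "\<And>x y'. y' \<in> {c..d} \<Longrightarrow> \<bar>y' - y\<bar> < \<delta>1 \<Longrightarrow> x \<in> {a..b} \<Longrightarrow> norm (U x y' - U x y) \<le> e"
      using uniform_linearization[OF Uy contUy y e] by metis
    obtain \<delta>2 where \<delta>2: "\<delta>2 > 0"
      "\<And>y'. y' \<in> {c..d} \<Longrightarrow> \<bar>y' - y\<bar> < \<delta>2 \<Longrightarrow>
        norm (f a y' - f a y - (y' - y) *\<^sub>R mv (W a y) (f a y)) \<le> e * \<bar>y' - y\<bar>"
      using fa[OF y] e unfolding has_vector_derivative_def has_derivative_within_alt real_norm_def
      by blast
    have "norm (f b y' - f b y - (y' - y) *\<^sub>R mv (W b y) (f b y)) \<le> \<epsilon> * norm (y' - y)"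
      if y': "y' \<in> {c..d}" and "norm (y' - y) < min \<delta>1 \<delta>2" for y'
    proof -
      define h where "h = y' - y"
      have h: "\<bar>y' - y\<bar> < \<delta>1" "\<bar>y' - y\<bar> < \<delta>2" using that by auto
      define E where "E x = f x y' - f x y - h *\<^sub>R mv (W x y) (f x y)" for x
      define R where "R x = mv (U x y' - U x y - h *\<^sub>R Uy x y) (f x y)
        + h *\<^sub>R mv (U x y' - U x y) (mv (W x y) (f x y))" for x
      define \<rho> where "\<rho> = e * \<bar>h\<bar> * (B * (F + G))"
      have E': "(E has_vector_derivative mv (U x y') (E x) + R x) (at x within {a..b})"
        if x: "x \<in> {a..b}" for x
      proof -
        have "(E has_vector_derivative mv (U x y') (f x y') - mv (U x y) (f x y)
            - h *\<^sub>R (mv (W x y) (mv (U x y) (f x y)) + mv (Wx x y) (f x y))) (at x within {a..b})"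
          unfolding E_def
          by (intro has_vector_derivative_diff f x y y' Wf
              bounded_linear.has_vector_derivative[OF bounded_linear_scaleR_right])
        moreover have "mv (U x y') (f x y') - mv (U x y) (f x y)
            - h *\<^sub>R (mv (W x y) (mv (U x y) (f x y)) + mv (Wx x y) (f x y)) = mv (U x y') (E x) + R x"
        proof -
          \<comment> \<open>Flatness enters here: it cancels the terms of first order in
            \<open>h\<close>, and what is left in \<open>R\<close> is of order o(h).\<close>
          have "mv (W x y) (mv (U x y) (f x y)) + mv (Wx x y) (f x y)
              = mv (Uy x y) (f x y) + mv (U x y) (mv (W x y) (f x y))"
            using flat[OF x y, of "f x y"] by (simp add: add.commute)
          then show ?thesis
            unfolding E_def R_def
            by (simp only: mv.diff_left mv.diff_right mv.scaleR_left mv.scaleR_right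
                scaleR_add_right scaleR_diff_right) simp
        qed
        ultimately show ?thesis by simp
      qed
      have "(norm (E b))\<^sup>2 \<le> ((norm (E a))\<^sup>2 + \<rho>\<^sup>2) * exp ((2 * (D * B) + 1) * (b - a))"
      proof (rule perturbed_linear_ode_bound[OF ab E'])
        fix x assume x: "x \<in> {a..b}"
        have "norm (mv (U x y' - U x y - h *\<^sub>R Uy x y) (f x y))
            \<le> norm (U x y' - U x y - h *\<^sub>R Uy x y) * norm (f x y) * B"
          by (rule B)
        also have "\<dots> \<le> (e * \<bar>h\<bar>) * F * B"
          using \<delta>1(2)[OF y' h(1) x] F(2)[OF x] B(1) e
          by (intro mult_right_mono mult_mono) (auto simp: h_def)
        finally have r1: "norm (mv (U x y' - U x y - h *\<^sub>R Uy x y) (f x y)) \<le> (e * \<bar>h\<bar>) * F * B" .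
        have "norm (mv (U x y' - U x y) (mv (W x y) (f x y)))
            \<le> norm (U x y' - U x y) * norm (mv (W x y) (f x y)) * B"
          by (rule B)
        also have "\<dots> \<le> e * G * B"
          using \<delta>1(3)[OF y' h(1) x] G(2)[OF x] B(1) e
          by (intro mult_right_mono mult_mono) auto
        finally have "\<bar>h\<bar> * norm (mv (U x y' - U x y) (mv (W x y) (f x y))) \<le> \<bar>h\<bar> * (e * G * B)"
          by (intro mult_left_mono) auto
        with r1 have R: "norm (R x) \<le> \<rho>"
          unfolding R_def \<rho>_def
          by (intro order_trans[OF norm_triangle_ineq]) (simp add: algebra_simps)
        have "E x \<bullet> (mv (U x y') (E x) + R x) \<le> norm (E x) * norm (mv (U x y') (E x)) + norm (E x) * norm (R x)"
          unfolding inner_add_right by (intro add_mono norm_cauchy_schwarz)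
        also have "\<dots> \<le> norm (E x) * (D * norm (E x) * B) + norm (E x) * \<rho>"
        proof (intro add_mono mult_left_mono R)
          have "norm (mv (U x y') (E x)) \<le> norm (U x y') * norm (E x) * B" by (rule B)
          also have "\<dots> \<le> D * norm (E x) * B"
            using D(2)[OF x y'] B(1) by (intro mult_right_mono) auto
          finally show "norm (mv (U x y') (E x)) \<le> D * norm (E x) * B" .
        qed auto
        finally show "E x \<bullet> (mv (U x y') (E x) + R x) \<le> D * B * (norm (E x))\<^sup>2 + \<rho> * norm (E x)"
          by (simp add: power2_eq_square algebra_simps)
      qed (use D B ab in auto)
      also have "\<dots> \<le> ((e * \<bar>h\<bar>)\<^sup>2 + \<rho>\<^sup>2) * exp ((2 * (D * B) + 1) * (b - a))"
        using \<delta>2(2)[OF y' h(2)] by (intro mult_right_mono add_right_mono power_mono) (auto simp: E_def h_def)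
      also have "\<dots> = (e * \<bar>h\<bar>)\<^sup>2 * C\<^sup>2"
        unfolding C2 \<rho>_def power_mult_distrib[of "e * \<bar>h\<bar>" "B * (F + G)"] by (simp add: algebra_simps)
      also have "\<dots> = (\<epsilon> * norm (y' - y))\<^sup>2"
        using C0 by (simp add: e_def h_def power_mult_distrib power_divide)
      finally show ?thesis
        using \<epsilon> unfolding E_def h_def by (auto intro: power2_le_imp_le)
    qed
    then show ?thesis using \<delta>1(1) \<delta>2(1) by (intro exI[of _ "min \<delta>1 \<delta>2"]) auto
  qed
  then show ?thesis
    unfolding has_vector_derivative_def has_derivative_within_alt
    by (auto intro: bounded_linear_scaleR_left)
qed

section \<open>Two-dimensional systems with a large diagonal part\<close>

lemma inner_mult_self: "r \<bullet> (z * r) = Re z * (cmod r)\<^sup>2"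
  unfolding cmod_power2 by (simp add: inner_complex_def power2_eq_square algebra_simps)

lemma norm_bound_of_deriv:
  fixes f :: "real \<Rightarrow> 'a::real_normed_vector"
  assumes "\<And>x. x \<in> {0..1} \<Longrightarrow> (f has_vector_derivative f' x) (at x within {0..1})"
    and "\<And>x. x \<in> {0..1} \<Longrightarrow> norm (f' x) \<le> K" and "x \<in> {0..1}"
  shows "norm (f x - f 0) \<le> K"
proof -
  have "norm (f x - f 0) \<le> K * norm (x - 0)"
  proof (rule differentiable_bound)
    show "(f has_derivative (\<lambda>h. h *\<^sub>R f' t)) (at t within {0..1})" if "t \<in> {0..1}" for t
      using assms(1)[OF that] by (simp add: has_vector_derivative_def)
    show "onorm (\<lambda>h. h *\<^sub>R f' t) \<le> K" if "t \<in> {0..1}" for t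
      using assms(2)[OF that] by (intro onorm_le) (simp, metis abs_ge_zero mult.commute mult_left_mono)
  qed (use assms(3) in auto)
  also have "\<dots> \<le> K * 1"
    using order_trans[OF norm_ge_zero assms(2)[OF assms(3)]] assms(3) by (intro mult_left_mono) auto
  finally show ?thesis by simp
qed

text \<open>Only the real part of \<open>z\<close> contributes to the derivative of the energy |r|^2
  + |s|^2, so the bound is independent of the large frequency \<open>Im z\<close>.\<close>

lemma system_bounded:
  fixes r s g1 g2 :: "real \<Rightarrow> complex"
  assumes r: "\<And>x. x \<in> {0..1} \<Longrightarrow> (r has_vector_derivative z * r x + g1 x) (at x within {0..1})"
    and s: "\<And>x. x \<in> {0..1} \<Longrightarrow> (s has_vector_derivative - z * s x + g2 x) (at x within {0..1})"
    and g1: "\<And>x. x \<in> {0..1} \<Longrightarrow> cmod (g1 x) \<le> K * (cmod (r x) + cmod (s x))"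
    and g2: "\<And>x. x \<in> {0..1} \<Longrightarrow> cmod (g2 x) \<le> K * (cmod (r x) + cmod (s x))"
    and z: "\<bar>Re z\<bar> \<le> K" and x: "x \<in> {0..1}"
  shows "(cmod (r x))\<^sup>2 + (cmod (s x))\<^sup>2 \<le> ((cmod (r 0))\<^sup>2 + (cmod (s 0))\<^sup>2) * exp (6 * K + 1)"
proof -
  have K: "K \<ge> 0" using z by linarith
  define e where "e x = (r x, s x)" for x
  have "(norm (e x))\<^sup>2 \<le> ((norm (e 0))\<^sup>2 + 0\<^sup>2) * exp ((2 * (3 * K) + 1) * (1 - 0))"
  proof (rule perturbed_linear_ode_bound)
    fix x :: real assume x: "x \<in> {0..1}"
    show "(e has_vector_derivative (z * r x + g1 x, - z * s x + g2 x)) (at x within {0..1})"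
      unfolding e_def by (intro has_vector_derivative_Pair r s x)
    have "e x \<bullet> (z * r x + g1 x, - z * s x + g2 x)
        = Re z * ((cmod (r x))\<^sup>2 - (cmod (s x))\<^sup>2) + (r x \<bullet> g1 x + s x \<bullet> g2 x)"
      using inner_mult_self[of "s x" "- z"]
      by (simp add: e_def inner_add_right inner_mult_self algebra_simps)
    also have "\<dots> \<le> K * ((cmod (r x))\<^sup>2 + (cmod (s x))\<^sup>2) + K * (cmod (r x) + cmod (s x))\<^sup>2"
    proof (rule add_mono)
      have "Re z * ((cmod (r x))\<^sup>2 - (cmod (s x))\<^sup>2) \<le> \<bar>Re z\<bar> * \<bar>(cmod (r x))\<^sup>2 - (cmod (s x))\<^sup>2\<bar>"
        by (metis abs_ge_self abs_mult)
      also have "\<dots> \<le> K * ((cmod (r x))\<^sup>2 + (cmod (s x))\<^sup>2)"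
        using z K by (intro mult_mono) (auto simp: abs_le_iff)
      finally show "Re z * ((cmod (r x))\<^sup>2 - (cmod (s x))\<^sup>2) \<le> K * ((cmod (r x))\<^sup>2 + (cmod (s x))\<^sup>2)" .
      have "r x \<bullet> g1 x \<le> cmod (r x) * (K * (cmod (r x) + cmod (s x)))"
        by (rule order_trans[OF norm_cauchy_schwarz mult_left_mono[OF g1[OF x]]]) simp
      moreover have "s x \<bullet> g2 x \<le> cmod (s x) * (K * (cmod (r x) + cmod (s x)))"
        by (rule order_trans[OF norm_cauchy_schwarz mult_left_mono[OF g2[OF x]]]) simp
      ultimately show "r x \<bullet> g1 x + s x \<bullet> g2 x \<le> K * (cmod (r x) + cmod (s x))\<^sup>2"
        by (simp add: power2_eq_square algebra_simps)
    qed
    also have "\<dots> \<le> 3 * K * ((cmod (r x))\<^sup>2 + (cmod (s x))\<^sup>2)"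
    proof -
      have "K * (cmod (r x) + cmod (s x))\<^sup>2 \<le> K * (2 * ((cmod (r x))\<^sup>2 + (cmod (s x))\<^sup>2))"
        using K sum_squares_bound[of "cmod (r x)" "cmod (s x)"]
        by (intro mult_left_mono) (auto simp: power2_eq_square algebra_simps)
      then show ?thesis by (simp add: algebra_simps)
    qed
    finally show "e x \<bullet> (z * r x + g1 x, - z * s x + g2 x) \<le> 3 * K * (norm (e x))\<^sup>2 + 0 * norm (e x)"
      by (simp add: e_def norm_Pair)
  qed (use K x in auto)
  then show ?thesis by (simp add: e_def norm_Pair)
qed

text \<open>The cone \<open>2 |s| < |r|\<close> is invariant, and solutions in it grow like \<open>exp (Re z t)\<close>.\<close>

lemma system_growth:
  fixes r s g1 g2 :: "real \<Rightarrow> complex"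
  assumes ab: "a \<le> b"
    and r: "\<And>t. t \<in> {a..b} \<Longrightarrow> (r has_vector_derivative z * r t + g1 t) (at t within {a..b})"
    and s: "\<And>t. t \<in> {a..b} \<Longrightarrow> (s has_vector_derivative - z * s t + g2 t) (at t within {a..b})"
    and g1: "\<And>t. t \<in> {a..b} \<Longrightarrow> cmod (g1 t) \<le> K * (cmod (r t) + cmod (s t))"
    and g2: "\<And>t. t \<in> {a..b} \<Longrightarrow> cmod (g2 t) \<le> K * (cmod (r t) + cmod (s t))"
    and z: "Re z \<ge> 8 * K" and K: "K \<ge> 0"
    and r0: "r a = 1" and s0: "s a = 0"
  shows "exp ((2 * Re z - 7 * K) * (b - a)) \<le> (cmod (r b))\<^sup>2 - 4 * (cmod (s b))\<^sup>2"
proof -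
  define E where "E t = (cmod (r t))\<^sup>2 - 4 * (cmod (s t))\<^sup>2" for t
  define L where "L = 2 * Re z - 7 * K"
  have "E a * exp (L * (b - a)) \<le> E b"
  proof (rule gronwall_lower[OF ab])
    fix t assume t: "t \<in> {a..b}"
    show "(E has_vector_derivative 2 * (r t \<bullet> (z * r t + g1 t)) - 4 * (2 * (s t \<bullet> (- z * s t + g2 t))))
        (at t within {a..b})"
      unfolding E_def
      by (intro has_vector_derivative_diff has_vector_derivative_norm_sq r s t
          has_vector_derivative_mult_right)
    define p q where "p = cmod (r t)" and "q = cmod (s t)"
    have "\<bar>r t \<bullet> g1 t\<bar> \<le> p * (K * (p + q))"
      unfolding p_def q_def
      by (rule order_trans[OF Cauchy_Schwarz_ineq2 mult_left_mono[OF g1[OF t]]]) simp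
    moreover have "\<bar>s t \<bullet> g2 t\<bar> \<le> q * (K * (p + q))"
      unfolding p_def q_def
      by (rule order_trans[OF Cauchy_Schwarz_ineq2 mult_left_mono[OF g2[OF t]]]) simp
    moreover have "r t \<bullet> (z * r t + g1 t) = Re z * p\<^sup>2 + r t \<bullet> g1 t"
      "s t \<bullet> (- z * s t + g2 t) = - Re z * q\<^sup>2 + s t \<bullet> g2 t"
      unfolding p_def q_def
      by (simp_all only: inner_add_right inner_mult_self uminus_complex.sel(1))
    ultimately have "2 * (r t \<bullet> (z * r t + g1 t)) - 4 * (2 * (s t \<bullet> (- z * s t + g2 t)))
        \<ge> 2 * Re z * p\<^sup>2 - 2 * (p * (K * (p + q))) + 8 * Re z * q\<^sup>2 - 8 * (q * (K * (p + q)))"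
      by (simp add: algebra_simps)
    \<comment> \<open>The loss \<open>7 * K\<close> in the rate \<open>L\<close> is chosen so that
      the \<open>p\<^sup>2\<close> and \<open>p * q\<close> terms form a complete square; the
      remaining coefficient of \<open>q\<^sup>2\<close> is nonnegative because
      \<open>Re z \<ge> 8 * K\<close>.\<close>
    moreover have "2 * Re z * p\<^sup>2 - 2 * (p * (K * (p + q))) + 8 * Re z * q\<^sup>2 - 8 * (q * (K * (p + q)))
        = L * (p\<^sup>2 - 4 * q\<^sup>2) + (5 * K * (p - q)\<^sup>2 + (16 * Re z - 41 * K) * q\<^sup>2)"
      by (simp add: L_def power2_eq_square algebra_simps)
    moreover have "0 \<le> 5 * K * (p - q)\<^sup>2 + (16 * Re z - 41 * K) * q\<^sup>2"
      using z K by (intro add_nonneg_nonneg mult_nonneg_nonneg) auto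
    ultimately show "L * E t \<le> 2 * (r t \<bullet> (z * r t + g1 t)) - 4 * (2 * (s t \<bullet> (- z * s t + g2 t)))"
      by (simp add: E_def p_def q_def)
  qed
  then show ?thesis by (simp add: E_def L_def r0 s0)
qed

lemma system_growth_backward:
  fixes r s g1 g2 :: "real \<Rightarrow> complex"
  assumes ab: "a \<le> b"
    and r: "\<And>t. t \<in> {a..b} \<Longrightarrow> (r has_vector_derivative - z * r t + g1 t) (at t within {a..b})"
    and s: "\<And>t. t \<in> {a..b} \<Longrightarrow> (s has_vector_derivative z * s t + g2 t) (at t within {a..b})"
    and g1: "\<And>t. t \<in> {a..b} \<Longrightarrow> cmod (g1 t) \<le> K * (cmod (r t) + cmod (s t))"
    and g2: "\<And>t. t \<in> {a..b} \<Longrightarrow> cmod (g2 t) \<le> K * (cmod (r t) + cmod (s t))"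
    and z: "Re z \<ge> 8 * K" and K: "K \<ge> 0"
    and "r b = 1" and "s b = 0"
  shows "exp ((2 * Re z - 7 * K) * (b - a)) \<le> (cmod (r a))\<^sup>2 - 4 * (cmod (s a))\<^sup>2"
proof -
  have "exp ((2 * Re z - 7 * K) * (b - a)) \<le> (cmod (r (a + b - b)))\<^sup>2 - 4 * (cmod (s (a + b - b)))\<^sup>2"
  proof (rule system_growth[where r = "\<lambda>t. r (a + b - t)" and s = "\<lambda>t. s (a + b - t)", OF ab _ _ _ _ z K])
    fix t assume t: "t \<in> {a..b}"
    then have t': "a + b - t \<in> {a..b}" by auto
    show "((\<lambda>t. r (a + b - t)) has_vector_derivative z * r (a + b - t) + - g1 (a + b - t)) (at t within {a..b})"
      using has_vector_derivative_reflect_interval[OF r t] by simp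
    show "((\<lambda>t. s (a + b - t)) has_vector_derivative - z * s (a + b - t) + - g2 (a + b - t)) (at t within {a..b})"
      using has_vector_derivative_reflect_interval[OF s t] by simp
    show "cmod (- g1 (a + b - t)) \<le> K * (cmod (r (a + b - t)) + cmod (s (a + b - t)))"
      "cmod (- g2 (a + b - t)) \<le> K * (cmod (r (a + b - t)) + cmod (s (a + b - t)))"
      using g1[OF t'] g2[OF t'] by simp_all
  qed (simp_all add: assms)
  then show ?thesis by simp
qed

text \<open>
  The correction \<open>h = s - w r / (2 z)\<close> removes the oscillating source \<open>w r\<close> to leading order in
  \<open>1 / z\<close>.
\<close>

lemma system_oscillation:
  fixes r s a1 a2 w w' :: "real \<Rightarrow> complex"
  assumes r: "\<And>x. x \<in> {0..1} \<Longrightarrow> (r has_vector_derivative z * r x + w x * s x + a1 x) (at x within {0..1})"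
    and s: "\<And>x. x \<in> {0..1} \<Longrightarrow> (s has_vector_derivative - z * s x + w x * r x + a2 x) (at x within {0..1})"
    and w: "\<And>x. x \<in> {0..1} \<Longrightarrow> (w has_vector_derivative w' x) (at x within {0..1})"
    and wK: "\<And>x. x \<in> {0..1} \<Longrightarrow> cmod (w x) \<le> K" "\<And>x. x \<in> {0..1} \<Longrightarrow> cmod (w' x) \<le> K"
    and B: "\<And>x. x \<in> {0..1} \<Longrightarrow> cmod (r x) \<le> B" "\<And>x. x \<in> {0..1} \<Longrightarrow> cmod (s x) \<le> B"
    and a1: "\<And>x. x \<in> {0..1} \<Longrightarrow> cmod (a1 x) \<le> K / cmod z"
    and a2: "\<And>x. x \<in> {0..1} \<Longrightarrow> cmod (a2 x) \<le> K / cmod z"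
    and z: "\<bar>Re z\<bar> \<le> 1" "1 \<le> cmod z" and K: "K \<ge> 1" and B1: "B \<ge> 1"
    and s0: "s 0 = 0" and x: "x \<in> {0..1}"
  shows "cmod (s x) \<le> 27 * K\<^sup>2 * B / cmod z"
    and "cmod (w x * s x + a1 x) \<le> 28 * K ^ 3 * B / cmod z"
proof -
  have z0: "z \<noteq> 0" using z(2) by auto
  define h where "h x = s x - w x * r x / (2 * z)" for x
  define g where "g x = a2 x - (w' x * r x + w x * (w x * s x + a1 x)) / (2 * z)" for x
  define \<rho> where "\<rho> = 3 * K\<^sup>2 * B / cmod z"
  have K2: "K \<le> K\<^sup>2" "1 \<le> K\<^sup>2" using K by (auto intro: self_le_power one_le_power)
  have \<rho>0: "\<rho> \<ge> 0" using K B1 by (simp add: \<rho>_def)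
  have wr: "cmod (w x * r x / (2 * z)) \<le> \<rho>" if x: "x \<in> {0..1}" for x
  proof -
    have "cmod (w x * r x / (2 * z)) \<le> K * B / (2 * cmod z)"
      using wK(1)[OF x] B(1)[OF x] K z(2) by (simp add: norm_mult norm_divide divide_right_mono mult_mono)
    also have "\<dots> \<le> 3 * K\<^sup>2 * B / cmod z"
    proof -
      have "K * B \<le> 6 * K\<^sup>2 * B" using K2 B1 by (intro mult_right_mono) auto
      then have "(K * B / 2) / cmod z \<le> 3 * K\<^sup>2 * B / cmod z" by (intro divide_right_mono) auto
      then show ?thesis by simp
    qed
    finally show ?thesis by (simp add: \<rho>_def)
  qed
  have h': "(h has_vector_derivative - z * h x + g x) (at x within {0..1})" if x: "x \<in> {0..1}" for x
  proof -
    have "(h has_vector_derivative (- z * s x + w x * r x + a2 x)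
        - (w x * (z * r x + w x * s x + a1 x) + w' x * r x) / (2 * z)) (at x within {0..1})"
      unfolding h_def
      by (intro has_vector_derivative_diff s x has_vector_derivative_divide has_vector_derivative_mult w r)
    moreover have "(- z * s x + w x * r x + a2 x) - (w x * (z * r x + w x * s x + a1 x) + w' x * r x) / (2 * z)
        = - z * h x + g x"
      using z0 by (simp add: h_def g_def field_simps)
    ultimately show ?thesis by simp
  qed
  have g: "cmod (g x) \<le> \<rho>" if x: "x \<in> {0..1}" for x
  proof -
    have a: "cmod (a1 x) \<le> K"
      using a1[OF x] divide_left_mono[of 1 "cmod z" K] z(2) K z0 by simp
    have ws: "cmod (w x * s x) \<le> K * B" and "cmod (w' x * r x) \<le> K * B"
      unfolding norm_mult by (intro mult_mono wK B x; use K in auto)+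
    moreover have "cmod (w x * (w x * s x + a1 x)) \<le> K * (K * B + K)"
      using mult_mono[OF wK(1)[OF x] norm_triangle_mono[OF ws a]] K by (simp add: norm_mult)
    ultimately have "cmod (w' x * r x + w x * (w x * s x + a1 x)) \<le> K * B + K * (K * B + K)"
      by (intro norm_triangle_mono)
    also have "\<dots> \<le> 4 * K\<^sup>2 * B"
    proof -
      have "K * B \<le> K\<^sup>2 * B" using K2 B1 by (intro mult_right_mono) auto
      moreover have "K\<^sup>2 \<le> K\<^sup>2 * B" using K2 B1 by (simp add: mult_le_cancel_left1)
      moreover have "K * B + K * (K * B + K) = K * B + K\<^sup>2 * B + K\<^sup>2"
        by (simp add: power2_eq_square algebra_simps)
      moreover have "0 \<le> K\<^sup>2 * B" using B1 by simp
      ultimately show ?thesis by linarith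
    qed
    finally have "cmod ((w' x * r x + w x * (w x * s x + a1 x)) / (2 * z)) \<le> 4 * K\<^sup>2 * B / (2 * cmod z)"
      unfolding norm_divide[of _ "2 * z"] norm_mult[of 2 z] norm_numeral
      by (rule divide_right_mono) simp
    moreover have "cmod (a2 x) \<le> K\<^sup>2 * B / cmod z"
    proof -
      have "K * 1 \<le> K\<^sup>2 * B" using K2 B1 K by (intro mult_mono) auto
      then have "K / cmod z \<le> K\<^sup>2 * B / cmod z" by (intro divide_right_mono) auto
      with a2[OF x] show ?thesis by linarith
    qed
    ultimately have "cmod (g x) \<le> K\<^sup>2 * B / cmod z + 4 * K\<^sup>2 * B / (2 * cmod z)"
      unfolding g_def by (intro order_trans[OF norm_triangle_ineq4 add_mono])
    also have "\<dots> = \<rho>" by (simp add: \<rho>_def field_simps)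
    finally show ?thesis .
  qed
  have "(norm (h x))\<^sup>2 \<le> ((norm (h 0))\<^sup>2 + \<rho>\<^sup>2) * exp ((2 * 1 + 1) * (1 - 0))"
  proof (rule perturbed_linear_ode_bound[OF _ h'])
    fix x :: real assume x: "x \<in> {0..1}"
    have "h x \<bullet> (- z * h x + g x) = - Re z * (cmod (h x))\<^sup>2 + h x \<bullet> g x"
      by (simp only: inner_add_right inner_mult_self uminus_complex.sel(1))
    also have "\<dots> \<le> 1 * (cmod (h x))\<^sup>2 + \<rho> * cmod (h x)"
    proof (intro add_mono mult_right_mono)
      have "h x \<bullet> g x \<le> cmod (h x) * cmod (g x)" by (rule norm_cauchy_schwarz)
      also have "\<dots> \<le> cmod (h x) * \<rho>" by (intro mult_left_mono g x) auto
      finally show "h x \<bullet> g x \<le> \<rho> * cmod (h x)" by (simp add: mult.commute)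
    qed (use z in auto)
    finally show "h x \<bullet> (- z * h x + g x) \<le> 1 * (cmod (h x))\<^sup>2 + \<rho> * cmod (h x)" .
  qed (use x in auto)
  \<comment> \<open>Since \<open>s 0 = 0\<close>, the initial value of \<open>h\<close> is the
    correction alone and is at most \<open>\<rho>\<close>. Any bound on \<open>exp 3\<close> works;
    32 makes the total a perfect square.\<close>
  also have "\<dots> \<le> (\<rho>\<^sup>2 + \<rho>\<^sup>2) * 32"
  proof (intro mult_mono add_right_mono power_mono)
    show "cmod (h 0) \<le> \<rho>" using wr[of 0] by (simp add: h_def s0)
    have "exp (3::real) = exp 1 ^ 3" by (simp flip: exp_of_nat_mult)
    also have "\<dots> \<le> (272/100) ^ 3" using e_less_272 by (intro power_mono) auto
    also have "\<dots> \<le> 32" by (simp add: power_divide)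
    finally show "exp ((2 * 1 + 1) * (1 - 0 :: real)) \<le> 32" by simp
  qed auto
  also have "\<dots> = (8 * \<rho>)\<^sup>2" by (simp add: power2_eq_square)
  finally have "cmod (h x) \<le> 8 * \<rho>" using \<rho>0 by (auto intro: power2_le_imp_le)
  moreover have "s x = h x + w x * r x / (2 * z)" by (simp add: h_def)
  ultimately have s9: "cmod (s x) \<le> 9 * \<rho>"
    using wr[OF x] norm_triangle_ineq[of "h x" "w x * r x / (2 * z)"] by simp
  then show "cmod (s x) \<le> 27 * K\<^sup>2 * B / cmod z" by (simp add: \<rho>_def)
  have "cmod (w x * s x + a1 x) \<le> K * (9 * \<rho>) + K / cmod z"
  proof (intro norm_triangle_mono a1 x)
    show "cmod (w x * s x) \<le> K * (9 * \<rho>)"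
      unfolding norm_mult by (intro mult_mono s9 wK x) (use K in auto)
  qed
  also have "\<dots> = (27 * K ^ 3 * B + K) / cmod z"
    by (simp add: \<rho>_def power2_eq_square power3_eq_cube add_divide_distrib algebra_simps)
  also have "\<dots> \<le> 28 * K ^ 3 * B / cmod z"
  proof (rule divide_right_mono)
    have "K * 1 \<le> K ^ 3 * B"
      using K B1 by (intro mult_mono) (auto intro: self_le_power)
    then show "27 * K ^ 3 * B + K \<le> 28 * K ^ 3 * B" by linarith
  qed simp
  finally show "cmod (w x * s x + a1 x) \<le> 28 * K ^ 3 * B / cmod z" .
qed

section \<open>Binary quadratic forms\<close>

text \<open>The values are those of \<open>g X\<^sup>2 + h X Y + k Y\<^sup>2\<close> at \<open>(1, \<sigma>)\<close>, \<open>(\<tau>, 1)\<close> and \<open>(1, 1)\<close>.\<close>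

lemma quadratic_form_small:
  fixes g h k \<sigma> \<tau> :: complex
  assumes e: "e \<ge> 0" and s: "cmod \<sigma> \<le> 1/2" "cmod (g + h * \<sigma> + k * \<sigma>\<^sup>2) \<le> e"
    and t: "cmod \<tau> \<le> 1/2" "cmod (g * \<tau>\<^sup>2 + h * \<tau> + k) \<le> e"
    and gh: "g + h + k = 0 \<or> h\<^sup>2 = 4 * g * k"
  shows "cmod g \<le> 4 * e \<and> cmod h \<le> 8 * e \<and> cmod k \<le> 4 * e"
  using gh
proof
  have *: "cmod a \<le> 2 * e" if "cmod \<sigma> \<le> 1/2" "cmod ((1 - \<sigma>) * a) \<le> e" for \<sigma> a :: complex
  proof -
    have "1/2 \<le> cmod (1 - \<sigma>)" using norm_triangle_ineq2[of 1 \<sigma>] that(1) by simp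
    then have "1/2 * cmod a \<le> cmod (1 - \<sigma>) * cmod a" by (intro mult_right_mono) auto
    then show ?thesis using that(2) by (simp add: norm_mult)
  qed
  assume "g + h + k = 0"
  then have h: "h = - g - k" by (simp add: algebra_simps eq_neg_iff_add_eq_0)
  \<comment> \<open>A form vanishing at (1, 1) has the factor X - Y, and this factor is at least 1/2
    in modulus at the other two points. The remaining linear factor yields two coupled bounds for
    \<open>g\<close> and \<open>k\<close>, which the factor 1/2 decouples.\<close>
  have "(1 - \<sigma>) * (g - k * \<sigma>) = g + h * \<sigma> + k * \<sigma>\<^sup>2"
    by (simp add: h power2_eq_square algebra_simps)
  then have 1: "cmod (g - k * \<sigma>) \<le> 2 * e" using *[OF s(1)] s(2) by simp
  have "(1 - \<tau>) * (k - g * \<tau>) = g * \<tau>\<^sup>2 + h * \<tau> + k"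
    by (simp add: h power2_eq_square algebra_simps)
  then have 2: "cmod (k - g * \<tau>) \<le> 2 * e" using *[OF t(1)] t(2) by simp
  have "cmod (k * \<sigma>) \<le> cmod k / 2" "cmod (g * \<tau>) \<le> cmod g / 2"
    using mult_left_mono[OF s(1), of "cmod k"] mult_left_mono[OF t(1), of "cmod g"]
    by (simp_all add: norm_mult)
  then have "cmod g \<le> 2 * e + cmod k / 2" "cmod k \<le> 2 * e + cmod g / 2"
    using 1 2 norm_triangle_sub[of g "k * \<sigma>"] norm_triangle_sub[of k "g * \<tau>"] by linarith+
  then have "cmod g \<le> 4 * e" "cmod k \<le> 4 * e" by linarith+
  moreover have "cmod h \<le> cmod g + cmod k" unfolding h by (metis norm_minus_cancel norm_triangle_ineq4)
  ultimately show ?thesis by linarith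
next
  assume h2: "h\<^sup>2 = 4 * g * k"
  \<comment> \<open>With a double root the form is the square of a linear form x X + y Y, where the
    sign of the root of \<open>k\<close> is fitted to \<open>h\<close>. The linear form is bounded
    by \<open>sqrt e\<close>, and squaring at the end restores the order \<open>e\<close>.\<close>
  define x y' where "x = csqrt g" and "y' = csqrt k"
  have "h\<^sup>2 = (2 * x * y')\<^sup>2" by (simp add: h2 x_def y'_def power_mult_distrib)
  then obtain y where y: "h = 2 * x * y" "k = y\<^sup>2"
    unfolding power2_eq_iff by (metis mult_minus_right power2_csqrt power2_minus y'_def)
  have g: "g = x\<^sup>2" by (simp add: x_def)
  have "(x + y * \<sigma>)\<^sup>2 = g + h * \<sigma> + k * \<sigma>\<^sup>2" "(y + x * \<tau>)\<^sup>2 = g * \<tau>\<^sup>2 + h * \<tau> + k"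
    by (simp_all add: g y power2_eq_square algebra_simps)
  then have "(cmod (x + y * \<sigma>))\<^sup>2 \<le> e" "(cmod (y + x * \<tau>))\<^sup>2 \<le> e"
    using s(2) t(2) by (simp_all flip: norm_power)
  then have 1: "cmod (x + y * \<sigma>) \<le> sqrt e" "cmod (y + x * \<tau>) \<le> sqrt e"
    by (auto intro: real_le_rsqrt)
  have "cmod (y * \<sigma>) \<le> cmod y / 2" "cmod (x * \<tau>) \<le> cmod x / 2"
    using mult_left_mono[OF s(1), of "cmod y"] mult_left_mono[OF t(1), of "cmod x"]
    by (simp_all add: norm_mult)
  moreover have "cmod x \<le> cmod (x + y * \<sigma>) + cmod (y * \<sigma>)" "cmod y \<le> cmod (y + x * \<tau>) + cmod (x * \<tau>)"
    by (metis add_diff_cancel_right' norm_triangle_ineq4)+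
  ultimately have xy: "cmod x \<le> 2 * sqrt e" "cmod y \<le> 2 * sqrt e"
    using 1 by linarith+
  have pr: "cmod a * cmod b \<le> 4 * e" if "cmod a \<le> 2 * sqrt e" "cmod b \<le> 2 * sqrt e" for a b :: complex
    using mult_mono[OF that] e by simp
  show ?thesis
    using pr[OF xy(1) xy(1)] pr[OF xy(2) xy(2)] pr[OF xy]
    by (simp add: g y norm_mult norm_power power2_eq_square)
qed

section \<open>The flat connection of a solution on a period rectangle\<close>

text \<open>Matrices are pairs of rows here, so that norms, inner products and componentwise
  derivatives are those of the product type.\<close>

definition mv2 :: "(complex \<times> complex) \<times> (complex \<times> complex) \<Rightarrow> complex \<times> complex \<Rightarrow> complex \<times> complex" where
  "mv2 m v = (fst (fst m) * fst v + snd (fst m) * snd v, fst (snd m) * fst v + snd (snd m) * snd v)"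

lemma bounded_bilinear_mv2: "bounded_bilinear mv2"
  unfolding bilinear_conv_bounded_bilinear[symmetric] bilinear_def
  by (auto intro!: linearI simp: mv2_def algebra_simps scaleR_prod_def)

lemma has_vector_derivative_exp:
  fixes f :: "real \<Rightarrow> complex"
  assumes "(f has_vector_derivative f') (at t within S)"
  shows "((\<lambda>t. exp (f t)) has_vector_derivative f' * exp (f t)) (at t within S)"
  using field_vector_diff_chain_within[OF assms DERIV_subset[OF DERIV_exp[of "f t"] subset_UNIV]]
  by (simp add: o_def)

definition hat_r :: "complex \<Rightarrow> complex \<Rightarrow> complex \<times> complex \<Rightarrow> complex" where
  "hat_r \<nu> U v = fst v * exp (- U / 4) + \<i> * (snd v * exp (U / 4)) / \<nu>"

definition hat_s :: "complex \<Rightarrow> complex \<Rightarrow> complex \<times> complex \<Rightarrow> complex" where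
  "hat_s \<nu> U v = fst v * exp (- U / 4) - \<i> * (snd v * exp (U / 4)) / \<nu>"

definition unhat :: "complex \<Rightarrow> complex \<Rightarrow> complex \<Rightarrow> complex \<Rightarrow> complex \<times> complex" where
  "unhat \<nu> U r s = ((r + s) * exp (U / 4) / 2, \<nu> * (r - s) * exp (- U / 4) / (2 * \<i>))"

lemma hat_unhat:
  assumes "\<nu> \<noteq> 0"
  shows "hat_r \<nu> U (unhat \<nu> U r s) = r" "hat_s \<nu> U (unhat \<nu> U r s) = s"
proof -
  define e where "e = exp (U / 4)"
  have e: "e \<noteq> 0" and m: "exp (- U / 4) = 1 / e"
    by (simp_all add: e_def exp_minus inverse_eq_divide)
  show "hat_r \<nu> U (unhat \<nu> U r s) = r" "hat_s \<nu> U (unhat \<nu> U r s) = s"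
    unfolding hat_r_def hat_s_def unhat_def m e_def[symmetric]
    using assms e by (simp_all add: field_simps)
qed

text \<open>The gauge multiplies determinants by a constant that does not depend on
  \<open>U\<close>. Wronskian identities therefore pass to the coordinates \<open>r, s\<close> at
  every point with the same factor.\<close>

lemma hat_det:
  assumes "\<nu> \<noteq> 0"
  shows "hat_r \<nu> U v * hat_s \<nu> U v' - hat_s \<nu> U v * hat_r \<nu> U v'
    = - 2 * \<i> / \<nu> * (fst v * snd v' - snd v * fst v')"
proof -
  define e where "e = exp (U / 4)"
  have e: "e \<noteq> 0" and m: "exp (- U / 4) = 1 / e"
    by (simp_all add: e_def exp_minus inverse_eq_divide)
  show ?thesis
    unfolding hat_r_def hat_s_def m e_def[symmetric]
    using assms e by (simp add: field_simps)
qed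

lemma has_vector_derivative_hat:
  assumes v: "(v has_vector_derivative v') (at t within S)"
    and U: "(U has_vector_derivative U') (at t within S)"
  defines "E \<equiv> exp (U t / 4)" and "e \<equiv> exp (- U t / 4)"
  shows "((\<lambda>t. hat_r \<nu> (U t) (v t)) has_vector_derivative
      (fst v' * e - U' / 4 * fst (v t) * e) + \<i> * (snd v' * E + U' / 4 * snd (v t) * E) / \<nu>) (at t within S)" (is ?r)
    and "((\<lambda>t. hat_s \<nu> (U t) (v t)) has_vector_derivative
      (fst v' * e - U' / 4 * fst (v t) * e) - \<i> * (snd v' * E + U' / 4 * snd (v t) * E) / \<nu>) (at t within S)" (is ?s)
proof -
  have 1: "((\<lambda>t. fst (v t)) has_vector_derivative fst v') (at t within S)"
    and 2: "((\<lambda>t. snd (v t)) has_vector_derivative snd v') (at t within S)"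
    using bounded_linear.has_vector_derivative[OF bounded_linear_fst v]
      bounded_linear.has_vector_derivative[OF bounded_linear_snd v] .
  have 3: "((\<lambda>t. exp (U t / 4)) has_vector_derivative U' / 4 * E) (at t within S)"
    unfolding E_def by (intro has_vector_derivative_exp has_vector_derivative_divide U)
  have 4: "((\<lambda>t. exp (- U t / 4)) has_vector_derivative - U' / 4 * e) (at t within S)"
    unfolding e_def by (intro has_vector_derivative_exp has_vector_derivative_divide has_vector_derivative_minus U)
  note P = has_vector_derivative_mult[OF 1 4]
    and Q = has_vector_derivative_divide[OF has_vector_derivative_mult_right[OF has_vector_derivative_mult[OF 2 3]]]
  show ?r using has_vector_derivative_add[OF P Q[of \<i> \<nu>]]
    by (simp add: hat_r_def E_def e_def algebra_simps)
  show ?s using has_vector_derivative_diff[OF P Q[of \<i> \<nu>]]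
    by (simp add: hat_s_def E_def e_def algebra_simps)
qed

text \<open>
  Here \<open>m = 1 / \<nu>\<close>, \<open>E = exp (u / 4)\<close>, \<open>a\<close> and \<open>b\<close> are the partial derivatives of \<open>u\<close>, and \<open>px, qx, py, qy\<close> are
  those of a parallel section \<open>(p, q)\<close>.
\<close>

lemma gauge_identities:
  fixes p q E e \<nu> m a b :: complex
  assumes Ee: "e * E = 1" and m: "\<nu> * m = 1"
  defines "r \<equiv> p * e + \<i> * (q * E) * m" and "s \<equiv> p * e - \<i> * (q * E) * m"
  defines "N1 \<equiv> e^4 * (r - s) + E^4 * (r + s)" and "N2 \<equiv> e^4 * (r - s) - E^4 * (r + s)"
  defines "w \<equiv> (\<i> * b - a) / 4"
  defines "px \<equiv> \<i> * b / 4 * p + - (E\<^sup>2 + m\<^sup>2 * e\<^sup>2) / 4 * q"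
    and "qx \<equiv> (E\<^sup>2 + \<nu>\<^sup>2 * e\<^sup>2) / 4 * p + - \<i> * b / 4 * q"
  defines "py \<equiv> - \<i> * a / 4 * p + \<i> * (- E\<^sup>2 + m\<^sup>2 * e\<^sup>2) / 4 * q"
    and "qy \<equiv> \<i> * (- E\<^sup>2 + \<nu>\<^sup>2 * e\<^sup>2) / 4 * p + \<i> * a / 4 * q"
  shows "(px * e - a / 4 * p * e) + \<i> * (qx * E + a / 4 * q * E) * m = \<i> * \<nu> / 4 * r + (w * s + \<i> * N1 * m / 8)"
    and "(px * e - a / 4 * p * e) - \<i> * (qx * E + a / 4 * q * E) * m = - (\<i> * \<nu> / 4) * s + (w * r + \<i> * N2 * m / 8)"
    and "(py * e - b / 4 * p * e) + \<i> * (qy * E + b / 4 * q * E) * m = - (\<nu> / 4) * r + (\<i> * w * s + N1 * m / 8)"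
    and "(py * e - b / 4 * p * e) - \<i> * (qy * E + b / 4 * q * E) * m = \<nu> / 4 * s + (\<i> * w * r + N2 * m / 8)"
proof -
  have i: "\<i> * \<i> = -1" by simp
  \<comment> \<open>In \<open>P, Q\<close> the passage to \<open>r, s\<close> has constant
    coefficients, and \<open>p, q\<close> become polynomial in \<open>P, Q\<close> and the
    parameters; the identities then follow from \<open>e * E = 1\<close>,
    \<open>\<nu> * m = 1\<close> and \<open>\<i> * \<i> = -1\<close>.\<close>
  define P Q where "P = p * e" and "Q = q * E * m"
  have p: "p = P * E" using Ee by (simp add: P_def mult.assoc)
  have q: "q = Q * e * \<nu>" using Ee m unfolding Q_def by algebra
  have r: "r = P + \<i> * Q" and s: "s = P - \<i> * Q"
    unfolding r_def s_def P_def Q_def by (simp_all add: mult.assoc)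
  show "(px * e - a / 4 * p * e) + \<i> * (qx * E + a / 4 * q * E) * m = \<i> * \<nu> / 4 * r + (w * s + \<i> * N1 * m / 8)"
    unfolding px_def qx_def N1_def w_def r s p q using Ee m i by algebra
  show "(px * e - a / 4 * p * e) - \<i> * (qx * E + a / 4 * q * E) * m = - (\<i> * \<nu> / 4) * s + (w * r + \<i> * N2 * m / 8)"
    unfolding px_def qx_def N2_def w_def r s p q using Ee m i by algebra
  show "(py * e - b / 4 * p * e) + \<i> * (qy * E + b / 4 * q * E) * m = - (\<nu> / 4) * r + (\<i> * w * s + N1 * m / 8)"
    unfolding py_def qy_def N1_def w_def r s p q using Ee m i by algebra
  show "(py * e - b / 4 * p * e) - \<i> * (qy * E + b / 4 * q * E) * m = \<nu> / 4 * s + (\<i> * w * r + N2 * m / 8)"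
    unfolding py_def qy_def N2_def w_def r s p q using Ee m i by algebra
qed

text \<open>First row of the zero-curvature equation applied to (p, q), with
  \<open>A, B = exp (\<plusminus> u / 2)\<close>, \<open>k = 1 / l\<close> and \<open>d\<close> the
  second \<open>y\<close>-derivative. The term \<open>- d - (A\<^sup>2 - B\<^sup>2) / 2\<close> is
  the second \<open>x\<close>-derivative rewritten by the sinh-Gordon equation.
  \<open>flat_identity_2\<close> is the second row.\<close>

lemma flat_identity_1:
fixes A B k l a b d p q :: complex
  assumes lk: "l * k = 1" 
  shows "(\<i> * d / 4 * p + - (b / 2 * A + k * (- b / 2 * B)) / 4 * q)
       + (\<i> * b / 4 * (- \<i> * a / 4 * p + \<i> * (- A + k * B) / 4 * q)
         + - (A + k * B) / 4 * (\<i> * (- A + l * B) / 4 * p + \<i> * a / 4 * q))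
     = (- \<i> * (- d - (A\<^sup>2 - B\<^sup>2) / 2) / 4 * p + \<i> * (- (a / 2 * A) + k * (- a / 2 * B)) / 4 * q)
       + (- \<i> * a / 4 * (\<i> * b / 4 * p + - (A + k * B) / 4 * q)
         + \<i> * (- A + k * B) / 4 * ((A + l * B) / 4 * p + - \<i> * b / 4 * q))"
proof -
  have "l * (k * X) = X" "k * (l * X) = X" for X using lk by (metis mult.assoc mult.commute mult_1)+
  then show ?thesis by (simp add: algebra_simps add_divide_distrib diff_divide_distrib power2_eq_square)
qed

lemma flat_identity_2:
fixes A B k l a b d p q :: complex
  assumes lk: "l * k = 1" 
  shows "((b / 2 * A + l * (- b / 2 * B)) / 4 * p + - \<i> * d / 4 * q)
       + ((A + l * B) / 4 * (- \<i> * a / 4 * p + \<i> * (- A + k * B) / 4 * q)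
         + - \<i> * b / 4 * (\<i> * (- A + l * B) / 4 * p + \<i> * a / 4 * q))
     = (\<i> * (- (a / 2 * A) + l * (- a / 2 * B)) / 4 * p + \<i> * (- d - (A\<^sup>2 - B\<^sup>2) / 2) / 4 * q)
       + (\<i> * (- A + l * B) / 4 * (\<i> * b / 4 * p + - (A + k * B) / 4 * q)
         + \<i> * a / 4 * ((A + l * B) / 4 * p + - \<i> * b / 4 * q))"
proof -
  have "l * (k * X) = X" "k * (l * X) = X" for X using lk by (metis mult.assoc mult.commute mult_1)+
  then show ?thesis by (simp add: algebra_simps add_divide_distrib diff_divide_distrib power2_eq_square)
qed

text \<open>The data of a solution on a closed period rectangle, with all derivatives as separate
  functions. Compactness gives uniform constants, and the locale is instantiated twice in the end:
  by the solution and by its reflection.\<close>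

locale sinh_gordon_rectangle =
  fixes Y :: real and u ux uy uxx uyx uyy :: "real \<Rightarrow> real \<Rightarrow> complex"
  assumes Y_pos: "Y > 0"
    and der_u_x: "\<And>x y. x \<in> {0..1} \<Longrightarrow> y \<in> {-Y..Y} \<Longrightarrow>
      ((\<lambda>x. u x y) has_vector_derivative ux x y) (at x within {0..1})"
    and der_u_y: "\<And>x y. x \<in> {0..1} \<Longrightarrow> y \<in> {-Y..Y} \<Longrightarrow>
      ((\<lambda>y. u x y) has_vector_derivative uy x y) (at y within {-Y..Y})"
    and der_ux_x: "\<And>x y. x \<in> {0..1} \<Longrightarrow> y \<in> {-Y..Y} \<Longrightarrow>
      ((\<lambda>x. ux x y) has_vector_derivative uxx x y) (at x within {0..1})"
    and der_uy_x: "\<And>x y. x \<in> {0..1} \<Longrightarrow> y \<in> {-Y..Y} \<Longrightarrow>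
      ((\<lambda>x. uy x y) has_vector_derivative uyx x y) (at x within {0..1})"
    and der_uy_y: "\<And>x y. x \<in> {0..1} \<Longrightarrow> y \<in> {-Y..Y} \<Longrightarrow>
      ((\<lambda>y. uy x y) has_vector_derivative uyy x y) (at y within {-Y..Y})"
    and cont_u: "continuous_on ({0..1} \<times> {-Y..Y}) (\<lambda>p. u (fst p) (snd p))"
    and cont_ux: "continuous_on ({0..1} \<times> {-Y..Y}) (\<lambda>p. ux (fst p) (snd p))"
    and cont_uy: "continuous_on ({0..1} \<times> {-Y..Y}) (\<lambda>p. uy (fst p) (snd p))"
    and cont_uxx: "continuous_on ({0..1} \<times> {-Y..Y}) (\<lambda>p. uxx (fst p) (snd p))"
    and cont_uyx: "continuous_on ({0..1} \<times> {-Y..Y}) (\<lambda>p. uyx (fst p) (snd p))"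
    and cont_uyy: "continuous_on ({0..1} \<times> {-Y..Y}) (\<lambda>p. uyy (fst p) (snd p))"
    and per_u: "\<And>y. y \<in> {-Y..Y} \<Longrightarrow> u 1 y = u 0 y"
    and per_ux: "\<And>y. y \<in> {-Y..Y} \<Longrightarrow> ux 1 y = ux 0 y"
    and pde: "\<And>x y. x \<in> {0..1} \<Longrightarrow> y \<in> {-Y..Y} \<Longrightarrow> uxx x y + uyy x y + sinh (u x y) = 0"
begin

definition connU where
  "connU l x y = ((\<i> * uy x y / 4, - (exp (u x y / 2) + inverse l * exp (- u x y / 2)) / 4),
    ((exp (u x y / 2) + l * exp (- u x y / 2)) / 4, - \<i> * uy x y / 4))"

text \<open>
  This is the \<open>dy\<close>-part of \<open>\<alpha>\<close> with the signs of the off-diagonal entries changed, which makes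
  \<open>dF = (U dx + W dy) F\<close> integrable; the monodromy only sees the \<open>dx\<close>-part.
\<close>

definition connW where
  "connW l x y = ((- \<i> * ux x y / 4, \<i> * (- exp (u x y / 2) + inverse l * exp (- u x y / 2)) / 4),
    (\<i> * (- exp (u x y / 2) + l * exp (- u x y / 2)) / 4, \<i> * ux x y / 4))"

definition connUy where
  "connUy l x y = ((\<i> * uyy x y / 4,
      - (uy x y / 2 * exp (u x y / 2) + inverse l * (- uy x y / 2 * exp (- u x y / 2))) / 4),
    ((uy x y / 2 * exp (u x y / 2) + l * (- uy x y / 2 * exp (- u x y / 2))) / 4, - \<i> * uyy x y / 4))"

definition connWx where
  "connWx l x y = ((- \<i> * uxx x y / 4,
      \<i> * (- (ux x y / 2 * exp (u x y / 2)) + inverse l * (- ux x y / 2 * exp (- u x y / 2))) / 4),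
    (\<i> * (- (ux x y / 2 * exp (u x y / 2)) + l * (- ux x y / 2 * exp (- u x y / 2))) / 4, \<i> * uxx x y / 4))"

text \<open>The estimates use the sinh-Gordon equation only through this zero-curvature
  identity.\<close>

lemma flat:
  assumes "l \<noteq> 0" "x \<in> {0..1}" "y \<in> {-Y..Y}"
  shows "mv2 (connUy l x y) v + mv2 (connU l x y) (mv2 (connW l x y) v)
    = mv2 (connWx l x y) v + mv2 (connW l x y) (mv2 (connU l x y) v)"
proof -
  define A B k a b p q where "A = exp (u x y / 2)" and "B = exp (- u x y / 2)" and "k = inverse l"
    and "a = ux x y" and "b = uy x y" and "p = fst v" and "q = snd v"
  note ab = A_def[symmetric] B_def[symmetric] k_def[symmetric] a_def[symmetric] b_def[symmetric]
    p_def[symmetric] q_def[symmetric]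
  have lk: "l * k = 1" using assms(1) by (simp add: k_def)
  have "exp (u x y) = A\<^sup>2" "exp (- u x y) = B\<^sup>2"
    by (simp_all add: A_def B_def flip: exp_double)
  then have "sinh (u x y) = (A\<^sup>2 - B\<^sup>2) / 2"
    by (simp add: sinh_field_def)
  with pde[OF assms(2,3)] have D: "uxx x y + uyy x y + (A\<^sup>2 - B\<^sup>2) / 2 = 0"
    by simp
  define c d where "c = uxx x y" and "d = uyy x y"
  have "c + d + (A\<^sup>2 - B\<^sup>2) / 2 = 0" using D by (simp add: c_def d_def)
  then have "c = - (d + (A\<^sup>2 - B\<^sup>2) / 2)" unfolding eq_neg_iff_add_eq_0 by (simp only: add.assoc)
  then have c: "c = - d - (A\<^sup>2 - B\<^sup>2) / 2" by simp
  note ab = ab c_def[symmetric] d_def[symmetric]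
  show ?thesis
    unfolding mv2_def connU_def connW_def connUy_def connWx_def fst_conv snd_conv plus_prod_def ab c
    by (intro conjI prod.inject[THEN iffD2] flat_identity_1 flat_identity_2 lk)
qed

lemma connUy:
  assumes x: "x \<in> {0..1}" and y: "y \<in> {-Y..Y}"
  shows "(connU l x has_vector_derivative connUy l x y) (at y within {-Y..Y})"
proof -
  note 1 = has_vector_derivative_exp[OF has_vector_derivative_divide[OF der_u_y[OF x y], of 2]]
    and 2 = has_vector_derivative_exp[OF has_vector_derivative_divide[OF
        has_vector_derivative_minus[OF der_u_y[OF x y]], of 2]]
  show ?thesis
    unfolding connU_def connUy_def
    by (intro has_vector_derivative_Pair has_vector_derivative_divide has_vector_derivative_mult_right
        has_vector_derivative_minus has_vector_derivative_add 1 2 der_uy_y x y)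
qed

lemma connWx:
  assumes x: "x \<in> {0..1}" and y: "y \<in> {-Y..Y}"
  shows "((\<lambda>x. connW l x y) has_vector_derivative connWx l x y) (at x within {0..1})"
proof -
  note 1 = has_vector_derivative_exp[OF has_vector_derivative_divide[OF der_u_x[OF x y], of 2]]
    and 2 = has_vector_derivative_exp[OF has_vector_derivative_divide[OF
        has_vector_derivative_minus[OF der_u_x[OF x y]], of 2]]
  show ?thesis
    unfolding connW_def connWx_def
    by (intro has_vector_derivative_Pair has_vector_derivative_divide has_vector_derivative_mult_right
        has_vector_derivative_minus has_vector_derivative_add 1 2 der_ux_x x y)
qed

lemma cont_conn:
  "continuous_on ({0..1} \<times> {-Y..Y}) (\<lambda>p. connU l (fst p) (snd p))"
  "continuous_on ({0..1} \<times> {-Y..Y}) (\<lambda>p. connW l (fst p) (snd p))"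
  "continuous_on ({0..1} \<times> {-Y..Y}) (\<lambda>p. connUy l (fst p) (snd p))"
  unfolding connU_def connW_def connUy_def
  by (intro continuous_intros cont_u cont_ux cont_uy cont_uyy; simp)+

definition xsol where
  "xsol l y v \<longleftrightarrow> (\<forall>x\<in>{0..1}. (v has_vector_derivative mv2 (connU l x y) (v x)) (at x within {0..1}))"

lemma xsol_exists:
  assumes "y \<in> {-Y..Y}"
  shows "\<exists>v. v 0 = v0 \<and> xsol l y v"
  unfolding xsol_def
proof (rule linear_ode_exists[OF bounded_bilinear_mv2])
  have "continuous_on {0..1} ((\<lambda>p. connU l (fst p) (snd p)) \<circ> (\<lambda>x. (x, y)))"
    by (intro continuous_on_compose continuous_intros continuous_on_subset[OF cont_conn(1)])
       (use assms in auto)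
  then show "continuous_on {0..1} (\<lambda>x. connU l x y)" by (simp add: o_def)
qed simp

lemma cont_connW:
  assumes "x \<in> {0..1}" "{c..d} \<subseteq> {-Y..Y}"
  shows "continuous_on {c..d} (connW l x)"
proof -
  have "continuous_on {c..d} ((\<lambda>p. connW l (fst p) (snd p)) \<circ> (\<lambda>y. (x, y)))"
    by (intro continuous_on_compose continuous_intros continuous_on_subset[OF cont_conn(2)])
       (use assms in auto)
  then show ?thesis by (simp add: o_def)
qed

text \<open>Trace-free coefficients preserve determinants. This is used along the period for det M =
  1 and across the strip for the invariance of the quadratic form.\<close>

lemma wronskian_constant:
  fixes f g :: "real \<Rightarrow> complex \<times> complex"
  assumes f: "\<And>t. t \<in> S \<Longrightarrow> (f has_vector_derivative mv2 (A t) (f t)) (at t within S)"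
    and g: "\<And>t. t \<in> S \<Longrightarrow> (g has_vector_derivative mv2 (A t) (g t)) (at t within S)"
    and tr: "\<And>t. t \<in> S \<Longrightarrow> snd (snd (A t)) = - fst (fst (A t))"
    and S: "convex S" "s \<in> S" "t \<in> S"
  shows "fst (f s) * snd (g s) - snd (f s) * fst (g s) = fst (f t) * snd (g t) - snd (f t) * fst (g t)"
proof -
  have "((\<lambda>t. fst (f t) * snd (g t) - snd (f t) * fst (g t)) has_vector_derivative 0) (at t within S)"
    if t: "t \<in> S" for t
  proof -
    note d = bounded_linear.has_vector_derivative[OF bounded_linear_fst f[OF t]]
      bounded_linear.has_vector_derivative[OF bounded_linear_snd f[OF t]]
      bounded_linear.has_vector_derivative[OF bounded_linear_fst g[OF t]]
      bounded_linear.has_vector_derivative[OF bounded_linear_snd g[OF t]]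
    have "((\<lambda>t. fst (f t) * snd (g t) - snd (f t) * fst (g t)) has_vector_derivative
       (fst (f t) * snd (mv2 (A t) (g t)) + fst (mv2 (A t) (f t)) * snd (g t))
       - (snd (f t) * fst (mv2 (A t) (g t)) + snd (mv2 (A t) (f t)) * fst (g t))) (at t within S)"
      by (intro has_vector_derivative_diff has_vector_derivative_mult d)
    moreover have "(fst (f t) * snd (mv2 (A t) (g t)) + fst (mv2 (A t) (f t)) * snd (g t))
       - (snd (f t) * fst (mv2 (A t) (g t)) + snd (mv2 (A t) (f t)) * fst (g t)) = 0"
      by (simp add: mv2_def tr[OF t] algebra_simps)
    ultimately show ?thesis by simp
  qed
  from has_vector_derivative_zero_constant[OF S(1) this] S(2,3) show ?thesis by metis
qed

text \<open>
  The quadratic form \<open>v \<mapsto> det (v, M v)\<close> of the monodromy \<open>M\<close> at height \<open>y\<close> is invariant under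
  the parallel transport in the direction of \<open>y\<close>.
\<close>

lemma transport_invariant:
  fixes f :: "real \<Rightarrow> real \<Rightarrow> complex \<times> complex"
  assumes l: "l \<noteq> 0" and cd: "{c..d} \<subseteq> {-Y..Y}"
    and f: "\<And>y. y \<in> {c..d} \<Longrightarrow> xsol l y (\<lambda>x. f x y)"
    and f0: "\<And>y. y \<in> {c..d} \<Longrightarrow> (f 0 has_vector_derivative mv2 (connW l 0 y) (f 0 y)) (at y within {c..d})"
    and y: "y \<in> {c..d}" "y' \<in> {c..d}"
  shows "fst (f 0 y) * snd (f 1 y) - snd (f 0 y) * fst (f 1 y)
    = fst (f 0 y') * snd (f 1 y') - snd (f 0 y') * fst (f 1 y')"
proof (rule wronskian_constant[OF f0 _ _ _ y])
  have sub: "{0..1} \<times> {c..d} \<subseteq> {0..1} \<times> {-Y..Y}" using cd by auto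
  fix y assume y: "y \<in> {c..d}"
  have "(f 1 has_vector_derivative mv2 (connW l 1 y) (f 1 y)) (at y within {c..d})"
  proof (rule flat_transport[OF bounded_bilinear_mv2])
    show "continuous_on ({0..1} \<times> {c..d}) (\<lambda>(x, y). connU l x y)"
      "continuous_on ({0..1} \<times> {c..d}) (\<lambda>(x, y). connUy l x y)"
      unfolding case_prod_beta'
      by (rule continuous_on_subset[OF cont_conn(1) sub], rule continuous_on_subset[OF cont_conn(3) sub])
    fix x y :: real assume xy: "x \<in> {0..1}" "y \<in> {c..d}"
    then have y': "y \<in> {-Y..Y}" using cd by blast
    show "(connU l x has_vector_derivative connUy l x y) (at y within {c..d})"
      using connUy[OF xy(1) y'] cd by (rule has_vector_derivative_within_subset)
    show "((\<lambda>x. connW l x y) has_vector_derivative connWx l x y) (at x within {0..1})"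
      by (rule connWx[OF xy(1) y'])
    show "mv2 (connUy l x y) v + mv2 (connU l x y) (mv2 (connW l x y) v)
      = mv2 (connWx l x y) v + mv2 (connW l x y) (mv2 (connU l x y) v)" for v
      by (rule flat[OF l xy(1) y'])
    show "((\<lambda>x. f x y) has_vector_derivative mv2 (connU l x y) (f x y)) (at x within {0..1})"
      using f[OF xy(2)] xy(1) by (simp add: xsol_def)
  next
    show "(f 0 has_vector_derivative mv2 (connW l 0 y) (f 0 y)) (at y within {c..d})"
      if "y \<in> {c..d}" for y by (rule f0[OF that])
  qed (use y in auto)
  \<comment> \<open>By periodicity the two vertical sides carry the same \<open>y\<close>-equation,
    so both ends of the transported family can be compared by one Wronskian.\<close>
  moreover have "connW l 1 y = connW l 0 y"
    using per_u[of y] per_ux[of y] cd y unfolding connW_def by auto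
  ultimately show "(f 1 has_vector_derivative mv2 (connW l 0 y) (f 1 y)) (at y within {c..d})"
    by simp
qed (auto simp: connW_def)

text \<open>The coupling of \<open>r\<close> and \<open>s\<close> of order 0 that survives the
  gauge. \<open>n1\<close> and \<open>n2\<close> below are the remainders, which enter with a factor
  1 / \<nu>.\<close>

definition w where "w x y = (\<i> * uy x y - ux x y) / 4"

definition wx where "wx x y = (\<i> * uyx x y - uxx x y) / 4"

definition n1 where "n1 x y r s = exp (- u x y) * (r - s) + exp (u x y) * (r + s)"

definition n2 where "n2 x y r s = exp (- u x y) * (r - s) - exp (u x y) * (r + s)"

lemma der_w:
  assumes "x \<in> {0..1}" "y \<in> {-Y..Y}"
  shows "((\<lambda>x. w x y) has_vector_derivative wx x y) (at x within {0..1})"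
  unfolding w_def wx_def
  by (intro has_vector_derivative_divide has_vector_derivative_diff has_vector_derivative_mult_right
      der_uy_x der_ux_x assms)

lemma coefficients_bounded:
  "\<exists>K\<ge>1. \<forall>x\<in>{0..1}. \<forall>y\<in>{-Y..Y}. cmod (w x y) \<le> K \<and> cmod (wx x y) \<le> K \<and>
    (\<forall>r s. cmod (n1 x y r s) \<le> 2 * K * (cmod r + cmod s) \<and> cmod (n2 x y r s) \<le> 2 * K * (cmod r + cmod s))"
proof -
  have "\<exists>K. \<forall>x\<in>{0..1}. \<forall>y\<in>{-Y..Y}. cmod (g x y) \<le> K"
    if "continuous_on ({0..1} \<times> {-Y..Y}) (\<lambda>p. g (fst p) (snd p))" for g :: "real \<Rightarrow> real \<Rightarrow> complex"
    using norm_le_on_rectangle[of 0 1 "- Y" Y g] that unfolding case_prod_beta' by blast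
  note b = this
  have "continuous_on ({0..1} \<times> {-Y..Y}) (\<lambda>p. w (fst p) (snd p))"
    "continuous_on ({0..1} \<times> {-Y..Y}) (\<lambda>p. wx (fst p) (snd p))"
    "continuous_on ({0..1} \<times> {-Y..Y}) (\<lambda>p. exp (u (fst p) (snd p)))"
    "continuous_on ({0..1} \<times> {-Y..Y}) (\<lambda>p. exp (- u (fst p) (snd p)))"
    unfolding w_def wx_def
    by (intro continuous_intros cont_u cont_ux cont_uy cont_uxx cont_uyx; simp)+
  note c = this
  obtain K1 where K1: "\<forall>x\<in>{0..1}. \<forall>y\<in>{-Y..Y}. cmod (w x y) \<le> K1" using b[OF c(1)] by blast
  obtain K2 where K2: "\<forall>x\<in>{0..1}. \<forall>y\<in>{-Y..Y}. cmod (wx x y) \<le> K2" using b[OF c(2)] by blast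
  obtain K3 where K3: "\<forall>x\<in>{0..1}. \<forall>y\<in>{-Y..Y}. cmod (exp (u x y)) \<le> K3" using b[OF c(3)] by blast
  obtain K4 where K4: "\<forall>x\<in>{0..1}. \<forall>y\<in>{-Y..Y}. cmod (exp (- u x y)) \<le> K4" using b[OF c(4)] by blast
  define K where "K = max 1 (max (max K1 K2) (max K3 K4))"
  have n: "cmod (a * (r - s) + b * (r + s)) \<le> 2 * K * (cmod r + cmod s)"
    "cmod (a * (r - s) - b * (r + s)) \<le> 2 * K * (cmod r + cmod s)"
    if "cmod a \<le> K" "cmod b \<le> K" for a b r s
  proof -
    have "cmod (a * (r - s)) \<le> K * (cmod r + cmod s)" "cmod (b * (r + s)) \<le> K * (cmod r + cmod s)"
      unfolding norm_mult
      by (intro mult_mono that norm_triangle_ineq4 norm_triangle_ineq; simp add: K_def)+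
    then show "cmod (a * (r - s) + b * (r + s)) \<le> 2 * K * (cmod r + cmod s)"
      "cmod (a * (r - s) - b * (r + s)) \<le> 2 * K * (cmod r + cmod s)"
      using norm_triangle_ineq[of "a * (r - s)" "b * (r + s)"]
        norm_triangle_ineq4[of "a * (r - s)" "b * (r + s)"] by linarith+
  qed
  show ?thesis
  proof (intro exI[of _ K] conjI ballI allI)
    fix x y :: real and r s :: complex assume xy: "x \<in> {0..1}" "y \<in> {-Y..Y}"
    show "cmod (w x y) \<le> K" "cmod (wx x y) \<le> K"
      using K1 K2 xy unfolding K_def by fastforce+
    have e: "cmod (exp (- u x y)) \<le> K" "cmod (exp (u x y)) \<le> K"
      using K3 K4 xy unfolding K_def by fastforce+
    show "cmod (n1 x y r s) \<le> 2 * K * (cmod r + cmod s)" "cmod (n2 x y r s) \<le> 2 * K * (cmod r + cmod s)"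
      unfolding n1_def n2_def by (rule n[OF e])+
  qed (simp add: K_def)
qed

lemma exp_powers:
  "exp (u x y / 4) ^ 2 = exp (u x y / 2)" "exp (- u x y / 4) ^ 2 = exp (- u x y / 2)"
  "exp (u x y / 4) ^ 4 = exp (u x y)" "exp (- u x y / 4) ^ 4 = exp (- u x y)"
  by (simp_all flip: exp_of_nat_mult)

lemma der_hat_x:
  assumes v: "xsol (\<nu>\<^sup>2) y v" and \<nu>: "\<nu> \<noteq> 0" and x: "x \<in> {0..1}" and y: "y \<in> {-Y..Y}"
  defines "r \<equiv> \<lambda>x. hat_r \<nu> (u x y) (v x)" and "s \<equiv> \<lambda>x. hat_s \<nu> (u x y) (v x)"
  shows "(r has_vector_derivative \<i> * \<nu> / 4 * r x + (w x y * s x + \<i> * n1 x y (r x) (s x) / \<nu> / 8)) (at x within {0..1})"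
    and "(s has_vector_derivative - (\<i> * \<nu> / 4) * s x + (w x y * r x + \<i> * n2 x y (r x) (s x) / \<nu> / 8)) (at x within {0..1})"
proof -
  have dv: "(v has_vector_derivative mv2 (connU (\<nu>\<^sup>2) x y) (v x)) (at x within {0..1})"
    using v x by (simp add: xsol_def)
  note d = has_vector_derivative_hat[OF dv der_u_x[OF x y], of \<nu>]
  define E e m where "E = exp (u x y / 4)" and "e = exp (- u x y / 4)" and "m = 1 / \<nu>"
  have Ee: "e * E = 1" and m: "\<nu> * m = 1"
    using \<nu> by (simp_all add: E_def e_def m_def flip: exp_add)
  have k: "inverse (\<nu>\<^sup>2) = m\<^sup>2" by (simp add: m_def power_divide inverse_eq_divide)
  note g = gauge_identities(1,2)[OF Ee m, where p = "fst (v x)" and q = "snd (v x)" and a = "ux x y" and b = "uy x y"]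
  note E = E_def[symmetric] e_def[symmetric] exp_powers[symmetric] k
  show "(r has_vector_derivative \<i> * \<nu> / 4 * r x + (w x y * s x + \<i> * n1 x y (r x) (s x) / \<nu> / 8)) (at x within {0..1})"
    unfolding r_def s_def
    apply (rule has_vector_derivative_eq_rhs[OF d(1)])
    unfolding n1_def w_def hat_r_def hat_s_def mv2_def connU_def fst_conv snd_conv E
    using g(1) by (simp add: m_def)
  show "(s has_vector_derivative - (\<i> * \<nu> / 4) * s x + (w x y * r x + \<i> * n2 x y (r x) (s x) / \<nu> / 8)) (at x within {0..1})"
    unfolding r_def s_def
    apply (rule has_vector_derivative_eq_rhs[OF d(2)])
    unfolding n2_def w_def hat_r_def hat_s_def mv2_def connU_def fst_conv snd_conv E
    using g(2) by (simp add: m_def)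
qed

text \<open>The same \<open>w\<close>, \<open>n1\<close>, \<open>n2\<close> occur as in the
  \<open>x\<close>-direction with only the factor \<i> placed differently, so one bound
  \<open>K\<close> serves both directions.\<close>

lemma der_hat_y:
  assumes v: "(v has_vector_derivative mv2 (connW (\<nu>\<^sup>2) x y) (v y)) (at y within S)"
    and \<nu>: "\<nu> \<noteq> 0" and x: "x \<in> {0..1}" and y: "y \<in> {-Y..Y}" and S: "S \<subseteq> {-Y..Y}"
  defines "r \<equiv> \<lambda>y. hat_r \<nu> (u x y) (v y)" and "s \<equiv> \<lambda>y. hat_s \<nu> (u x y) (v y)"
  shows "(r has_vector_derivative - (\<nu> / 4) * r y + (\<i> * w x y * s y + n1 x y (r y) (s y) / \<nu> / 8)) (at y within S)"
    and "(s has_vector_derivative \<nu> / 4 * s y + (\<i> * w x y * r y + n2 x y (r y) (s y) / \<nu> / 8)) (at y within S)"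
proof -
  note d = has_vector_derivative_hat[OF v has_vector_derivative_within_subset[OF der_u_y[OF x y] S], of \<nu>]
  define E e m where "E = exp (u x y / 4)" and "e = exp (- u x y / 4)" and "m = 1 / \<nu>"
  have Ee: "e * E = 1" and m: "\<nu> * m = 1"
    using \<nu> by (simp_all add: E_def e_def m_def flip: exp_add)
  have k: "inverse (\<nu>\<^sup>2) = m\<^sup>2" by (simp add: m_def power_divide inverse_eq_divide)
  note g = gauge_identities(3,4)[OF Ee m, where p = "fst (v y)" and q = "snd (v y)" and a = "ux x y" and b = "uy x y"]
  note E = E_def[symmetric] e_def[symmetric] exp_powers[symmetric] k
  show "(r has_vector_derivative - (\<nu> / 4) * r y + (\<i> * w x y * s y + n1 x y (r y) (s y) / \<nu> / 8)) (at y within S)"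
    unfolding r_def s_def
    apply (rule has_vector_derivative_eq_rhs[OF d(1)])
    unfolding n1_def w_def hat_r_def hat_s_def mv2_def connW_def fst_conv snd_conv E
    using g(1) by (simp add: m_def)
  show "(s has_vector_derivative \<nu> / 4 * s y + (\<i> * w x y * r y + n2 x y (r y) (s y) / \<nu> / 8)) (at y within S)"
    unfolding r_def s_def
    apply (rule has_vector_derivative_eq_rhs[OF d(2)])
    unfolding n2_def w_def hat_r_def hat_s_def mv2_def connW_def fst_conv snd_conv E
    using g(2) by (simp add: m_def)
qed

end

section \<open>Spectral points\<close>

context sinh_gordon_rectangle
begin

section \<open>The monodromy and its quadratic form in the gauged coordinates\<close>

lemma zero_mem: "0 \<in> {-Y..Y}"
  using Y_pos by auto

text \<open>The monodromy as a property of all solutions instead of a chosen matrix: this form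
  passes through the gauge and the reflection without reference to a fundamental system.\<close>

definition is_mon :: "complex \<Rightarrow> complex \<Rightarrow> complex \<Rightarrow> complex \<Rightarrow> complex \<Rightarrow> bool" where
  "is_mon l a b c d \<longleftrightarrow> (\<forall>v. xsol l 0 v \<longrightarrow>
    v 1 = (a * fst (v 0) + b * snd (v 0), c * fst (v 0) + d * snd (v 0)))"

text \<open>Both ends use the gauge at \<open>u 0 0\<close>, which is legitimate because
  \<open>u 1 0 = u 0 0\<close>; the gauged monodromy is thus conjugate to the original one.\<close>

definition hat_mon :: "complex \<Rightarrow> complex \<Rightarrow> complex \<Rightarrow> complex \<Rightarrow> complex \<Rightarrow> bool" where
  "hat_mon \<nu> \<alpha> \<beta> \<gamma> \<delta> \<longleftrightarrow> (\<forall>v. xsol (\<nu>\<^sup>2) 0 v \<longrightarrow>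
    hat_r \<nu> (u 0 0) (v 1) = \<alpha> * hat_r \<nu> (u 0 0) (v 0) + \<beta> * hat_s \<nu> (u 0 0) (v 0) \<and>
    hat_s \<nu> (u 0 0) (v 1) = \<gamma> * hat_r \<nu> (u 0 0) (v 0) + \<delta> * hat_s \<nu> (u 0 0) (v 0))"

lemma hat_mon_of_mon:
  assumes m: "is_mon (\<nu>\<^sup>2) a b c d" and \<nu>: "\<nu> \<noteq> 0"
  defines "b' \<equiv> b * \<nu> * exp (- u 0 0 / 2)" and "c' \<equiv> c * exp (u 0 0 / 2) / \<nu>"
  shows "hat_mon \<nu> ((a + d + \<i> * (c' - b')) / 2) ((a - d + \<i> * (b' + c')) / 2)
    ((a - d - \<i> * (b' + c')) / 2) ((a + d + \<i> * (b' - c')) / 2)"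
proof -
  define e where "e = exp (u 0 0 / 4)"
  have e: "e \<noteq> 0" and e1: "exp (- u 0 0 / 4) = 1 / e" and e2: "exp (u 0 0 / 2) = e\<^sup>2"
    "exp (- u 0 0 / 2) = 1 / e\<^sup>2"
    by (simp_all add: e_def exp_minus inverse_eq_divide flip: exp_double)
  have i: "\<i> * (\<i> * x) = - x" for x :: complex by (simp flip: mult.assoc)
  show ?thesis
    unfolding hat_mon_def
  proof (intro allI impI)
    fix v assume "xsol (\<nu>\<^sup>2) 0 v"
    then have v: "v 1 = (a * fst (v 0) + b * snd (v 0), c * fst (v 0) + d * snd (v 0))"
      using m by (simp add: is_mon_def)
    show "hat_r \<nu> (u 0 0) (v 1) = (a + d + \<i> * (c' - b')) / 2 * hat_r \<nu> (u 0 0) (v 0)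
        + (a - d + \<i> * (b' + c')) / 2 * hat_s \<nu> (u 0 0) (v 0) \<and>
      hat_s \<nu> (u 0 0) (v 1) = (a - d - \<i> * (b' + c')) / 2 * hat_r \<nu> (u 0 0) (v 0)
        + (a + d + \<i> * (b' - c')) / 2 * hat_s \<nu> (u 0 0) (v 0)"
      unfolding v hat_r_def hat_s_def b'_def c'_def e1 e2 e_def[symmetric] fst_conv snd_conv
      using e \<nu> by (simp add: field_simps power2_eq_square i)
  qed
qed

lemma hat_xsol_exists:
  assumes "y \<in> {-Y..Y}" "\<nu> \<noteq> 0"
  obtains v where "xsol (\<nu>\<^sup>2) y v" "hat_r \<nu> (u 0 y) (v 0) = r" "hat_s \<nu> (u 0 y) (v 0) = s"
  using xsol_exists[OF assms(1), of "unhat \<nu> (u 0 y) r s" "\<nu>\<^sup>2"] hat_unhat[OF assms(2)] by metis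

lemma hat_mon_det:
  assumes h: "hat_mon \<nu> \<alpha> \<beta> \<gamma> \<delta>" and \<nu>: "\<nu> \<noteq> 0"
  shows "\<alpha> * \<delta> - \<beta> * \<gamma> = 1"
proof -
  obtain v where v: "xsol (\<nu>\<^sup>2) 0 v" "hat_r \<nu> (u 0 0) (v 0) = 1" "hat_s \<nu> (u 0 0) (v 0) = 0"
    using hat_xsol_exists[OF zero_mem \<nu>] by blast
  obtain v' where v': "xsol (\<nu>\<^sup>2) 0 v'" "hat_r \<nu> (u 0 0) (v' 0) = 0" "hat_s \<nu> (u 0 0) (v' 0) = 1"
    using hat_xsol_exists[OF zero_mem \<nu>] by blast
  have "fst (v 0) * snd (v' 0) - snd (v 0) * fst (v' 0) = fst (v 1) * snd (v' 1) - snd (v 1) * fst (v' 1)"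
    by (rule wronskian_constant[of "{0..1}" v "\<lambda>x. connU (\<nu>\<^sup>2) x 0"])
       (use v(1) v'(1) in \<open>auto simp: xsol_def connU_def\<close>)
  then have "hat_r \<nu> (u 0 0) (v 1) * hat_s \<nu> (u 0 0) (v' 1) - hat_s \<nu> (u 0 0) (v 1) * hat_r \<nu> (u 0 0) (v' 1)
    = hat_r \<nu> (u 0 0) (v 0) * hat_s \<nu> (u 0 0) (v' 0) - hat_s \<nu> (u 0 0) (v 0) * hat_r \<nu> (u 0 0) (v' 0)"
    by (simp add: hat_det[OF \<nu>])
  then show ?thesis
    using h v v' by (simp add: hat_mon_def algebra_simps)
qed

definition K where
  "K = (SOME K. K \<ge> 1 \<and> (\<forall>x\<in>{0..1}. \<forall>y\<in>{-Y..Y}. cmod (w x y) \<le> K \<and> cmod (wx x y) \<le> K \<and>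
    (\<forall>r s. cmod (n1 x y r s) \<le> 2 * K * (cmod r + cmod s) \<and> cmod (n2 x y r s) \<le> 2 * K * (cmod r + cmod s))))"

lemma K: "K \<ge> 1"
  "\<And>x y. x \<in> {0..1} \<Longrightarrow> y \<in> {-Y..Y} \<Longrightarrow> cmod (w x y) \<le> K"
  "\<And>x y. x \<in> {0..1} \<Longrightarrow> y \<in> {-Y..Y} \<Longrightarrow> cmod (wx x y) \<le> K"
  "\<And>x y r s. x \<in> {0..1} \<Longrightarrow> y \<in> {-Y..Y} \<Longrightarrow> cmod (n1 x y r s) \<le> 2 * K * (cmod r + cmod s)"
  "\<And>x y r s. x \<in> {0..1} \<Longrightarrow> y \<in> {-Y..Y} \<Longrightarrow> cmod (n2 x y r s) \<le> 2 * K * (cmod r + cmod s)"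
  using someI_ex[OF coefficients_bounded] unfolding K_def by blast+

lemma lower_order_bound:
  assumes n: "cmod n \<le> 2 * K * (cmod r + cmod s)" and W: "cmod W \<le> K" and \<nu>: "1 \<le> cmod \<nu>"
    and q: "q = r \<or> q = s"
  shows "cmod (W * q + n / \<nu> / 8) \<le> 2 * K * (cmod r + cmod s)"
proof -
  have "cmod (W * q) \<le> K * (cmod r + cmod s)"
    unfolding norm_mult using W q K(1) by (intro mult_mono) auto
  moreover have "cmod (n / \<nu> / 8) \<le> K * (cmod r + cmod s)"
  proof -
    have "cmod (n / \<nu> / 8) = cmod n / (8 * cmod \<nu>)" by (simp add: norm_divide)
    also have "\<dots> \<le> cmod n / (8 * 1)" using \<nu> by (intro divide_left_mono) auto
    also have "\<dots> \<le> K * (cmod r + cmod s)"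
    proof -
      have "0 \<le> K * (cmod r + cmod s)" using K(1) by simp
      then show ?thesis using n by linarith
    qed
    finally show ?thesis .
  qed
  ultimately show ?thesis using norm_triangle_ineq[of "W * q" "n / \<nu> / 8"] by linarith
qed

text \<open>For |Im \<nu>| at most 1 the diagonal coefficient \<i> \<nu> / 4 is imaginary up to a
  bounded amount, so the bound is uniform in \<open>\<nu>\<close>, and in the height
  \<open>y\<close> as well.\<close>

lemma hat_x_bounded:
  assumes v: "xsol (\<nu>\<^sup>2) y v" and y: "y \<in> {-Y..Y}" and \<nu>: "1 \<le> cmod \<nu>" "\<bar>Im \<nu>\<bar> \<le> 1" and x: "x \<in> {0..1}"
  shows "(cmod (hat_r \<nu> (u x y) (v x)))\<^sup>2 + (cmod (hat_s \<nu> (u x y) (v x)))\<^sup>2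
    \<le> ((cmod (hat_r \<nu> (u 0 y) (v 0)))\<^sup>2 + (cmod (hat_s \<nu> (u 0 y) (v 0)))\<^sup>2) * exp (12 * K + 1)"
proof -
  have \<nu>0: "\<nu> \<noteq> 0" using \<nu>(1) by auto
  note d = der_hat_x[OF v \<nu>0 _ y]
  have *: "cmod (\<i> * n1 x y r s) \<le> 2 * K * (cmod r + cmod s)" "cmod (\<i> * n2 x y r s) \<le> 2 * K * (cmod r + cmod s)"
    if "x \<in> {0..1}" for x r s
    using K(4,5)[OF that y] by (simp_all add: norm_mult)
  have "6 * (2 * K) = 12 * K" by simp
  moreover have "\<bar>Re (\<i> * \<nu> / 4)\<bar> \<le> 2 * K" using \<nu>(2) K(1) by simp
  ultimately show ?thesis
    using system_bounded[OF d(1) d(2) _ _ _ x, of "2 * K"] lower_order_bound[OF *(1) K(2)[OF _ y] \<nu>(1)]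
      lower_order_bound[OF *(2) K(2)[OF _ y] \<nu>(1)] by simp
qed

text \<open>The expression is det (v, M v) in gauged coordinates. By invariance it can be evaluated
  at the height where \<open>\<phi>\<close> is a unit vector; there it is, up to sign, one
  coordinate of the image of that vector and hence bounded.\<close>

lemma hat_form_transport:
  assumes h: "hat_mon \<nu> \<alpha> \<beta> \<gamma> \<delta>" and \<nu>: "1 \<le> cmod \<nu>" "\<bar>Im \<nu>\<bar> \<le> 1"
    and cd: "{c..d} \<subseteq> {-Y..Y}" and y: "y \<in> {c..d}" and z: "0 \<in> {c..d}"
    and \<phi>: "\<And>y. y \<in> {c..d} \<Longrightarrow> (\<phi> has_vector_derivative mv2 (connW (\<nu>\<^sup>2) 0 y) (\<phi> y)) (at y within {c..d})"
    and rs: "hat_r \<nu> (u 0 y) (\<phi> y) = 1 \<and> hat_s \<nu> (u 0 y) (\<phi> y) = 0 \<or>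
      hat_r \<nu> (u 0 y) (\<phi> y) = 0 \<and> hat_s \<nu> (u 0 y) (\<phi> y) = 1"
  defines "r \<equiv> hat_r \<nu> (u 0 0) (\<phi> 0)" and "s \<equiv> hat_s \<nu> (u 0 0) (\<phi> 0)"
  shows "cmod (\<gamma> * r\<^sup>2 + (\<delta> - \<alpha>) * (r * s) - \<beta> * s\<^sup>2) \<le> exp (12 * K + 1)"
proof -
  have \<nu>0: "\<nu> \<noteq> 0" using \<nu>(1) by auto
  have "\<forall>y. \<exists>v. y \<in> {c..d} \<longrightarrow> v 0 = \<phi> y \<and> xsol (\<nu>\<^sup>2) y v"
    using xsol_exists cd by blast
  then obtain F where F: "\<And>y. y \<in> {c..d} \<Longrightarrow> F y 0 = \<phi> y \<and> xsol (\<nu>\<^sup>2) y (F y)"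
    by metis
  \<comment> \<open>The value at \<open>x = 0\<close> is set by hand so that
    \<open>f 0 = \<phi>\<close> holds as functions, also for heights outside the interval, where
    \<open>F\<close> is unspecified.\<close>
  define f where "f x y = (if x = 0 then \<phi> y else F y x)" for x y
  have fF: "f x y = F y x" if "y \<in> {c..d}" for x y
    using F[OF that] by (simp add: f_def)
  have fx: "xsol (\<nu>\<^sup>2) y (\<lambda>x. f x y)" if "y \<in> {c..d}" for y
    using F[OF that] fF[OF that] by simp
  have f0: "f 0 = \<phi>" by (simp add: f_def fun_eq_iff)
  have inv: "fst (f 0 0) * snd (f 1 0) - snd (f 0 0) * fst (f 1 0)
    = fst (f 0 y) * snd (f 1 y) - snd (f 0 y) * fst (f 1 y)"
    by (rule transport_invariant[OF _ cd fx _ z y]) (use \<phi> \<nu>0 in \<open>simp_all add: f0\<close>)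
  define r1 s1 where "r1 = hat_r \<nu> (u 0 y) (f 1 y)" and "s1 = hat_s \<nu> (u 0 y) (f 1 y)"
  have inv': "r * hat_s \<nu> (u 0 0) (f 1 0) - s * hat_r \<nu> (u 0 0) (f 1 0)
    = hat_r \<nu> (u 0 y) (\<phi> y) * s1 - hat_s \<nu> (u 0 y) (\<phi> y) * r1"
    unfolding r_def s_def r1_def s1_def hat_det[OF \<nu>0] f0[symmetric] inv ..
  have m: "hat_r \<nu> (u 0 0) (f 1 0) = \<alpha> * r + \<beta> * s" "hat_s \<nu> (u 0 0) (f 1 0) = \<gamma> * r + \<delta> * s"
    using h fx[OF z] unfolding hat_mon_def r_def s_def f0[symmetric] by blast+
  have yY: "y \<in> {-Y..Y}" using y cd by blast
  have "(cmod r1)\<^sup>2 + (cmod s1)\<^sup>2 \<le> exp (12 * K + 1)"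
    using hat_x_bounded[OF fx[OF y] yY \<nu>, of 1] rs by (auto simp: r1_def s1_def f0 per_u[OF yY])
  moreover have "exp (12 * K + 1) \<le> (exp (12 * K + 1))\<^sup>2"
    using K(1) by (intro self_le_power) auto
  ultimately have "(cmod r1)\<^sup>2 \<le> (exp (12 * K + 1))\<^sup>2" "(cmod s1)\<^sup>2 \<le> (exp (12 * K + 1))\<^sup>2"
    by (smt (verit) zero_le_power2)+
  then have "cmod r1 \<le> exp (12 * K + 1)" "cmod s1 \<le> exp (12 * K + 1)"
    by (auto intro: power2_le_imp_le)
  then have "cmod (r * (\<gamma> * r + \<delta> * s) - s * (\<alpha> * r + \<beta> * s)) \<le> exp (12 * K + 1)"
    using inv' rs unfolding m by auto
  moreover have "r * (\<gamma> * r + \<delta> * s) - s * (\<alpha> * r + \<beta> * s) = \<gamma> * r\<^sup>2 + (\<delta> - \<alpha>) * (r * s) - \<beta> * s\<^sup>2"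
    by (simp add: power2_eq_square algebra_simps)
  ultimately show ?thesis by simp
qed

text \<open>The first factor bounds the form at a unit vector on the edge. The second is the
  reciprocal of the growth of the squared modulus over a distance \<open>Y\<close>, with rate 2 Re
  (\<nu> / 4) - 7 (2 K).\<close>

definition \<epsilon> where "\<epsilon> \<nu> = exp (12 * K + 1) * exp (- ((Re \<nu> / 2 - 14 * K) * Y))"

text \<open>Along increasing \<open>y\<close> the coordinate \<open>r\<close> decays and
  \<open>s\<close> grows. The solution with \<open>s = 0\<close> is therefore started at
  \<open>Y\<close> and followed downwards, the one with \<open>r = 0\<close> at \<open>- Y\<close>
  and upwards, and each stays in its own cone.\<close>

lemma hat_form_small:
  assumes h: "hat_mon \<nu> \<alpha> \<beta> \<gamma> \<delta>" and \<nu>: "64 * K \<le> Re \<nu>" "\<bar>Im \<nu>\<bar> \<le> 1"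
  shows "\<exists>\<sigma>. cmod \<sigma> \<le> 1/2 \<and> cmod (\<gamma> + (\<delta> - \<alpha>) * \<sigma> + - \<beta> * \<sigma>\<^sup>2) \<le> \<epsilon> \<nu>" (is ?t1)
    and "\<exists>\<tau>. cmod \<tau> \<le> 1/2 \<and> cmod (\<gamma> * \<tau>\<^sup>2 + (\<delta> - \<alpha>) * \<tau> + - \<beta>) \<le> \<epsilon> \<nu>" (is ?t2)
proof -
  have \<nu>1: "1 \<le> cmod \<nu>" using complex_Re_le_cmod[of \<nu>] \<nu>(1) K(1) by linarith
  have \<nu>0: "\<nu> \<noteq> 0" using \<nu>1 by auto
  \<comment> \<open>This is the cone condition of \<open>system_growth\<close> for the exponent
    \<nu> / 4 and remainder constant 2 K; it is the origin of the threshold 64 K.\<close>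
  have z: "8 * (2 * K) \<le> Re (\<nu> / 4)" using \<nu>(1) by simp
  have K0: "0 \<le> 2 * K" using K(1) by simp
  have rate: "(2 * Re (\<nu> / 4) - 7 * (2 * K)) * Y = (Re \<nu> / 2 - 14 * K) * Y" by simp
  have iw: "cmod (\<i> * w 0 y) \<le> K" if "y \<in> {-Y..Y}" for y
    using K(2)[of 0 y] that by (simp add: norm_mult)
  have zz: "(0::real) \<in> {0..1}" by simp
  \<comment> \<open>Dividing the bounded value of the form by the square of the dominant coordinate
    \<open>p\<close> produces the exponential smallness. The cone keeps the ratio of the coordinates
    below 1/2, which is the separation demanded by \<open>quadratic_form_small\<close>.\<close>
  have ratio: "p \<noteq> 0" "cmod (q / p) \<le> 1/2" "cmod (X / p\<^sup>2) \<le> \<epsilon> \<nu>"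
    if e: "exp ((Re \<nu> / 2 - 14 * K) * Y) \<le> (cmod p)\<^sup>2 - 4 * (cmod q)\<^sup>2"
      and X: "cmod X \<le> exp (12 * K + 1)" for p q X :: complex
  proof -
    have p: "exp ((Re \<nu> / 2 - 14 * K) * Y) \<le> (cmod p)\<^sup>2"
      using e by (smt (verit) zero_le_power2)
    with exp_gt_zero have p0: "(cmod p)\<^sup>2 > 0" by (rule less_le_trans)
    then show "p \<noteq> 0" by auto
    have "(2 * cmod q)\<^sup>2 \<le> (cmod p)\<^sup>2"
      using order_trans[OF exp_ge_zero e] by (simp add: power_mult_distrib)
    then have "2 * cmod q \<le> cmod p" by (rule power2_le_imp_le) simp
    then show "cmod (q / p) \<le> 1/2" using p0 by (simp add: norm_divide field_simps)
    have "cmod X / (cmod p)\<^sup>2 \<le> exp (12 * K + 1) / exp ((Re \<nu> / 2 - 14 * K) * Y)"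
      using X p by (intro frac_le) auto
    also have "\<dots> = \<epsilon> \<nu>" by (simp only: \<epsilon>_def exp_minus divide_inverse)
    finally show "cmod (X / p\<^sup>2) \<le> \<epsilon> \<nu>" by (simp only: norm_divide norm_power)
  qed
  show ?t1
  proof -
    have sub: "{0..Y} \<subseteq> {-Y..Y}" and Y0: "0 \<le> Y" using Y_pos by auto
    obtain \<phi> where \<phi>: "\<phi> Y = unhat \<nu> (u 0 Y) 1 0"
      "\<And>y. y \<in> {0..Y} \<Longrightarrow> (\<phi> has_vector_derivative mv2 (connW (\<nu>\<^sup>2) 0 y) (\<phi> y)) (at y within {0..Y})"
      using linear_ode_exists_terminal[OF bounded_bilinear_mv2 Y0 cont_connW[OF zz sub]] by blast
    define r s where "r y = hat_r \<nu> (u 0 y) (\<phi> y)" and "s y = hat_s \<nu> (u 0 y) (\<phi> y)" for y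
    have rsY: "r Y = 1" "s Y = 0" by (simp_all add: r_def s_def \<phi>(1) hat_unhat[OF \<nu>0])
    note d = der_hat_y[OF \<phi>(2) \<nu>0 zz _ sub, folded r_def s_def]
    have "exp ((2 * Re (\<nu> / 4) - 7 * (2 * K)) * (Y - 0)) \<le> (cmod (r 0))\<^sup>2 - 4 * (cmod (s 0))\<^sup>2"
    proof (rule system_growth_backward[OF Y0 d(1) d(2) _ _ z K0 rsY])
      fix y assume "y \<in> {0..Y}"
      then have y: "y \<in> {-Y..Y}" using sub by blast
      show "cmod (\<i> * w 0 y * s y + n1 0 y (r y) (s y) / \<nu> / 8) \<le> 2 * K * (cmod (r y) + cmod (s y))"
        "cmod (\<i> * w 0 y * r y + n2 0 y (r y) (s y) / \<nu> / 8) \<le> 2 * K * (cmod (r y) + cmod (s y))"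
        by (intro lower_order_bound K(4,5) zz y iw \<nu>1; simp)+
    qed (use sub in auto)
    then have e: "exp ((Re \<nu> / 2 - 14 * K) * Y) \<le> (cmod (r 0))\<^sup>2 - 4 * (cmod (s 0))\<^sup>2"
      unfolding rate[symmetric] by simp
    have "cmod (\<gamma> * (r 0)\<^sup>2 + (\<delta> - \<alpha>) * (r 0 * s 0) - \<beta> * (s 0)\<^sup>2) \<le> exp (12 * K + 1)"
      using hat_form_transport[OF h \<nu>1 \<nu>(2) sub, of Y \<phi>] \<phi>(2) rsY Y0 by (simp add: r_def s_def)
    note * = ratio[OF e this]
    have "(\<gamma> * (r 0)\<^sup>2 + (\<delta> - \<alpha>) * (r 0 * s 0) - \<beta> * (s 0)\<^sup>2) / (r 0)\<^sup>2
      = \<gamma> + (\<delta> - \<alpha>) * (s 0 / r 0) + - \<beta> * (s 0 / r 0)\<^sup>2"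
      using *(1) by (simp add: field_simps power2_eq_square)
    with *(2,3) show ?t1 by (intro exI[of _ "s 0 / r 0"]) simp
  qed
  show ?t2
  proof -
    have sub: "{-Y..0} \<subseteq> {-Y..Y}" and Y0: "-Y \<le> 0" using Y_pos by auto
    obtain \<phi> where \<phi>: "\<phi> (-Y) = unhat \<nu> (u 0 (-Y)) 0 1"
      "\<And>y. y \<in> {-Y..0} \<Longrightarrow> (\<phi> has_vector_derivative mv2 (connW (\<nu>\<^sup>2) 0 y) (\<phi> y)) (at y within {-Y..0})"
      using linear_ode_exists[OF bounded_bilinear_mv2 Y0 cont_connW[OF zz sub]] by blast
    define r s where "r y = hat_r \<nu> (u 0 y) (\<phi> y)" and "s y = hat_s \<nu> (u 0 y) (\<phi> y)" for y
    have rsY: "s (-Y) = 1" "r (-Y) = 0" by (simp_all add: r_def s_def \<phi>(1) hat_unhat[OF \<nu>0])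
    note d = der_hat_y[OF \<phi>(2) \<nu>0 zz _ sub, folded r_def s_def]
    have "exp ((2 * Re (\<nu> / 4) - 7 * (2 * K)) * (0 - - Y)) \<le> (cmod (s 0))\<^sup>2 - 4 * (cmod (r 0))\<^sup>2"
    proof (rule system_growth[OF Y0 d(2) d(1) _ _ z K0 rsY])
      fix y assume "y \<in> {-Y..0}"
      then have y: "y \<in> {-Y..Y}" using sub by blast
      have "cmod (\<i> * w 0 y * s y + n1 0 y (r y) (s y) / \<nu> / 8) \<le> 2 * K * (cmod (r y) + cmod (s y))"
        "cmod (\<i> * w 0 y * r y + n2 0 y (r y) (s y) / \<nu> / 8) \<le> 2 * K * (cmod (r y) + cmod (s y))"
        by (intro lower_order_bound K(4,5) zz y iw \<nu>1; simp)+
      then show "cmod (\<i> * w 0 y * s y + n1 0 y (r y) (s y) / \<nu> / 8) \<le> 2 * K * (cmod (s y) + cmod (r y))"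
        "cmod (\<i> * w 0 y * r y + n2 0 y (r y) (s y) / \<nu> / 8) \<le> 2 * K * (cmod (s y) + cmod (r y))"
        by (simp_all add: add.commute)
    qed (use sub in auto)
    then have e: "exp ((Re \<nu> / 2 - 14 * K) * Y) \<le> (cmod (s 0))\<^sup>2 - 4 * (cmod (r 0))\<^sup>2"
      unfolding rate[symmetric] by simp
    have "cmod (\<gamma> * (r 0)\<^sup>2 + (\<delta> - \<alpha>) * (r 0 * s 0) - \<beta> * (s 0)\<^sup>2) \<le> exp (12 * K + 1)"
      using hat_form_transport[OF h \<nu>1 \<nu>(2) sub, of "-Y" \<phi>] \<phi>(2) rsY Y0 by (simp add: r_def s_def)
    note * = ratio[OF e this]
    have "(\<gamma> * (r 0)\<^sup>2 + (\<delta> - \<alpha>) * (r 0 * s 0) - \<beta> * (s 0)\<^sup>2) / (s 0)\<^sup>2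
      = \<gamma> * (r 0 / s 0)\<^sup>2 + (\<delta> - \<alpha>) * (r 0 / s 0) + - \<beta>"
      using *(1) by (simp add: field_simps power2_eq_square)
    with *(2,3) show ?t2 by (intro exI[of _ "r 0 / s 0"]) simp
  qed
qed

text \<open>Since the determinant is 1, the discriminant of the form is the squared trace minus 4,
  so a branch point gives a double root. The alternative condition says that the form vanishes at
  (1, 1).\<close>

lemma hat_mon_nearly_scalar:
  assumes h: "hat_mon \<nu> \<alpha> \<beta> \<gamma> \<delta>" and \<nu>: "64 * K \<le> Re \<nu>" "\<bar>Im \<nu>\<bar> \<le> 1"
    and c: "(\<alpha> + \<delta>)\<^sup>2 = 4 \<or> \<gamma> + \<delta> = \<alpha> + \<beta>"
  shows "cmod \<gamma> \<le> 4 * \<epsilon> \<nu>" "cmod (\<delta> - \<alpha>) \<le> 8 * \<epsilon> \<nu>" "cmod \<beta> \<le> 4 * \<epsilon> \<nu>"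
proof -
  have "\<nu> \<noteq> 0" using \<nu>(1) K(1) by auto
  note det = hat_mon_det[OF h this]
  obtain \<sigma> where s: "cmod \<sigma> \<le> 1/2" "cmod (\<gamma> + (\<delta> - \<alpha>) * \<sigma> + - \<beta> * \<sigma>\<^sup>2) \<le> \<epsilon> \<nu>"
    using hat_form_small(1)[OF h \<nu>] by blast
  obtain \<tau> where t: "cmod \<tau> \<le> 1/2" "cmod (\<gamma> * \<tau>\<^sup>2 + (\<delta> - \<alpha>) * \<tau> + - \<beta>) \<le> \<epsilon> \<nu>"
    using hat_form_small(2)[OF h \<nu>] by blast
  have "\<gamma> + (\<delta> - \<alpha>) + - \<beta> = 0 \<or> (\<delta> - \<alpha>)\<^sup>2 = 4 * \<gamma> * - \<beta>"
    using c
  proof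
    assume "(\<alpha> + \<delta>)\<^sup>2 = 4"
    moreover have "(\<delta> - \<alpha>)\<^sup>2 = (\<alpha> + \<delta>)\<^sup>2 - 4 * (\<alpha> * \<delta> - \<beta> * \<gamma>) - 4 * \<gamma> * \<beta>"
      by (simp add: power2_eq_square algebra_simps)
    ultimately show ?thesis using det by simp
  qed (simp add: algebra_simps)
  moreover have "0 \<le> \<epsilon> \<nu>" by (simp add: \<epsilon>_def)
  ultimately have "cmod \<gamma> \<le> 4 * \<epsilon> \<nu> \<and> cmod (\<delta> - \<alpha>) \<le> 8 * \<epsilon> \<nu> \<and> cmod (- \<beta>) \<le> 4 * \<epsilon> \<nu>"
    by (intro quadratic_form_small[OF _ s t])
  then show "cmod \<gamma> \<le> 4 * \<epsilon> \<nu>" "cmod (\<delta> - \<alpha>) \<le> 8 * \<epsilon> \<nu>" "cmod \<beta> \<le> 4 * \<epsilon> \<nu>" by simp_all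
qed

end

section \<open>Separation of two spectral parameters by a Wronskian\<close>

lemma error_sum_identities:
  fixes B K M R :: real
  shows "1/4 + (B * (4 * M / R) + (4 * M / R) * B) = 1/4 + 8 * M * B / R"
    and "1/4 + 8 * M * B / R + 4 * M / R * B + 8 * K * B\<^sup>2 / (2 * R * 1)
      = 1/4 + (12 * M * B + 4 * K * B\<^sup>2) / R"
proof -
  define t s where "t = M * B / R" and "s = K * B\<^sup>2 / R"
  have e: "B * (4 * M / R) = 4 * t" "4 * M / R * B = 4 * t" "8 * M * B / R = 8 * t"
     unfolding t_def by (simp_all only: times_divide_eq_right times_divide_eq_left mult.assoc mult.commute[of B])
  have f: "8 * K * B\<^sup>2 / (2 * R * 1) = 4 * s" unfolding s_def by simp
  have g: "(12 * M * B + 4 * K * B\<^sup>2) / R = 12 * t + 4 * s"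
    unfolding s_def t_def add_divide_distrib by (simp_all only: times_divide_eq_right times_divide_eq_left mult.assoc)
  show "1/4 + (B * (4 * M / R) + (4 * M / R) * B) = 1/4 + 8 * M * B / R"
    unfolding e by simp
  show "1/4 + 8 * M * B / R + 4 * M / R * B + 8 * K * B\<^sup>2 / (2 * R * 1)
      = 1/4 + (12 * M * B + 4 * K * B\<^sup>2) / R"
    unfolding e f g by simp
qed

context sinh_gordon_rectangle
begin

text \<open>A bound for squared moduli along the period when the initial vector is a unit vector;
  being at least 1, it bounds the moduli themselves too.\<close>

definition B where "B = exp (12 * K + 1)"

lemma B_ge_1: "1 \<le> B"
  using K(1) by (simp add: B_def)

lemma hat_x_bounded_unit:
  assumes v: "xsol (\<nu>\<^sup>2) y v" and y: "y \<in> {-Y..Y}" and \<nu>: "1 \<le> cmod \<nu>" "\<bar>Im \<nu>\<bar> \<le> 1" and x: "x \<in> {0..1}"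
    and n: "(cmod (hat_r \<nu> (u 0 y) (v 0)))\<^sup>2 + (cmod (hat_s \<nu> (u 0 y) (v 0)))\<^sup>2 = 1"
  shows "cmod (hat_r \<nu> (u x y) (v x)) \<le> B" "cmod (hat_s \<nu> (u x y) (v x)) \<le> B"
proof -
  have "(cmod (hat_r \<nu> (u x y) (v x)))\<^sup>2 + (cmod (hat_s \<nu> (u x y) (v x)))\<^sup>2 \<le> B"
    using hat_x_bounded[OF v y \<nu> x] n by (simp add: B_def)
  moreover have "B \<le> B\<^sup>2" using B_ge_1 by (intro self_le_power) auto
  ultimately have "(cmod (hat_r \<nu> (u x y) (v x)))\<^sup>2 \<le> B\<^sup>2" "(cmod (hat_s \<nu> (u x y) (v x)))\<^sup>2 \<le> B\<^sup>2"
    by (smt (verit) zero_le_power2)+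
  then show "cmod (hat_r \<nu> (u x y) (v x)) \<le> B" "cmod (hat_s \<nu> (u x y) (v x)) \<le> B"
    using B_ge_1 by (auto intro: power2_le_imp_le)
qed

text \<open>The constant of \<open>system_oscillation\<close> with its \<open>K\<close> replaced by
  \<open>K * B\<close>: the remainders contain \<open>r\<close> and \<open>s\<close>, which are
  themselves only bounded by \<open>B\<close>.\<close>

definition M where "M = 28 * (K * B) ^ 3 * B"

text \<open>A solution starting in one coordinate direction stays there up to O(1 / \<nu>). The
  second claim is \<open>system_oscillation\<close> with \<open>r\<close> and \<open>s\<close>
  exchanged and \<open>z\<close> replaced by \<open>- z\<close>.\<close>

lemma hat_x_oscillation:
  assumes v: "xsol (\<nu>\<^sup>2) y v" and y: "y \<in> {-Y..Y}" and \<nu>: "4 \<le> cmod \<nu>" "\<bar>Im \<nu>\<bar> \<le> 1" and x: "x \<in> {0..1}"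
  defines "r \<equiv> \<lambda>x. hat_r \<nu> (u x y) (v x)" and "s \<equiv> \<lambda>x. hat_s \<nu> (u x y) (v x)"
  shows "r 0 = 1 \<Longrightarrow> s 0 = 0 \<Longrightarrow> cmod (s x) \<le> M / cmod (\<i> * \<nu> / 4) \<and>
      cmod (w x y * s x + \<i> * n1 x y (r x) (s x) / \<nu> / 8) \<le> M / cmod (\<i> * \<nu> / 4)"
    and "r 0 = 0 \<Longrightarrow> s 0 = 1 \<Longrightarrow> cmod (r x) \<le> M / cmod (\<i> * \<nu> / 4) \<and>
      cmod (w x y * r x + \<i> * n2 x y (r x) (s x) / \<nu> / 8) \<le> M / cmod (\<i> * \<nu> / 4)"
proof -
  have \<nu>1: "1 \<le> cmod \<nu>" using \<nu>(1) by simp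
  then have \<nu>0: "\<nu> \<noteq> 0" by auto
  define z where "z = \<i> * \<nu> / 4"
  have z: "\<bar>Re z\<bar> \<le> 1" "1 \<le> cmod z" "cmod z = cmod \<nu> / 4"
    using \<nu> by (simp_all add: z_def norm_mult norm_divide)
  have KB: "K \<le> K * B" "1 \<le> K * B"
    using K(1) B_ge_1 mult_mono[of 1 K 1 B] by (simp_all add: mult_le_cancel_left1)
  have M: "27 * (K * B)\<^sup>2 * B \<le> M"
  proof -
    have "(K * B)\<^sup>2 \<le> (K * B) ^ 3" using KB(2) by (intro power_increasing) auto
    moreover have "0 \<le> (K * B)\<^sup>2" by simp
    ultimately have "27 * (K * B)\<^sup>2 \<le> 28 * (K * B) ^ 3" by linarith
    then show ?thesis unfolding M_def using B_ge_1 by (intro mult_right_mono) auto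
  qed
  have rs: "hat_r \<nu> (u x y) (v x) = r x" "hat_s \<nu> (u x y) (v x) = s x" for x
    by (simp_all add: r_def s_def)
  note d = der_hat_x[OF v \<nu>0 _ y, unfolded rs, folded z_def, unfolded add.assoc[symmetric]]
  have w: "cmod (w x y) \<le> K * B" "cmod (wx x y) \<le> K * B" if "x \<in> {0..1}" for x
    using K(2,3)[OF that y] KB by linarith+
  have n: "cmod (\<i> * n1 x y (r x) (s x) / \<nu> / 8) \<le> K * B / cmod z"
    "cmod (\<i> * n2 x y (r x) (s x) / \<nu> / 8) \<le> K * B / cmod z"
    if x: "x \<in> {0..1}" and rs: "cmod (r x) \<le> B" "cmod (s x) \<le> B" for x
  proof -
    have "2 * K * (cmod (r x) + cmod (s x)) \<le> 2 * K * (2 * B)"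
      using rs K(1) by (intro mult_left_mono) auto
    then have "cmod (n1 x y (r x) (s x)) \<le> 4 * (K * B)" "cmod (n2 x y (r x) (s x)) \<le> 4 * (K * B)"
      using K(4,5)[OF x y, of "r x" "s x"] by linarith+
    then have "cmod (n1 x y (r x) (s x)) / (8 * cmod \<nu>) \<le> 32 * (K * B) / (8 * cmod \<nu>)"
      "cmod (n2 x y (r x) (s x)) / (8 * cmod \<nu>) \<le> 32 * (K * B) / (8 * cmod \<nu>)"
      using KB by (intro divide_right_mono; simp)+
    then show "cmod (\<i> * n1 x y (r x) (s x) / \<nu> / 8) \<le> K * B / cmod z"
      "cmod (\<i> * n2 x y (r x) (s x) / \<nu> / 8) \<le> K * B / cmod z"
      unfolding z(3) by (simp_all add: norm_mult norm_divide mult.commute)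
  qed
  have le: "X \<le> 27 * (K * B)\<^sup>2 * B / cmod z \<Longrightarrow> X \<le> M / cmod z" for X
    using divide_right_mono[OF M, of "cmod z"] by simp
  have dw: "((\<lambda>x. w x y) has_vector_derivative wx x y) (at x within {0..1})" if "x \<in> {0..1}" for x
    by (rule der_w[OF that y])
  { assume 0: "r 0 = 1" "s 0 = 0"
    have b: "cmod (r x) \<le> B" "cmod (s x) \<le> B" if "x \<in> {0..1}" for x
      using hat_x_bounded_unit[OF v y \<nu>1 \<nu>(2) that] 0 by (simp_all add: r_def s_def)
    have n1': "cmod (\<i> * n1 x y (r x) (s x) / \<nu> / 8) \<le> K * B / cmod z"
      and n2': "cmod (\<i> * n2 x y (r x) (s x) / \<nu> / 8) \<le> K * B / cmod z" if "x \<in> {0..1}" for x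
      using n[OF that b[OF that]] by simp_all
    note o = system_oscillation[OF d(1) d(2) dw w b n1' n2' z(1,2) KB(2) B_ge_1 0(2) x]
    show "cmod (s x) \<le> M / cmod (\<i> * \<nu> / 4) \<and>
      cmod (w x y * s x + \<i> * n1 x y (r x) (s x) / \<nu> / 8) \<le> M / cmod (\<i> * \<nu> / 4)"
      unfolding z_def[symmetric] using le[OF o(1)] o(2) by (simp add: M_def) }
  { assume 0: "r 0 = 0" "s 0 = 1"
    have b: "cmod (s x) \<le> B" "cmod (r x) \<le> B" if "x \<in> {0..1}" for x
      using hat_x_bounded_unit[OF v y \<nu>1 \<nu>(2) that] 0 by (simp_all add: r_def s_def)
    have z': "\<bar>Re (- z)\<bar> \<le> 1" "1 \<le> cmod (- z)" using z by simp_all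
    have d1: "(r has_vector_derivative - (- z) * r x + w x y * s x + \<i> * n1 x y (r x) (s x) / \<nu> / 8) (at x within {0..1})"
      if "x \<in> {0..1}" for x using d(1)[OF that] by simp
    have n1': "cmod (\<i> * n1 x y (r x) (s x) / \<nu> / 8) \<le> K * B / cmod (- z)"
      and n2': "cmod (\<i> * n2 x y (r x) (s x) / \<nu> / 8) \<le> K * B / cmod (- z)" if "x \<in> {0..1}" for x
      using n[OF that b(2,1)[OF that]] by simp_all
    note o = system_oscillation[where z = "- z", OF d(2) d1 dw w b n2' n1' z' KB(2) B_ge_1 0(1) x,
        unfolded norm_minus_cancel[of z]]
    show "cmod (r x) \<le> M / cmod (\<i> * \<nu> / 4) \<and>
      cmod (w x y * r x + \<i> * n2 x y (r x) (s x) / \<nu> / 8) \<le> M / cmod (\<i> * \<nu> / 4)"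
      unfolding z_def[symmetric] using le[OF o(1)] o(2) by (simp add: M_def) }
qed

text \<open>The first summand is the threshold of \<open>hat_form_small\<close>. The second makes
  the total error (12 M B + 4 K B^2) / R0 in \<open>hat_mon_separation\<close> at most 1/4.\<close>

definition R0 where "R0 = 64 * K + 4 * (12 * M * B + 4 * K * B\<^sup>2)"

lemma M_nonneg: "0 \<le> M"
proof -
  have "0 \<le> K" "0 \<le> B" using K(1) B_ge_1 by linarith+
  then show ?thesis unfolding M_def by simp
qed

lemma R0_ge: "64 * K \<le> R0" "4 * (12 * M * B + 4 * K * B\<^sup>2) \<le> R0" "64 \<le> R0"
proof -
  have "0 \<le> 12 * M * B" "0 \<le> 4 * K * B\<^sup>2" using K(1) B_ge_1 M_nonneg by auto
  then have "0 \<le> 4 * (12 * M * B + 4 * K * B\<^sup>2)" by simp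
  then show "64 * K \<le> R0" "4 * (12 * M * B + 4 * K * B\<^sup>2) \<le> R0" "64 \<le> R0"
    unfolding R0_def using K(1) by linarith+
qed

text \<open>
  The Wronskian of a solution for \<open>\<nu>\<close> close to \<open>exp (i \<nu> x / 4)\<close> and one for \<open>\<nu>'\<close> close to
  \<open>exp (- i \<nu>' x / 4)\<close> has derivative close to \<open>i (\<nu> - \<nu>') / 4\<close>.
\<close>

lemma hat_mon_separation:
  assumes h: "hat_mon \<nu> \<alpha> \<beta> \<gamma> \<delta>" and h': "hat_mon \<nu>' \<alpha>' \<beta>' \<gamma>' \<delta>'"
    and \<nu>: "R0 \<le> Re \<nu>" "\<bar>Im \<nu>\<bar> \<le> 1" and \<nu>': "R0 \<le> Re \<nu>'" "\<bar>Im \<nu>'\<bar> \<le> 1"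
    and c: "cmod (\<nu> - \<nu>') \<le> 1 / B\<^sup>2"
  shows "cmod (\<alpha> * \<delta>' - \<gamma> * \<beta>' - 1 - \<i> * (\<nu> - \<nu>') / 4) \<le> cmod (\<nu> - \<nu>') / 8"
    and "cmod \<alpha> \<le> B" "cmod \<delta>' \<le> B"
proof -
  have R: "R0 \<le> cmod \<nu>" "R0 \<le> cmod \<nu>'"
    using complex_Re_le_cmod[of \<nu>] complex_Re_le_cmod[of \<nu>'] \<nu> \<nu>' by linarith+
  then have \<nu>4: "4 \<le> cmod \<nu>" "4 \<le> cmod \<nu>'" "1 \<le> cmod \<nu>" "1 \<le> cmod \<nu>'" using R0_ge by linarith+
  then have \<nu>0: "\<nu> \<noteq> 0" "\<nu>' \<noteq> 0" by auto
  obtain v where v: "xsol (\<nu>\<^sup>2) 0 v" "hat_r \<nu> (u 0 0) (v 0) = 1" "hat_s \<nu> (u 0 0) (v 0) = 0"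
    using hat_xsol_exists[OF zero_mem \<nu>0(1)] by blast
  obtain v' where v': "xsol (\<nu>'\<^sup>2) 0 v'" "hat_r \<nu>' (u 0 0) (v' 0) = 0" "hat_s \<nu>' (u 0 0) (v' 0) = 1"
    using hat_xsol_exists[OF zero_mem \<nu>0(2)] by blast
  define r s r' s' where "r x = hat_r \<nu> (u x 0) (v x)" and "s x = hat_s \<nu> (u x 0) (v x)"
    and "r' x = hat_r \<nu>' (u x 0) (v' x)" and "s' x = hat_s \<nu>' (u x 0) (v' x)" for x
  have init: "r 0 = 1" "s 0 = 0" "r' 0 = 0" "s' 0 = 1"
    using v v' by (simp_all add: r_def s_def r'_def s'_def)
  have u1: "u 1 0 = u 0 0" by (rule per_u[OF zero_mem])
  have fin: "r 1 = \<alpha>" "s 1 = \<gamma>" "r' 1 = \<beta>'" "s' 1 = \<delta>'"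
    using h h' v v' by (simp_all add: r_def s_def r'_def s'_def u1 hat_mon_def)
  define z z' where "z = \<i> * \<nu> / 4" and "z' = \<i> * \<nu>' / 4"
  note d = der_hat_x[OF v(1) \<nu>0(1) _ zero_mem, folded r_def s_def z_def]
    and d' = der_hat_x[OF v'(1) \<nu>0(2) _ zero_mem, folded r'_def s'_def z'_def]
  have Bd: "cmod (r x) \<le> B" "cmod (s x) \<le> B" "cmod (r' x) \<le> B" "cmod (s' x) \<le> B" if "x \<in> {0..1}" for x
    using hat_x_bounded_unit[OF v(1) zero_mem \<nu>4(3) \<nu>(2) that] hat_x_bounded_unit[OF v'(1) zero_mem \<nu>4(4) \<nu>'(2) that]
    using v v' by (simp_all add: r_def s_def r'_def s'_def)
  show "cmod \<alpha> \<le> B" "cmod \<delta>' \<le> B" using Bd(1,4)[of 1] by (simp_all add: fin)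
  have zz: "cmod z = cmod \<nu> / 4" "cmod z' = cmod \<nu>' / 4" "cmod (z - z') = cmod (\<nu> - \<nu>') / 4"
    by (simp_all add: z_def z'_def norm_mult norm_divide flip: right_diff_distrib diff_divide_distrib)
  have Mz: "M / cmod z \<le> 4 * M / R0" "M / cmod z' \<le> 4 * M / R0"
    unfolding zz using M_nonneg R R0_ge(3) by (simp_all add: frac_le)
  have osc: "cmod (s x) \<le> 4 * M / R0" "cmod (w x 0 * s x + \<i> * n1 x 0 (r x) (s x) / \<nu> / 8) \<le> 4 * M / R0"
    "cmod (r' x) \<le> 4 * M / R0" "cmod (w x 0 * r' x + \<i> * n2 x 0 (r' x) (s' x) / \<nu>' / 8) \<le> 4 * M / R0"
    if "x \<in> {0..1}" for x
    using hat_x_oscillation(1)[OF v(1) zero_mem \<nu>4(1) \<nu>(2) that, folded r_def s_def z_def]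
      hat_x_oscillation(2)[OF v'(1) zero_mem \<nu>4(2) \<nu>'(2) that, folded r'_def s'_def z'_def] init Mz
    by linarith+
  define X where "X x = n1 x 0 (r x) (s x) * s' x - n2 x 0 (r x) (s x) * r' x" for x
  \<comment> \<open>\<open>X\<close> is the determinant of the image of (r, s) under the remainder
    matrix with (r', s'). As that matrix is trace-free, moving it to the other argument changes only
    the sign.\<close>
  have X': "r x * n2 x 0 (r' x) (s' x) - s x * n1 x 0 (r' x) (s' x) = - X x" for x
    unfolding X_def n1_def n2_def by (simp add: algebra_simps)
  have Xb: "cmod (X x) \<le> 8 * K * B\<^sup>2" if x: "x \<in> {0..1}" for x
  proof -
    have "2 * K * (cmod (r x) + cmod (s x)) \<le> 2 * K * (2 * B)"
      using Bd[OF x] K(1) by (intro mult_left_mono) auto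
    then have n: "cmod (n1 x 0 (r x) (s x)) \<le> 4 * K * B" "cmod (n2 x 0 (r x) (s x)) \<le> 4 * K * B"
      using K(4,5)[OF x zero_mem, of "r x" "s x"] by linarith+
    have "cmod (n1 x 0 (r x) (s x) * s' x) \<le> 4 * K * B * B" "cmod (n2 x 0 (r x) (s x) * r' x) \<le> 4 * K * B * B"
      unfolding norm_mult using n Bd[OF x] K(1) B_ge_1 by (intro mult_mono; simp)+
    then show ?thesis
      unfolding X_def using norm_triangle_ineq4[of "n1 x 0 (r x) (s x) * s' x" "n2 x 0 (r x) (s x) * r' x"]
      by (simp add: power2_eq_square algebra_simps)
  qed
  define m where "m x = r x * s' x" for x
  have m1: "cmod (m x - 1) \<le> 1/4 + 8 * M * B / R0" if x: "x \<in> {0..1}" for x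
  proof -
    let ?a = "\<lambda>x. w x 0 * s x + \<i> * n1 x 0 (r x) (s x) / \<nu> / 8"
    let ?b = "\<lambda>x. w x 0 * r' x + \<i> * n2 x 0 (r' x) (s' x) / \<nu>' / 8"
    have "cmod (m x - m 0) \<le> 1/4 + 8 * M * B / R0"
    proof (rule norm_bound_of_deriv[OF _ _ x])
      fix x :: real assume x: "x \<in> {0..1}"
      show "(m has_vector_derivative r x * (- z' * s' x + ?b x) + (z * r x + ?a x) * s' x) (at x within {0..1})"
        unfolding m_def by (intro has_vector_derivative_mult d d' x)
      have eq: "r x * (- z' * s' x + ?b x) + (z * r x + ?a x) * s' x
          = (z - z') * (r x * s' x) + (r x * ?b x + ?a x * s' x)"
        by (simp add: algebra_simps)
      have "cmod ((z - z') * (r x * s' x) + (r x * ?b x + ?a x * s' x)) \<le> 1/4 + (B * (4 * M / R0) + (4 * M / R0) * B)"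
      proof (intro norm_triangle_mono)
        show "cmod (r x * ?b x) \<le> B * (4 * M / R0)" "cmod (?a x * s' x) \<le> 4 * M / R0 * B"
          unfolding norm_mult using Bd[OF x] osc[OF x] B_ge_1 M_nonneg R0_ge(3) by (intro mult_mono; simp)+
        \<comment> \<open>The closeness 1 / B^2 is made for this place: it compensates the bound B^2
          on the product and leaves 1/4.\<close>
        have "cmod ((z - z') * (r x * s' x)) \<le> (1 / B\<^sup>2 / 4) * (B * B)"
          unfolding norm_mult zz(3) using c Bd[OF x] B_ge_1 by (intro mult_mono) auto
        also have "\<dots> = 1/4" using B_ge_1 by (simp add: power2_eq_square)
        finally show "cmod ((z - z') * (r x * s' x)) \<le> 1/4" .
      qed
      also have "\<dots> = 1/4 + 8 * M * B / R0" by (rule error_sum_identities)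
      finally show "cmod (r x * (- z' * s' x + ?b x) + (z * r x + ?a x) * s' x) \<le> 1/4 + 8 * M * B / R0"
        unfolding eq .
    qed
    then show ?thesis by (simp add: m_def init)
  qed
  \<comment> \<open>\<open>q\<close> is the cofactor of \<open>z - z'\<close> in the derivative of
    the Wronskian. It is near 1 because the opposite phases in \<open>r * s'\<close> almost cancel.
    Taking out \<open>z - z'\<close> exactly makes the final error relative to |\<nu> -
    \<nu>'|.\<close>
  define q where "q x = m x + s x * r' x - X x / (2 * \<nu> * \<nu>')" for x
  have q1: "cmod (q x - 1) \<le> 1/2" if x: "x \<in> {0..1}" for x
  proof -
    have "cmod (s x * r' x) \<le> (4 * M / R0) * B"
      unfolding norm_mult using osc[OF x] Bd[OF x] M_nonneg R0_ge(3) by (intro mult_mono) auto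
    moreover have "cmod (X x / (2 * \<nu> * \<nu>')) \<le> 8 * K * B\<^sup>2 / (2 * R0 * 1)"
      unfolding norm_divide norm_mult using Xb[OF x] R \<nu>4 R0_ge(3) K(1) by (intro frac_le mult_mono) auto
    moreover have "cmod (q x - 1) \<le> cmod (m x - 1) + cmod (s x * r' x) + cmod (X x / (2 * \<nu> * \<nu>'))"
    proof -
      have eq: "q x - 1 = ((m x - 1) + s x * r' x) - X x / (2 * \<nu> * \<nu>')" by (simp add: q_def)
      show ?thesis
        unfolding eq
        using norm_triangle_ineq4[of "(m x - 1) + s x * r' x" "X x / (2 * \<nu> * \<nu>')"]
          norm_triangle_ineq[of "m x - 1" "s x * r' x"] by linarith
    qed
    ultimately have "cmod (q x - 1) \<le> 1/4 + 8 * M * B / R0 + 4 * M / R0 * B + 8 * K * B\<^sup>2 / (2 * R0 * 1)"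
      using m1[OF x] by linarith
    also have "\<dots> = 1/4 + (12 * M * B + 4 * K * B\<^sup>2) / R0"
      by (rule error_sum_identities)
    also have "\<dots> \<le> 1/4 + 1/4"
      using R0_ge by (intro add_left_mono) (simp add: divide_le_eq)
    finally show ?thesis by simp
  qed
  define D where "D x = (r x * s' x - s x * r' x) - x *\<^sub>R (z - z')" for x :: real
  have "cmod (D 1 - D 0) \<le> cmod (z - z') / 2"
  proof (rule norm_bound_of_deriv)
    fix x :: real assume x: "x \<in> {0..1}"
    let ?N1 = "n1 x 0 (r x) (s x)" and ?N2 = "n2 x 0 (r x) (s x)"
      and ?N1' = "n1 x 0 (r' x) (s' x)" and ?N2' = "n2 x 0 (r' x) (s' x)"
    let ?d = "(r x * (- z' * s' x + (w x 0 * r' x + \<i> * ?N2' / \<nu>' / 8)) + (z * r x + (w x 0 * s x + \<i> * ?N1 / \<nu> / 8)) * s' x)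
        - (s x * (z' * r' x + (w x 0 * s' x + \<i> * ?N1' / \<nu>' / 8)) + (- z * s x + (w x 0 * r x + \<i> * ?N2 / \<nu> / 8)) * r' x)"
    \<comment> \<open>The \<open>w\<close> terms cancel, since their matrix is trace-free and the
      same for both parameters. The remainders combine to X (1 / \<nu> - 1 / \<nu>'), which again
      contains the difference of the parameters.\<close>
    have "?d = (z - z') * (r x * s' x + s x * r' x) + \<i> / 8 * (X x / \<nu> + (r x * ?N2' - s x * ?N1') / \<nu>')"
      unfolding X_def by (simp add: algebra_simps diff_divide_distrib add_divide_distrib)
    also have "\<dots> = (z - z') * (r x * s' x + s x * r' x) + \<i> / 8 * (X x / \<nu> - X x / \<nu>')"
      by (simp add: X')
    also have "\<dots> = (z - z') * q x"
      unfolding q_def m_def z_def z'_def using \<nu>0 by (simp add: field_simps)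
    finally have eq: "?d = (z - z') * q x" .
    have "((\<lambda>x. x *\<^sub>R (z - z')) has_vector_derivative 1 *\<^sub>R (z - z')) (at x within {0..1})"
      by (auto intro!: derivative_eq_intros simp: has_vector_derivative_def)
    then have "(D has_vector_derivative ?d - 1 *\<^sub>R (z - z')) (at x within {0..1})"
      unfolding D_def by (intro has_vector_derivative_diff has_vector_derivative_mult d d' x)
    then show "(D has_vector_derivative (z - z') * (q x - 1)) (at x within {0..1})"
      unfolding eq by (simp add: algebra_simps)
    show "cmod ((z - z') * (q x - 1)) \<le> cmod (z - z') / 2"
      unfolding norm_mult using mult_left_mono[OF q1[OF x], of "cmod (z - z')"] by simp
  qed auto
  moreover have "D 1 - D 0 = \<alpha> * \<delta>' - \<gamma> * \<beta>' - 1 - \<i> * (\<nu> - \<nu>') / 4"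
    by (simp add: D_def fin init z_def z'_def diff_divide_distrib algebra_simps)
  ultimately show "cmod (\<alpha> * \<delta>' - \<gamma> * \<beta>' - 1 - \<i> * (\<nu> - \<nu>') / 4) \<le> cmod (\<nu> - \<nu>') / 8"
    by (simp add: zz(3))
qed

end

section \<open>Exponential closeness of spectral points near 4 \<pi> n\<close>

context sinh_gordon_rectangle
begin

text \<open>Nearly scalar monodromies of determinant 1 have \<open>\<alpha>\<^sup>2\<close> and
  \<open>\<delta>'\<^sup>2\<close> near 1, so the product X of \<open>\<alpha>\<close> and
  \<open>\<delta>'\<close> has its square near 1, and in fact X itself is near 1. The Wronskian then
  deviates little from 1, while separation forces a deviation of at least |\<nu> - \<nu>'| /
  8.\<close>

lemma spectral_points_close:
  assumes h: "hat_mon \<nu> \<alpha> \<beta> \<gamma> \<delta>" and h': "hat_mon \<nu>' \<alpha>' \<beta>' \<gamma>' \<delta>'"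
    and \<nu>: "R0 \<le> Re \<nu>" "\<bar>Im \<nu>\<bar> \<le> 1" and \<nu>': "R0 \<le> Re \<nu>'" "\<bar>Im \<nu>'\<bar> \<le> 1"
    and close: "cmod (\<nu> - \<nu>') \<le> 1 / B\<^sup>2"
    and c: "(\<alpha> + \<delta>)\<^sup>2 = 4 \<or> \<gamma> + \<delta> = \<alpha> + \<beta>" and c': "(\<alpha>' + \<delta>')\<^sup>2 = 4 \<or> \<gamma>' + \<delta>' = \<alpha>' + \<beta>'"
    and small: "\<epsilon> \<nu> \<le> 1/32" "\<epsilon> \<nu>' \<le> 1/32"
  shows "cmod (\<nu> - \<nu>') \<le> 8 * ((8 * B + 16) * (\<epsilon> \<nu> * B\<^sup>2 + \<epsilon> \<nu>') + \<epsilon> \<nu>)"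
proof -
  define e e' where "e = \<epsilon> \<nu>" and "e' = \<epsilon> \<nu>'"
  have e: "0 \<le> e" "0 \<le> e'" "e \<le> 1/32" "e' \<le> 1/32"
    using small by (simp_all add: e_def e'_def \<epsilon>_def)
  have K\<nu>: "64 * K \<le> Re \<nu>" "64 * K \<le> Re \<nu>'" using R0_ge \<nu> \<nu>' by linarith+
  then have \<nu>0: "\<nu> \<noteq> 0" "\<nu>' \<noteq> 0" using K(1) by auto
  note s = hat_mon_nearly_scalar[OF h K\<nu>(1) \<nu>(2) c, folded e_def]
    and s' = hat_mon_nearly_scalar[OF h' K\<nu>(2) \<nu>'(2) c', folded e'_def]
  note sep = hat_mon_separation[OF h h' \<nu> \<nu>' close]
  have sq: "cmod (x\<^sup>2 - 1) \<le> (8 * B + 16) * t"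
    if "cmod x \<le> B" "cmod y \<le> 8 * t" "cmod p \<le> 4 * t" "cmod q \<le> 4 * t" "x\<^sup>2 - 1 = x * y + p * q" "0 \<le> t" "t \<le> 1/32"
    for x y p q :: complex and t
  proof -
    have "cmod (x * y) \<le> B * (8 * t)" "cmod (p * q) \<le> (4 * t) * (4 * t)"
      unfolding norm_mult using that B_ge_1 by (intro mult_mono; simp)+
    moreover have "(4 * t) * (4 * t) \<le> 16 * t"
      using mult_left_mono[of t 1 "16 * t"] that by simp
    ultimately have "cmod (x * y + p * q) \<le> B * (8 * t) + 16 * t"
      using norm_triangle_ineq[of "x * y" "p * q"] by linarith
    then show ?thesis using that(5) by (simp add: algebra_simps)
  qed
  have "\<alpha>\<^sup>2 - 1 = \<alpha> * - (\<delta> - \<alpha>) + \<beta> * \<gamma>"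
    using hat_mon_det[OF h \<nu>0(1)] by (simp add: power2_eq_square algebra_simps)
  then have a: "cmod (\<alpha>\<^sup>2 - 1) \<le> (8 * B + 16) * e"
    by (intro sq[of _ "- (\<delta> - \<alpha>)" _ \<beta> \<gamma>] sep e) (use s in \<open>simp_all only: norm_minus_cancel\<close>)
  have "\<delta>'\<^sup>2 - 1 = \<delta>' * (\<delta>' - \<alpha>') + \<beta>' * \<gamma>'"
    using hat_mon_det[OF h' \<nu>0(2)] by (simp add: power2_eq_square algebra_simps)
  then have d: "cmod (\<delta>'\<^sup>2 - 1) \<le> (8 * B + 16) * e'"
    by (intro sq[of _ "\<delta>' - \<alpha>'" _ \<beta>' \<gamma>'] sep e s')
  define X where "X = \<alpha> * \<delta>'"
  have eq: "X\<^sup>2 - 1 = (\<alpha>\<^sup>2 - 1) * \<delta>'\<^sup>2 + (\<delta>'\<^sup>2 - 1)"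
    by (simp add: X_def power_mult_distrib algebra_simps)
  have "cmod ((\<alpha>\<^sup>2 - 1) * \<delta>'\<^sup>2) \<le> ((8 * B + 16) * e) * B\<^sup>2"
    unfolding norm_mult norm_power using a sep(3) B_ge_1 e by (intro mult_mono power_mono) auto
  then have X2: "cmod (X\<^sup>2 - 1) \<le> ((8 * B + 16) * e) * B\<^sup>2 + (8 * B + 16) * e'"
    unfolding eq using d norm_triangle_ineq[of "(\<alpha>\<^sup>2 - 1) * \<delta>'\<^sup>2" "\<delta>'\<^sup>2 - 1"] by linarith
  have gb: "cmod (\<gamma> * \<beta>') \<le> e"
  proof -
    have "cmod (\<gamma> * \<beta>') \<le> (4 * e) * (4 * (1/32))"
      unfolding norm_mult using s s' e by (intro mult_mono) auto
    then show ?thesis using e by simp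
  qed
  define \<Delta> where "\<Delta> = cmod (\<nu> - \<nu>')"
  have "1 / B\<^sup>2 \<le> 1" using B_ge_1 one_le_power[of B 2] by (simp add: divide_le_eq)
  then have \<Delta>: "0 \<le> \<Delta>" "\<Delta> \<le> 1" using close unfolding \<Delta>_def by (simp, linarith)
  have i: "cmod (\<i> * (\<nu> - \<nu>') / 4) = \<Delta> / 4"
    by (simp add: \<Delta>_def norm_mult norm_divide)
  define W where "W = X - \<gamma> * \<beta>' - 1"
  have sep1: "cmod (W - \<i> * (\<nu> - \<nu>') / 4) \<le> \<Delta> / 8"
    using sep(1) by (simp add: W_def X_def \<Delta>_def)
  then have W: "\<Delta> / 8 \<le> cmod W" "cmod W \<le> 3 * \<Delta> / 8"
    using norm_triangle_ineq3[of W "\<i> * (\<nu> - \<nu>') / 4"] unfolding i by linarith+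
  have XW: "X - 1 = W + \<gamma> * \<beta>'" "W = (X - 1) - \<gamma> * \<beta>'" by (simp_all add: W_def)
  \<comment> \<open>Separation and closeness of the parameters keep \<open>X\<close> in the unit
    disc around 1; this excludes the other square root, -1, and keeps \<open>X + 1\<close> away from
    0.\<close>
  have "cmod (X - 1) \<le> 1"
    using norm_triangle_ineq[of W "\<gamma> * \<beta>'"] W \<Delta> gb e unfolding XW(1) by linarith
  moreover have "cmod (2 - (X + 1)) = cmod (X - 1)" by (simp add: norm_minus_commute)
  ultimately have "1 \<le> cmod (X + 1)" using norm_triangle_ineq2[of 2 "X + 1"] norm_minus_commute[of 2 "X + 1"] norm_triangle_sub[of 2 "X + 1"] by simp
  then have "cmod (X - 1) * 1 \<le> cmod (X - 1) * cmod (X + 1)" by (intro mult_left_mono) auto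
  also have "\<dots> = cmod (X\<^sup>2 - 1)" by (simp add: power2_eq_square algebra_simps flip: norm_mult)
  finally have X1: "cmod (X - 1) \<le> ((8 * B + 16) * e) * B\<^sup>2 + (8 * B + 16) * e'" using X2 by simp
  have "cmod W \<le> cmod (X - 1) + cmod (\<gamma> * \<beta>')" unfolding XW(2) by (rule norm_triangle_ineq4)
  with W(1) have "\<Delta> / 8 \<le> cmod (X - 1) + cmod (\<gamma> * \<beta>')" by (rule order_trans)
  also have "\<dots> \<le> ((8 * B + 16) * e) * B\<^sup>2 + (8 * B + 16) * e' + e" by (intro add_mono X1 gb)
  finally have "\<Delta> \<le> 8 * (((8 * B + 16) * e) * B\<^sup>2 + (8 * B + 16) * e' + e)" by simp
  also have "\<dots> = 8 * ((8 * B + 16) * (e * B\<^sup>2 + e') + e)" by (simp add: algebra_simps)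
  finally show ?thesis by (simp add: \<Delta>_def e_def e'_def)
qed

text \<open>Branch points and zeros of the entry \<open>c\<close> are treated alike, so the same
  comparison covers branch points and divisor points.\<close>

definition spectral_point where
  "spectral_point l \<longleftrightarrow> (\<exists>a b c d. is_mon l a b c d \<and> ((a + d)\<^sup>2 = 4 \<or> c = 0))"

text \<open>If \<open>c = 0\<close>, the first basis vector is an eigenvector; its gauged
  coordinates are equal, so the form vanishes at (1, 1). The difference of the diagonal entries
  becomes \<open>\<beta> + \<gamma>\<close>, which is small for a nearly scalar matrix.\<close>

lemma hat_mon_of_spectral_point:
  assumes m: "is_mon (\<nu>\<^sup>2) a b c d" and \<nu>: "\<nu> \<noteq> 0" and c: "(a + d)\<^sup>2 = 4 \<or> c = 0"
  obtains \<alpha> \<beta> \<gamma> \<delta> where "hat_mon \<nu> \<alpha> \<beta> \<gamma> \<delta>" "(\<alpha> + \<delta>)\<^sup>2 = 4 \<or> \<gamma> + \<delta> = \<alpha> + \<beta>" "\<beta> + \<gamma> = a - d"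
proof -
  define b' c' where "b' = b * \<nu> * exp (- u 0 0 / 2)" and "c' = c * exp (u 0 0 / 2) / \<nu>"
  have h: "hat_mon \<nu> ((a + d + \<i> * (c' - b')) / 2) ((a - d + \<i> * (b' + c')) / 2)
      ((a - d - \<i> * (b' + c')) / 2) ((a + d + \<i> * (b' - c')) / 2)"
    unfolding b'_def c'_def by (rule hat_mon_of_mon[OF m \<nu>])
  have e: "(a + d + \<i> * (c' - b')) / 2 + (a + d + \<i> * (b' - c')) / 2 = a + d"
    "(a - d - \<i> * (b' + c')) / 2 + (a + d + \<i> * (b' - c')) / 2
      = (a + d + \<i> * (c' - b')) / 2 + (a - d + \<i> * (b' + c')) / 2 - 2 * \<i> * c'"
    "(a - d + \<i> * (b' + c')) / 2 + (a - d - \<i> * (b' + c')) / 2 = a - d"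
    by (simp_all add: field_simps)
  have "c = 0 \<Longrightarrow> c' = 0" by (simp add: c'_def)
  with c show ?thesis by (intro that[OF h]) (unfold e, auto)
qed

text \<open>The constants precede the quantifiers over n and over both parameters. The first point
  keeps its monodromy entries because \<open>a - d\<close> is needed later for the divisor.\<close>

lemma exponential_decay:
  "\<exists>C>0. \<exists>\<eta>>0. \<exists>N. \<forall>n\<ge>N. \<forall>(\<nu>::complex) (\<nu>'::complex) a b c d.
    cmod (\<nu> - 4 * pi * real n) \<le> \<eta> \<longrightarrow> cmod (\<nu>' - 4 * pi * real n) \<le> \<eta> \<longrightarrow>
    is_mon (\<nu>\<^sup>2) a b c d \<longrightarrow> ((a + d)\<^sup>2 = 4 \<or> c = 0) \<longrightarrow> spectral_point (\<nu>'\<^sup>2) \<longrightarrow>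
    cmod (\<nu> - \<nu>') \<le> C * exp (- 2 * pi * real n * Y) \<and>
    cmod (a - d) \<le> C * exp (- 2 * pi * real n * Y)"
proof -
  \<comment> \<open>On the disc around 4 \<pi> n, \<open>\<epsilon>\<close> is at most
    \<open>E0\<close> times exp (- 2 \<pi> n Y): the exponent Y / 2 pays for Re \<nu> being as low
    as 4 \<pi> n - 1, and 14 K Y for the lower-order terms.\<close>
  define E0 where "E0 = exp (12 * K + 1) * exp ((1/2 + 14 * K) * Y)"
  \<comment> \<open>The first summand is the constant of \<open>spectral_points_close\<close>, the
    second bounds \<open>a - d\<close> by 4 \<open>\<epsilon>\<close> + 4
    \<open>\<epsilon>\<close>.\<close>
  define C where "C = 8 * ((8 * B + 16) * (E0 * B\<^sup>2 + E0) + E0) + 8 * E0"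
  \<comment> \<open>Half of the closeness 1 / B^2 required for separation, since each of the two
    points may be \<open>\<eta>\<close> away from the centre.\<close>
  define \<eta> where "\<eta> = 1 / (2 * B\<^sup>2)"
  \<comment> \<open>The first bound puts both points beyond \<open>R0\<close>. The second makes the
    error at most 1/32, using n Y \<le> exp (2 \<pi> n Y).\<close>
  obtain N :: nat where N: "real N \<ge> max (R0 + 1) (32 * E0 / Y)"
    using real_arch_simple by blast
  have E0: "E0 > 0" by (simp add: E0_def)
  have B2: "1 \<le> B\<^sup>2" using B_ge_1 by (rule one_le_power)
  have \<eta>: "\<eta> > 0" "\<eta> \<le> 1" "2 * \<eta> = 1 / B\<^sup>2"
  proof -
    have "1 \<le> 2 * B\<^sup>2" using B2 by linarith
    then show "\<eta> > 0" "\<eta> \<le> 1" "2 * \<eta> = 1 / B\<^sup>2"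
      using B_ge_1 by (simp_all add: \<eta>_def divide_le_eq)
  qed
  have C: "C > 0" unfolding C_def using E0 B_ge_1 by (intro add_nonneg_pos mult_nonneg_nonneg add_nonneg_nonneg) auto
  show ?thesis
  proof (rule exI[of _ C], rule conjI[OF C], rule exI[of _ \<eta>], rule conjI[OF \<eta>(1)], rule exI[of _ N],
      intro allI impI conjI)
    fix n and \<nu> \<nu>' a b c d :: complex
    assume n: "N \<le> n" and \<nu>: "cmod (\<nu> - 4 * pi * real n) \<le> \<eta>" and \<nu>': "cmod (\<nu>' - 4 * pi * real n) \<le> \<eta>"
      and m: "is_mon (\<nu>\<^sup>2) a b c d" and cond: "(a + d)\<^sup>2 = 4 \<or> c = 0" and m': "spectral_point (\<nu>'\<^sup>2)"
    define t where "t = exp (- 2 * pi * real n * Y)"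
    have nN: "real n \<ge> R0 + 1" "real n \<ge> 32 * E0 / Y" using n N by linarith+
    have pn: "4 * pi * real n - 1 \<ge> real n - 1"
    proof -
      have "1 * real n \<le> (4 * pi) * real n" using pi_gt3 by (intro mult_right_mono) auto
      then show ?thesis by simp
    qed
    have *: "4 * pi * real n - 1 \<le> Re \<mu> \<and> \<bar>Im \<mu>\<bar> \<le> 1 \<and> \<epsilon> \<mu> \<le> E0 * t" if "cmod (\<mu> - 4 * pi * real n) \<le> \<eta>" for \<mu> :: complex
    proof -
      have "\<bar>Re \<mu> - 4 * pi * real n\<bar> \<le> 1" "\<bar>Im \<mu>\<bar> \<le> 1"
        using abs_Re_le_cmod[of "\<mu> - 4 * pi * real n"] abs_Im_le_cmod[of "\<mu> - 4 * pi * real n"] that \<eta>(2)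
        by simp_all
      then have re: "4 * pi * real n - 1 \<le> Re \<mu>" and im: "\<bar>Im \<mu>\<bar> \<le> 1" by linarith+
      have "((4 * pi * real n - 1) / 2 - 14 * K) * Y \<le> (Re \<mu> / 2 - 14 * K) * Y"
        using re Y_pos by (intro mult_right_mono) auto
      moreover have "((4 * pi * real n - 1) / 2 - 14 * K) * Y = 2 * pi * real n * Y - (1/2 + 14 * K) * Y"
        by (simp add: algebra_simps diff_divide_distrib)
      ultimately have "- ((Re \<mu> / 2 - 14 * K) * Y) \<le> (1/2 + 14 * K) * Y + - 2 * pi * real n * Y"
        by simp
      then have "exp (- ((Re \<mu> / 2 - 14 * K) * Y)) \<le> exp ((1/2 + 14 * K) * Y) * t"
        unfolding t_def exp_add[symmetric] by simp
      then have "\<epsilon> \<mu> \<le> E0 * t"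
        unfolding \<epsilon>_def E0_def by (simp add: mult.assoc)
      with re im show ?thesis by simp
    qed
    have small: "E0 * t \<le> 1/32"
    proof -
      have "32 * E0 \<le> real n * Y" using nN(2) Y_pos by (simp add: divide_le_eq)
      also have "\<dots> \<le> (2 * pi * real n) * Y"
      proof (rule mult_right_mono)
        show "real n \<le> 2 * pi * real n" using pi_gt3 by (simp add: mult_le_cancel_right1)
      qed (use Y_pos in simp)
      also have "\<dots> \<le> exp (2 * pi * real n * Y)" using exp_ge_add_one_self[of "2 * pi * real n * Y"] by linarith
      finally have "32 * E0 * t \<le> exp (2 * pi * real n * Y) * t"
        by (intro mult_right_mono) (simp_all add: t_def)
      also have "\<dots> = 1" by (simp add: t_def flip: exp_add)
      finally show ?thesis by simp
    qed
    have R: "R0 \<le> Re \<nu>" "R0 \<le> Re \<nu>'" using *[OF \<nu>] *[OF \<nu>'] pn nN(1) by linarith+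
    then have \<nu>0: "\<nu> \<noteq> 0" "\<nu>' \<noteq> 0" using R0_ge(3) by auto
    obtain \<alpha> \<beta> \<gamma> \<delta> where h: "hat_mon \<nu> \<alpha> \<beta> \<gamma> \<delta>" "(\<alpha> + \<delta>)\<^sup>2 = 4 \<or> \<gamma> + \<delta> = \<alpha> + \<beta>" "\<beta> + \<gamma> = a - d"
      using hat_mon_of_spectral_point[OF m \<nu>0(1) cond] by blast
    obtain \<alpha>' \<beta>' \<gamma>' \<delta>' where h': "hat_mon \<nu>' \<alpha>' \<beta>' \<gamma>' \<delta>'" "(\<alpha>' + \<delta>')\<^sup>2 = 4 \<or> \<gamma>' + \<delta>' = \<alpha>' + \<beta>'"
      using m' hat_mon_of_spectral_point[OF _ \<nu>0(2)] unfolding spectral_point_def by blast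
    have "cmod (\<nu> - \<nu>') \<le> \<eta> + \<eta>"
      using norm_triangle_ineq4[of "\<nu> - 4 * pi * real n" "\<nu>' - 4 * pi * real n"] \<nu> \<nu>' by simp
    then have close: "cmod (\<nu> - \<nu>') \<le> 1 / B\<^sup>2" using \<eta>(3) by simp
    have eps: "\<epsilon> \<nu> \<le> E0 * t" "\<epsilon> \<nu>' \<le> E0 * t" using *[OF \<nu>] *[OF \<nu>'] by auto
    have "cmod (\<nu> - \<nu>') \<le> 8 * ((8 * B + 16) * (\<epsilon> \<nu> * B\<^sup>2 + \<epsilon> \<nu>') + \<epsilon> \<nu>)"
      using *[OF \<nu>] *[OF \<nu>'] small R
      by (intro spectral_points_close[OF h(1) h'(1) _ _ _ _ close h(2) h'(2)]) auto
    also have "\<dots> \<le> 8 * ((8 * B + 16) * ((E0 * t) * B\<^sup>2 + E0 * t) + E0 * t)"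
      using eps B_ge_1 by (intro mult_left_mono add_mono mult_right_mono) auto
    also have "\<dots> \<le> C * t"
    proof -
      have "C * t = 8 * ((8 * B + 16) * ((E0 * t) * B\<^sup>2 + E0 * t) + E0 * t) + 8 * E0 * t"
        by (simp add: C_def algebra_simps)
      moreover have "0 \<le> 8 * E0 * t" using E0 by (simp add: t_def)
      ultimately show ?thesis by linarith
    qed
    finally show "cmod (\<nu> - \<nu>') \<le> C * exp (- 2 * pi * real n * Y)" by (simp add: t_def)
    have "64 * K \<le> Re \<nu>" using R R0_ge by linarith
    note s = hat_mon_nearly_scalar[OF h(1) this _ h(2)]
    have "cmod (a - d) \<le> 4 * \<epsilon> \<nu> + 4 * \<epsilon> \<nu>"
      unfolding h(3)[symmetric] using *[OF \<nu>] by (intro norm_triangle_mono s) auto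
    also have "\<dots> \<le> 8 * E0 * t" using eps by linarith
    also have "\<dots> \<le> C * t"
      unfolding C_def using E0 B_ge_1 by (intro mult_right_mono) (auto simp: t_def)
    finally show "cmod (a - d) \<le> C * exp (- 2 * pi * real n * Y)" by (simp add: t_def)
  qed
qed

end

text \<open>With x = 2 \<pi> n the value is 2 x^2 + 2 x sqrt (x^2 - 1) - 1, which lies between 4 x^2
  - 3 and 4 x^2 - 1. Hence its square root is centred at 4 \<pi> n.\<close>

lemma lambda0_near:
  assumes "n \<ge> 1"
  shows "\<bar>lambda0 (int n) - (4 * pi * real n)\<^sup>2\<bar> \<le> 3"
proof -
  define x where "x = 2 * pi * real n"
  have "1 * 1 \<le> (2 * pi) * real n" using assms pi_gt3 by (intro mult_mono) auto
  then have x: "1 \<le> x" by (simp add: x_def)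
  define q where "q = x * sqrt (x\<^sup>2 - 1)"
  have l: "lambda0 (int n) = 2 * x\<^sup>2 + 2 * q - 1"
    unfolding lambda0_def x_def q_def by (simp add: power_mult_distrib)
  have x2: "1 \<le> x\<^sup>2" using x by (rule one_le_power)
  have sq: "sqrt (x\<^sup>2 - 1) \<le> x" using x by (intro real_le_lsqrt) auto
  then have "q \<le> x\<^sup>2" unfolding q_def power2_eq_square[of x] using x by (intro mult_left_mono) auto
  moreover have "sqrt (x\<^sup>2 - 1) * sqrt (x\<^sup>2 - 1) \<le> q"
    unfolding q_def using sq x2 by (intro mult_right_mono) auto
  then have "x\<^sup>2 - 1 \<le> q" using x2 by simp
  moreover have "(4 * pi * real n)\<^sup>2 = 4 * x\<^sup>2" by (simp add: x_def power_mult_distrib)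
  ultimately show ?thesis unfolding l by linarith
qed

text \<open>The principal root has nonnegative real part, so |\<nu> + 4 \<pi> n| is at least n, and
  dividing the difference of squares by it turns an error o(n) in \<open>g\<close> into o(1). The
  weight -1 in \<open>l2_space (-1) 3\<close> is exactly what this needs.\<close>

lemma csqrt_near_lambda0:
  fixes g :: "nat \<Rightarrow> complex"
  assumes g: "(\<lambda>n. (g n - of_real (lambda0 (int n))) / of_nat n) \<longlonglongrightarrow> 0"
  shows "(\<lambda>n. csqrt (g n) - 4 * pi * real n) \<longlonglongrightarrow> 0"
proof -
  have lim: "(\<lambda>n. cmod ((g n - of_real (lambda0 (int n))) / of_nat n) + 3 / real n) \<longlonglongrightarrow> 0"
    using tendsto_add[OF tendsto_norm[OF g] lim_const_over_n[of "3::real"]] by simp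
  have "\<forall>\<^sub>F n in sequentially. norm (csqrt (g n) - 4 * pi * real n)
      \<le> cmod ((g n - of_real (lambda0 (int n))) / of_nat n) + 3 / real n"
    using eventually_ge_at_top[of 1]
  proof eventually_elim
    case (elim n)
    define \<nu> where "\<nu> = csqrt (g n)"
    define y where "y = 4 * pi * real n"
    have ny: "real n \<le> y" using pi_gt3 by (simp add: y_def mult_le_cancel_right1)
    have "0 \<le> Re \<nu>" using csqrt_principal[of "g n"] by (auto simp: \<nu>_def)
    then have "y \<le> Re (\<nu> + y)" by simp
    then have 1: "real n \<le> cmod (\<nu> + y)" using complex_Re_le_cmod[of "\<nu> + y"] ny by linarith
    have "(\<nu> - y) * (\<nu> + y) = g n - y\<^sup>2"
      using power2_csqrt[of "g n"] by (simp add: \<nu>_def power2_eq_square algebra_simps)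
    also have "\<dots> = (g n - of_real (lambda0 (int n))) + of_real (lambda0 (int n) - y\<^sup>2)" by simp
    finally have "cmod (\<nu> - y) * cmod (\<nu> + y) \<le> cmod (g n - of_real (lambda0 (int n))) + 3"
      using norm_triangle_ineq[of "g n - of_real (lambda0 (int n))" "of_real (lambda0 (int n) - y\<^sup>2)"] lambda0_near[OF elim]
      unfolding norm_mult[symmetric] y_def[symmetric] by (simp only: norm_of_real)
    moreover have "cmod (\<nu> - y) * real n \<le> cmod (\<nu> - y) * cmod (\<nu> + y)"
      using 1 by (intro mult_left_mono) auto
    ultimately have "cmod (\<nu> - y) \<le> (cmod (g n - of_real (lambda0 (int n))) + 3) / real n"
      using elim by (simp add: le_divide_eq)
    then show ?case by (simp add: \<nu>_def y_def norm_divide add_divide_distrib)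
  qed
  then show ?thesis using lim by (rule Lim_null_comparison)
qed

context sinh_gordon_rectangle
begin

text \<open>Returning from \<nu> to \<nu>^2 multiplies the difference by \<nu> + \<nu>', which is
  O(n); this is the polynomial loss paid by lowering the rate from \<open>Y\<close> to
  \<open>y0\<close>.\<close>

lemma spectral_points_exponentially_close:
  fixes g g' a b d :: "nat \<Rightarrow> complex"
  assumes y0: "0 < y0" "y0 < Y"
    and g: "(\<lambda>n. (g n - of_real (lambda0 (int n))) / of_nat n) \<longlonglongrightarrow> 0"
    and g': "(\<lambda>n. (g' n - of_real (lambda0 (int n))) / of_nat n) \<longlonglongrightarrow> 0"
    and m: "\<And>n. n \<ge> 1 \<Longrightarrow> is_mon (g n) (a n) (b n) 0 (d n)"
    and m': "\<And>n. n \<ge> 1 \<Longrightarrow> spectral_point (g' n)"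
  shows "\<exists>C>0. \<forall>\<^sub>F n in sequentially. cmod (g n - g' n) \<le> C * exp (- 2 * pi * real n * y0) \<and>
    cmod (a n - d n) \<le> C * exp (- 2 * pi * real n * y0)"
proof -
  obtain C \<eta> N where C: "C > 0" "\<eta> > 0" and decay: "\<forall>n\<ge>N. \<forall>(\<nu>::complex) (\<nu>'::complex) a b c d.
    cmod (\<nu> - 4 * pi * real n) \<le> \<eta> \<longrightarrow> cmod (\<nu>' - 4 * pi * real n) \<le> \<eta> \<longrightarrow>
    is_mon (\<nu>\<^sup>2) a b c d \<longrightarrow> ((a + d)\<^sup>2 = 4 \<or> c = 0) \<longrightarrow> spectral_point (\<nu>'\<^sup>2) \<longrightarrow>
    cmod (\<nu> - \<nu>') \<le> C * exp (- 2 * pi * real n * Y) \<and>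
    cmod (a - d) \<le> C * exp (- 2 * pi * real n * Y)"
    using exponential_decay by (elim exE conjE) (rule that)
  define \<theta> where "\<theta> = 2 * pi * (Y - y0)"
  have \<theta>: "\<theta> > 0" using y0 by (simp add: \<theta>_def)
  \<comment> \<open>Chosen for the inequality \<theta> n exp (- \<theta> n) \<le> 1, with (8 \<pi> +
    2 \<eta>) n bounding |\<nu> + \<nu>'|.\<close>
  define A where "A = C * (8 * pi + 2 * \<eta>) / \<theta>"
  have A: "A \<ge> 0" "A * \<theta> = C * (8 * pi + 2 * \<eta>)"
    using C \<theta> pi_gt_zero by (simp_all add: A_def)
  define C' where "C' = A + C"
  have C': "C' > 0" "A \<le> C'" "C \<le> C'" using A C by (simp_all add: C'_def)
  have ev: "\<forall>\<^sub>F n in sequentially. cmod (csqrt (f n) - 4 * pi * real n) \<le> \<eta>"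
    if "(\<lambda>n. (f n - of_real (lambda0 (int n))) / of_nat n) \<longlonglongrightarrow> 0" for f :: "nat \<Rightarrow> complex"
    using csqrt_near_lambda0[OF that] C(2) unfolding tendsto_iff dist_norm
    by (auto elim!: allE[of _ \<eta>] eventually_mono)
  have "\<forall>\<^sub>F n in sequentially. cmod (g n - g' n) \<le> C' * exp (- 2 * pi * real n * y0) \<and>
    cmod (a n - d n) \<le> C' * exp (- 2 * pi * real n * y0)"
    using ev[OF g] ev[OF g'] eventually_ge_at_top[of "max 1 N"]
  proof eventually_elim
    case (elim n)
    define \<nu> \<nu>' where "\<nu> = csqrt (g n)" and "\<nu>' = csqrt (g' n)"
    have n: "n \<ge> 1" "n \<ge> N" using elim by auto
    define t where "t = exp (- 2 * pi * real n * y0)"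
    have e: "exp (- 2 * pi * real n * Y) = exp (- (\<theta> * real n)) * t"
      by (simp add: t_def \<theta>_def algebra_simps flip: exp_add)
    have "cmod (\<nu> - \<nu>') \<le> C * exp (- 2 * pi * real n * Y) \<and> cmod (a n - d n) \<le> C * exp (- 2 * pi * real n * Y)"
      using elim m[OF n(1)] m'[OF n(1)] by (intro decay[rule_format, OF n(2), where b = "b n" and c = 0]) (simp_all add: \<nu>_def \<nu>'_def)
    then have *: "cmod (\<nu> - \<nu>') \<le> C * (exp (- (\<theta> * real n)) * t)" "cmod (a n - d n) \<le> C * (exp (- (\<theta> * real n)) * t)"
      unfolding e by auto
    have "exp (- (\<theta> * real n)) \<le> 1" using \<theta> by simp
    then have "C * (exp (- (\<theta> * real n)) * t) \<le> C * (1 * t)"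
      using C by (intro mult_left_mono mult_right_mono) (auto simp: t_def)
    also have "\<dots> \<le> C' * t"
      using mult_right_mono[OF C'(3), of t] by (simp add: t_def)
    finally have ad: "cmod (a n - d n) \<le> C' * t" using * by linarith
    have ex: "\<theta> * real n * exp (- (\<theta> * real n)) \<le> 1"
    proof -
      have "\<theta> * real n \<le> exp (\<theta> * real n)" using exp_ge_add_one_self[of "\<theta> * real n"] by linarith
      then have "\<theta> * real n * exp (- (\<theta> * real n)) \<le> exp (\<theta> * real n) * exp (- (\<theta> * real n))"
        by (intro mult_right_mono) auto
      then show ?thesis by (simp flip: exp_add)
    qed
    have "cmod (\<nu> + \<nu>') \<le> (8 * pi + 2 * \<eta>) * real n"
    proof -
      have "cmod ((\<nu> - 4 * pi * real n) + (\<nu>' - 4 * pi * real n) + of_real (8 * pi * real n))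
          \<le> \<eta> + \<eta> + 8 * pi * real n"
        using elim by (intro norm_triangle_mono) (auto simp: \<nu>_def \<nu>'_def norm_mult)
      moreover have "(\<nu> - 4 * pi * real n) + (\<nu>' - 4 * pi * real n) + of_real (8 * pi * real n) = \<nu> + \<nu>'"
        by simp
      moreover have "2 * \<eta> * 1 \<le> 2 * \<eta> * real n" using n(1) C(2) by (intro mult_left_mono) auto
      ultimately show ?thesis by (simp add: distrib_right)
    qed
    moreover have "g n - g' n = (\<nu> - \<nu>') * (\<nu> + \<nu>')"
      using power2_csqrt[of "g n"] power2_csqrt[of "g' n"]
      by (simp add: \<nu>_def \<nu>'_def power2_eq_square algebra_simps)
    ultimately have "cmod (g n - g' n) \<le> C * (exp (- (\<theta> * real n)) * t) * ((8 * pi + 2 * \<eta>) * real n)"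
      using *(1) C by (auto simp: norm_mult t_def intro!: mult_mono)
    also have "\<dots> = A * \<theta> * (t * (real n * exp (- (\<theta> * real n))))"
      unfolding A(2) by (simp only: mult_ac)
    also have "\<dots> = A * t * (\<theta> * real n * exp (- (\<theta> * real n)))"
      by (simp only: mult_ac)
    also have "\<dots> \<le> A * t * 1"
      using ex A(1) by (intro mult_left_mono) (auto simp: t_def)
    also have "\<dots> \<le> C' * t"
      using mult_right_mono[OF C'(2), of t] by (simp add: t_def)
    finally show ?case using ad by (simp add: t_def)
  qed
  with C'(1) show ?thesis by blast
qed

end

section \<open>The monodromy of a periodic solution\<close>

lemma has_derivative_partials:
  assumes "f differentiable (at z)"
  shows "(f has_derivative (\<lambda>h. Re h *\<^sub>R pdx f z + Im h *\<^sub>R pdy f z)) (at z)"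
proof -
  have d: "(f has_derivative frechet_derivative f (at z)) (at z)"
    using assms by (simp add: frechet_derivative_works)
  then interpret L: bounded_linear "frechet_derivative f (at z)"
    by (rule has_derivative_bounded_linear)
  have "frechet_derivative f (at z) h = Re h *\<^sub>R pdx f z + Im h *\<^sub>R pdy f z" for h
  proof -
    have "h = Re h *\<^sub>R 1 + Im h *\<^sub>R \<i>" by (simp add: complex_eq_iff)
    then have "frechet_derivative f (at z) h = frechet_derivative f (at z) (Re h *\<^sub>R 1 + Im h *\<^sub>R \<i>)"
      by simp
    then show ?thesis by (simp only: L.add L.scaleR pdx_def pdy_def)
  qed
  then have "frechet_derivative f (at z) = (\<lambda>h. Re h *\<^sub>R pdx f z + Im h *\<^sub>R pdy f z)"
    by (rule ext)
  with d show ?thesis by simp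
qed

lemma has_vector_derivative_Complex:
  "((\<lambda>x. Complex x y) has_vector_derivative 1) (at x within S)"
  "(Complex x has_vector_derivative \<i>) (at y within S)"
  unfolding Complex_eq[abs_def] has_vector_derivative_def
  by (auto intro!: derivative_eq_intros simp: scaleR_conv_of_real)

lemma has_vector_derivative_partials:
  assumes "f differentiable (at (Complex x y))"
  shows "((\<lambda>x. f (Complex x y)) has_vector_derivative pdx f (Complex x y)) (at x within S)"
    and "((\<lambda>y. f (Complex x y)) has_vector_derivative pdy f (Complex x y)) (at y within S)"
proof -
  note d = has_derivative_at_withinI[OF has_derivative_partials[OF assms]]
  show "((\<lambda>x. f (Complex x y)) has_vector_derivative pdx f (Complex x y)) (at x within S)"
    using vector_derivative_diff_chain_within[OF has_vector_derivative_Complex(1) d]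
    by (simp add: o_def)
  show "((\<lambda>y. f (Complex x y)) has_vector_derivative pdy f (Complex x y)) (at y within S)"
    using vector_derivative_diff_chain_within[OF has_vector_derivative_Complex(2) d]
    by (simp add: o_def)
qed

lemma open_strip: "open (strip r)"
  unfolding strip_def by (intro open_Collect_less continuous_intros)

lemma pdx_periodic:
  assumes per: "simply_periodic (strip r) u" and z: "z \<in> strip r" and d: "u differentiable (at (z + 1))"
  shows "pdx u (z + 1) = pdx u z"
proof -
  have "(u has_derivative frechet_derivative u (at (z + 1))) (at (z + 1))"
    using d by (simp add: frechet_derivative_works)
  moreover have "((\<lambda>z. z + 1) has_derivative (\<lambda>h. h)) (at z)"
    by (auto intro!: derivative_eq_intros)
  ultimately have "((\<lambda>z. u (z + 1)) has_derivative frechet_derivative u (at (z + 1))) (at z)"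
    using has_derivative_compose[of "\<lambda>z. z + 1" "\<lambda>h. h" z UNIV u] by simp
  then have "(u has_derivative frechet_derivative u (at (z + 1))) (at z)"
    by (rule has_derivative_transform_within_open[OF _ open_strip z])
       (use per in \<open>simp add: simply_periodic_def\<close>)
  then have "frechet_derivative u (at (z + 1)) = frechet_derivative u (at z)"
    by (rule frechet_derivative_at)
  then show ?thesis by (simp add: pdx_def)
qed

lemma rectangle_of_solution:
  assumes Y: "0 < Y" "Y < r" and sol: "sinh_gordon_solution (strip r) u"
    and per: "simply_periodic (strip r) u"
  shows "sinh_gordon_rectangle Y (\<lambda>x y. u (Complex x y)) (\<lambda>x y. pdx u (Complex x y))
    (\<lambda>x y. pdy u (Complex x y)) (\<lambda>x y. pdx (pdx u) (Complex x y))
    (\<lambda>x y. pdx (pdy u) (Complex x y)) (\<lambda>x y. pdy (pdy u) (Complex x y))"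
proof -
  have in_strip: "Complex x y \<in> strip r" if "y \<in> {-Y..Y}" for x y
    using that Y by (auto simp: strip_def)
  have C1: "real_C1_on (strip r) u" "real_C1_on (strip r) (pdx u)" "real_C1_on (strip r) (pdy u)"
    using sol by (simp_all add: sinh_gordon_solution_def real_C2_on_def)
  then have diff: "f differentiable (at z)" if "z \<in> strip r" "f \<in> {u, pdx u, pdy u}" for f z
    using that by (auto simp: real_C1_on_def)
  have cont: "continuous_on ({0..1} \<times> {-Y..Y}) (\<lambda>p. f (Complex (fst p) (snd p)))"
    if "continuous_on (strip r) f" for f :: "complex \<Rightarrow> complex"
  proof (rule continuous_on_compose2[OF that])
    show "continuous_on ({0..1} \<times> {-Y..Y}) (\<lambda>p. Complex (fst p) (snd p))"
      unfolding Complex_eq by (intro continuous_intros)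
    show "(\<lambda>p. Complex (fst p) (snd p)) ` ({0..1} \<times> {-Y..Y}) \<subseteq> strip r"
      using in_strip by auto
  qed
  have cu: "continuous_on (strip r) u"
    using diff by (auto intro!: continuous_at_imp_continuous_on differentiable_imp_continuous_within)
  have shift: "Complex 1 y = Complex 0 y + 1" for y by (simp add: complex_eq_iff)
  show ?thesis
  proof
    fix x y :: real assume y: "y \<in> {-Y..Y}"
    note z = in_strip[OF y]
    show "((\<lambda>x. u (Complex x y)) has_vector_derivative pdx u (Complex x y)) (at x within {0..1})"
      "((\<lambda>y. u (Complex x y)) has_vector_derivative pdy u (Complex x y)) (at y within {-Y..Y})"
      "((\<lambda>x. pdx u (Complex x y)) has_vector_derivative pdx (pdx u) (Complex x y)) (at x within {0..1})"
      "((\<lambda>x. pdy u (Complex x y)) has_vector_derivative pdx (pdy u) (Complex x y)) (at x within {0..1})"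
      "((\<lambda>y. pdy u (Complex x y)) has_vector_derivative pdy (pdy u) (Complex x y)) (at y within {-Y..Y})"
      by (intro has_vector_derivative_partials diff z; simp)+
    show "u (Complex 1 y) = u (Complex 0 y)"
      using per z unfolding shift simply_periodic_def by blast
    show "pdx u (Complex 1 y) = pdx u (Complex 0 y)"
      unfolding shift by (rule pdx_periodic[OF per z]) (use diff[OF z, of u 1] in \<open>simp add: shift\<close>)
    show "pdx (pdx u) (Complex x y) + pdy (pdy u) (Complex x y) + sinh (u (Complex x y)) = 0"
      using sol z by (simp add: sinh_gordon_solution_def)
  qed (use C1 Y cu in \<open>auto simp: real_C1_on_def intro: cont\<close>)
qed

text \<open>The Laplacian is even in \<open>y\<close> and sinh is odd. The two sign changes cancel
  in the first \<open>y\<close>-derivative, which therefore appears without a minus sign.\<close>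

lemma (in sinh_gordon_rectangle) reflected:
  "sinh_gordon_rectangle Y (\<lambda>x y. - u x (- y)) (\<lambda>x y. - ux x (- y)) (\<lambda>x y. uy x (- y))
    (\<lambda>x y. - uxx x (- y)) (\<lambda>x y. uyx x (- y)) (\<lambda>x y. - uyy x (- y))"
proof -
  have refl: "((\<lambda>y. f (- y)) has_vector_derivative - f' (- y)) (at y within {-Y..Y})"
    if "\<And>y. y \<in> {-Y..Y} \<Longrightarrow> (f has_vector_derivative f' y) (at y within {-Y..Y})" "y \<in> {-Y..Y}"
    for f f' :: "real \<Rightarrow> complex" and y
    using has_vector_derivative_reflect_interval[OF that] by simp
  have cont: "continuous_on ({0..1} \<times> {-Y..Y}) (\<lambda>p. g (fst p) (- snd p))"
    if "continuous_on ({0..1} \<times> {-Y..Y}) (\<lambda>p. g (fst p) (snd p))" for g :: "real \<Rightarrow> real \<Rightarrow> complex"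
  proof -
    have "continuous_on ({0..1} \<times> {-Y..Y}) ((\<lambda>p. g (fst p) (snd p)) \<circ> (\<lambda>p. (fst p, - snd p)))"
      by (intro continuous_on_compose continuous_intros continuous_on_subset[OF that]) auto
    then show ?thesis by (simp add: o_def)
  qed
  show ?thesis
  proof
    fix x y :: real assume x: "x \<in> {0..1}" and y: "y \<in> {-Y..Y}"
    then have y': "- y \<in> {-Y..Y}" by auto
    show "((\<lambda>x. - u x (- y)) has_vector_derivative - ux x (- y)) (at x within {0..1})"
      "((\<lambda>x. - ux x (- y)) has_vector_derivative - uxx x (- y)) (at x within {0..1})"
      "((\<lambda>x. uy x (- y)) has_vector_derivative uyx x (- y)) (at x within {0..1})"
      by (intro has_vector_derivative_minus der_u_x der_ux_x der_uy_x x y')+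
    show "((\<lambda>y. - u x (- y)) has_vector_derivative uy x (- y)) (at y within {-Y..Y})"
      using has_vector_derivative_minus[OF refl[OF der_u_y[OF x] y]] by simp
    show "((\<lambda>y. uy x (- y)) has_vector_derivative - uyy x (- y)) (at y within {-Y..Y})"
      by (rule refl[OF der_uy_y[OF x] y])
    have "- (uxx x (- y) + uyy x (- y) + sinh (u x (- y))) = 0" using pde[OF x y'] by simp
    then show "- uxx x (- y) + - uyy x (- y) + sinh (- u x (- y)) = 0" by simp
  next
    fix y :: real assume "y \<in> {-Y..Y}"
    then have "- y \<in> {-Y..Y}" by auto
    then show "- u 1 (- y) = - u 0 (- y)" "- ux 1 (- y) = - ux 0 (- y)"
      using per_u per_ux by simp_all
  qed (intro Y_pos continuous_on_minus cont cont_u cont_ux cont_uy cont_uxx cont_uyx cont_uyy)+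
qed

text \<open>
  The symmetry \<open>u(x, y) \<mapsto> - u(x, - y)\<close>, \<open>l \<mapsto> 1 / l\<close> exchanges the two ends of the spectrum.
\<close>

lemma (in sinh_gordon_rectangle) is_mon_reflected:
  assumes m: "is_mon l a b c d" and l: "l \<noteq> 0"
  shows "sinh_gordon_rectangle.is_mon (\<lambda>x y. - u x (- y)) (\<lambda>x y. uy x (- y)) (inverse l) a (b * l) (c / l) d"
proof -
  interpret R: sinh_gordon_rectangle Y "\<lambda>x y. - u x (- y)" "\<lambda>x y. - ux x (- y)" "\<lambda>x y. uy x (- y)"
    "\<lambda>x y. - uxx x (- y)" "\<lambda>x y. uyx x (- y)" "\<lambda>x y. - uyy x (- y)"
    by (rule reflected)
  show ?thesis
    unfolding R.is_mon_def
  proof (intro allI impI)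
    fix v assume v: "R.xsol (inverse l) 0 v"
    \<comment> \<open>Conjugation by diag (1, l) identifies the reflected connection at
      \<open>1 / l\<close> with the original one at \<open>l\<close>; it leaves the diagonal of the
      monodromy and the vanishing of \<open>c\<close> unchanged.\<close>
    define v' where "v' x = (fst (v x), l * snd (v x))" for x
    have "xsol l 0 v'"
      unfolding xsol_def
    proof
      fix x :: real assume "x \<in> {0..1}"
      then have d: "(v has_vector_derivative mv2 (R.connU (inverse l) x 0) (v x)) (at x within {0..1})"
        using v by (simp add: R.xsol_def)
      have "(v' has_vector_derivative (fst (mv2 (R.connU (inverse l) x 0) (v x)),
          l * snd (mv2 (R.connU (inverse l) x 0) (v x)))) (at x within {0..1})"
        unfolding v'_def
        by (intro has_vector_derivative_Pair has_vector_derivative_mult_right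
            bounded_linear.has_vector_derivative[OF bounded_linear_fst d]
            bounded_linear.has_vector_derivative[OF bounded_linear_snd d])
      moreover have "(fst (mv2 (R.connU (inverse l) x 0) (v x)), l * snd (mv2 (R.connU (inverse l) x 0) (v x)))
          = mv2 (connU l x 0) (v' x)"
        using l by (simp add: mv2_def R.connU_def connU_def v'_def field_simps)
      ultimately show "(v' has_vector_derivative mv2 (connU l x 0) (v' x)) (at x within {0..1})"
        by simp
    qed
    with m have v1: "v' 1 = (a * fst (v' 0) + b * snd (v' 0), c * fst (v' 0) + d * snd (v' 0))"
      by (simp add: is_mon_def)
    have "snd (v 1) = snd (v' 1) / l" "fst (v 1) = fst (v' 1)" using l by (simp_all add: v'_def)
    then show "v 1 = (a * fst (v 0) + b * l * snd (v 0), c / l * fst (v 0) + d * snd (v 0))"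
      using l unfolding v1 by (simp add: v'_def prod_eq_iff field_simps)
  qed
qed

section \<open>The definite description behind \<open>monodromy\<close>\<close>

lemma linear_ode_unique:
  fixes v :: "real \<Rightarrow> 'a::real_inner"
  assumes mv: "bounded_bilinear mv" and A: "continuous_on {a..b} A" and ab: "a \<le> b"
    and v: "\<And>t. t \<in> {a..b} \<Longrightarrow> (v has_vector_derivative mv (A t) (v t)) (at t within {a..b})"
    and v': "\<And>t. t \<in> {a..b} \<Longrightarrow> (v' has_vector_derivative mv (A t) (v' t)) (at t within {a..b})"
    and init: "v a = v' a"
  shows "v b = v' b"
proof -
  interpret mv: bounded_bilinear mv by (fact mv)
  obtain B where B: "B > 0" "\<And>m x. norm (mv m x) \<le> norm m * norm x * B"
    using mv.pos_bounded by blast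
  obtain D where D: "D > 0" "\<And>t. t \<in> {a..b} \<Longrightarrow> norm (A t) \<le> D"
    using compact_imp_bounded[OF compact_continuous_image[OF A compact_Icc]]
    unfolding bounded_pos by blast
  have "(norm (v b - v' b))\<^sup>2 \<le> ((norm (v a - v' a))\<^sup>2 + 0\<^sup>2) * exp ((2 * (D * B) + 1) * (b - a))"
  proof (rule perturbed_linear_ode_bound[where e = "\<lambda>t. v t - v' t", OF ab])
    fix t assume t: "t \<in> {a..b}"
    show "((\<lambda>t. v t - v' t) has_vector_derivative mv (A t) (v t - v' t)) (at t within {a..b})"
      using has_vector_derivative_diff[OF v[OF t] v'[OF t]] by (simp add: mv.diff_right)
    have "(v t - v' t) \<bullet> mv (A t) (v t - v' t) \<le> norm (v t - v' t) * (norm (A t) * norm (v t - v' t) * B)"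
      by (rule order_trans[OF norm_cauchy_schwarz mult_left_mono[OF B(2)]]) simp
    also have "\<dots> \<le> norm (v t - v' t) * (D * norm (v t - v' t) * B)"
      using D(2)[OF t] B(1) by (intro mult_left_mono mult_right_mono) auto
    finally show "(v t - v' t) \<bullet> mv (A t) (v t - v' t) \<le> D * B * (norm (v t - v' t))\<^sup>2 + 0 * norm (v t - v' t)"
      by (simp add: power2_eq_square algebra_simps)
  qed (use D B ab in auto)
  then show ?thesis by (simp add: init)
qed

definition mat_of :: "(complex \<times> complex) \<times> (complex \<times> complex) \<Rightarrow> complex^2^2" where
  "mat_of m = mat2 (fst (fst m)) (snd (fst m)) (fst (snd m)) (snd (snd m))"

lemma mat_of_nth [simp]:
  "mat_of m $ 1 $ 1 = fst (fst m)" "mat_of m $ 1 $ 2 = snd (fst m)"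
  "mat_of m $ 2 $ 1 = fst (snd m)" "mat_of m $ 2 $ 2 = snd (snd m)"
  by (simp_all add: mat_of_def mat2_def vector_2)

lemma bounded_linear_mat_of: "bounded_linear mat_of"
  unfolding linear_conv_bounded_linear[symmetric]
  by (rule linearI) (simp_all add: vec_eq_iff forall_2)

definition col :: "2 \<Rightarrow> complex^2^2 \<Rightarrow> complex \<times> complex" where
  "col j X = (X $ 1 $ j, X $ 2 $ j)"

lemma bounded_linear_col: "bounded_linear (col j)"
  unfolding col_def[abs_def]
  by (intro bounded_linear_Pair bounded_linear_compose[OF bounded_linear_vec_nth bounded_linear_vec_nth])

lemma col_mult: "col j (mat_of A ** X) = mv2 A (col j X)"
  by (simp add: col_def mv2_def matrix_matrix_mult_def sum_2)

lemma col_mat_of: "col 1 (mat_of m) = (fst (fst m), fst (snd m))" "col 2 (mat_of m) = (snd (fst m), snd (snd m))"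
  by (simp_all add: col_def)

lemma mat_eq_iff_col: "X = X' \<longleftrightarrow> col 1 X = col 1 X' \<and> col 2 X = col 2 X'"
  by (auto simp: col_def vec_eq_iff forall_2)

lemma col_mat_1: "col 1 (mat 1) = (1, 0)" "col 2 (mat 1) = (0, 1)"
  by (simp_all add: col_def mat_def)

lemma frame_column:
  assumes F: "is_frame u l F" and A: "\<And>t. t \<in> {0..1} \<Longrightarrow> alpha u l (of_real t) 1 = mat_of (A t)"
    and t: "t \<in> {0..1}"
  shows "((\<lambda>t. col j (F t)) has_vector_derivative mv2 (A t) (col j (F t))) (at t within {0..1})"
proof -
  have d: "(F has_vector_derivative (alpha u l (of_real t) 1 ** F t)) (at t within {0..1})"
    using F t by (simp add: is_frame_def)
  from bounded_linear.has_vector_derivative[OF bounded_linear_col d] show ?thesis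
    unfolding A[OF t] col_mult .
qed

text \<open>A frame is assembled from the solutions starting at the two basis vectors, and
  uniqueness of solutions determines its end value. This justifies the description operator and
  shows that the resulting matrix propagates every solution.\<close>

lemma monodromy_solution:
  fixes v :: "real \<Rightarrow> complex \<times> complex"
  assumes A: "\<And>t. t \<in> {0..1} \<Longrightarrow> alpha u l (of_real t) 1 = mat_of (A t)" and cont: "continuous_on {0..1} A"
    and v: "\<And>t. t \<in> {0..1} \<Longrightarrow> (v has_vector_derivative mv2 (A t) (v t)) (at t within {0..1})"
  shows "v 1 = mv2 ((mon_a u l, fst (col 2 (monodromy u l))), (mon_c u l, snd (col 2 (monodromy u l)))) (v 0)"
proof -
  have sol: "v 1 = mv2 ((fst (col 1 (F 1)), fst (col 2 (F 1))), (snd (col 1 (F 1)), snd (col 2 (F 1)))) (v 0)"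
    if F: "is_frame u l F" and v: "\<And>t. t \<in> {0..1} \<Longrightarrow> (v has_vector_derivative mv2 (A t) (v t)) (at t within {0..1})"
    for F and v :: "real \<Rightarrow> complex \<times> complex"
  proof -
    define w where "w t = (fst (col 1 (F t)) * fst (v 0) + fst (col 2 (F t)) * snd (v 0),
      snd (col 1 (F t)) * fst (v 0) + snd (col 2 (F t)) * snd (v 0))" for t
    have "F 0 = mat 1" using F by (simp add: is_frame_def)
    then have "v 0 = w 0" by (simp add: w_def col_mat_1)
    have "v 1 = w 1"
    proof (rule linear_ode_unique[where v = v and v' = w and a = 0 and b = 1,
          OF bounded_bilinear_mv2 cont _ v _ \<open>v 0 = w 0\<close>])
      fix t :: real assume t: "t \<in> {0..1}"
      note c = frame_column[OF F A t]
      note d = bounded_linear.has_vector_derivative[OF bounded_linear_fst c]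
        bounded_linear.has_vector_derivative[OF bounded_linear_snd c]
      have "(w has_vector_derivative
         (fst (mv2 (A t) (col 1 (F t))) * fst (v 0) + fst (mv2 (A t) (col 2 (F t))) * snd (v 0),
          snd (mv2 (A t) (col 1 (F t))) * fst (v 0) + snd (mv2 (A t) (col 2 (F t))) * snd (v 0)))
         (at t within {0..1})"
        unfolding w_def
        by (intro has_vector_derivative_Pair has_vector_derivative_add has_vector_derivative_mult_left d)
      then show "(w has_vector_derivative mv2 (A t) (w t)) (at t within {0..1})"
        by (simp add: w_def mv2_def algebra_simps)
    qed simp_all
    then show ?thesis by (simp add: w_def mv2_def)
  qed
  obtain v1 where v1: "v1 0 = (1, 0)"
    "\<And>t. t \<in> {0..1} \<Longrightarrow> (v1 has_vector_derivative mv2 (A t) (v1 t)) (at t within {0..1})"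
    using linear_ode_exists[OF bounded_bilinear_mv2 zero_le_one cont] by blast
  obtain v2 where v2: "v2 0 = (0, 1)"
    "\<And>t. t \<in> {0..1} \<Longrightarrow> (v2 has_vector_derivative mv2 (A t) (v2 t)) (at t within {0..1})"
    using linear_ode_exists[OF bounded_bilinear_mv2 zero_le_one cont] by blast
  define F where "F t = mat_of ((fst (v1 t), fst (v2 t)), (snd (v1 t), snd (v2 t)))" for t
  have F: "is_frame u l F"
    unfolding is_frame_def
  proof (intro conjI ballI)
    show "F 0 = mat 1"
      by (simp add: F_def v1(1) v2(1) mat_eq_iff_col col_mat_of col_mat_1)
    fix t :: real assume t: "t \<in> {0..1}"
    note d = bounded_linear.has_vector_derivative[OF bounded_linear_fst v1(2)[OF t]]
      bounded_linear.has_vector_derivative[OF bounded_linear_snd v1(2)[OF t]]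
      bounded_linear.has_vector_derivative[OF bounded_linear_fst v2(2)[OF t]]
      bounded_linear.has_vector_derivative[OF bounded_linear_snd v2(2)[OF t]]
    have "((\<lambda>t. ((fst (v1 t), fst (v2 t)), (snd (v1 t), snd (v2 t)))) has_vector_derivative
      ((fst (mv2 (A t) (v1 t)), fst (mv2 (A t) (v2 t))), (snd (mv2 (A t) (v1 t)), snd (mv2 (A t) (v2 t)))))
      (at t within {0..1})"
      by (intro has_vector_derivative_Pair d)
    from bounded_linear.has_vector_derivative[OF bounded_linear_mat_of this]
    have "(F has_vector_derivative mat_of
      ((fst (mv2 (A t) (v1 t)), fst (mv2 (A t) (v2 t))), (snd (mv2 (A t) (v1 t)), snd (mv2 (A t) (v2 t)))))
      (at t within {0..1})"
      by (simp add: F_def[abs_def])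
    moreover have "mat_of ((fst (mv2 (A t) (v1 t)), fst (mv2 (A t) (v2 t))), (snd (mv2 (A t) (v1 t)), snd (mv2 (A t) (v2 t))))
      = mat_of (A t) ** F t"
      by (simp add: mat_eq_iff_col col_mult col_mat_of F_def)
    ultimately show "(F has_vector_derivative alpha u l (of_real t) 1 ** F t) (at t within {0..1})"
      by (simp add: A[OF t])
  qed
  have "monodromy u l = F 1"
    unfolding monodromy_def
  proof (rule the_equality)
    show "\<exists>G. is_frame u l G \<and> F 1 = G 1" using F by blast
    fix N assume "\<exists>G. is_frame u l G \<and> N = G 1"
    then obtain G where G: "is_frame u l G" "N = G 1" by blast
    have "v1 1 = col 1 (F 1)" "v1 1 = col 1 (G 1)" "v2 1 = col 2 (F 1)" "v2 1 = col 2 (G 1)"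
      using sol[OF F v1(2)] sol[OF G(1) v1(2)] sol[OF F v2(2)] sol[OF G(1) v2(2)]
      by (simp_all add: v1(1) v2(1) mv2_def)
    then show "N = F 1" by (simp add: G(2) mat_eq_iff_col)
  qed
  then show ?thesis using sol[OF F v] by (simp add: mon_a_def mon_c_def col_def)
qed

section \<open>Asymptotics at the two ends of the spectrum\<close>

lemma (in sinh_gordon_rectangle) spectral_data_exponentially_close:
  fixes g g1 g2 a b d :: "nat \<Rightarrow> complex"
  assumes y0: "0 < y0" "y0 < Y"
    and g: "(\<lambda>n. (g n - of_real (lambda0 (int n))) / of_nat n) \<longlonglongrightarrow> 0"
    and g1: "(\<lambda>n. (g1 n - of_real (lambda0 (int n))) / of_nat n) \<longlonglongrightarrow> 0"
    and g2: "(\<lambda>n. (g2 n - of_real (lambda0 (int n))) / of_nat n) \<longlonglongrightarrow> 0"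
    and m: "\<And>n. n \<ge> 1 \<Longrightarrow> is_mon (g n) (a n) (b n) 0 (d n)"
    and m1: "\<And>n. n \<ge> 1 \<Longrightarrow> spectral_point (g1 n)" and m2: "\<And>n. n \<ge> 1 \<Longrightarrow> spectral_point (g2 n)"
  shows "\<exists>C>0. \<forall>\<^sub>F n in sequentially. cmod (g n - g1 n) \<le> C * exp (- 2 * pi * real n * y0) \<and>
    cmod (g n - g2 n) \<le> C * exp (- 2 * pi * real n * y0) \<and>
    cmod (a n - d n) \<le> C * exp (- 2 * pi * real n * y0)"
proof -
  obtain C1 where C1: "C1 > 0" "\<forall>\<^sub>F n in sequentially. cmod (g n - g1 n) \<le> C1 * exp (- 2 * pi * real n * y0) \<and>
    cmod (a n - d n) \<le> C1 * exp (- 2 * pi * real n * y0)"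
    using spectral_points_exponentially_close[OF y0 g g1 m m1] by blast
  obtain C2 where C2: "C2 > 0" "\<forall>\<^sub>F n in sequentially. cmod (g n - g2 n) \<le> C2 * exp (- 2 * pi * real n * y0) \<and>
    cmod (a n - d n) \<le> C2 * exp (- 2 * pi * real n * y0)"
    using spectral_points_exponentially_close[OF y0 g g2 m m2] by blast
  have le: "x \<le> max C1 C2 * t" if "x \<le> C * t" "C = C1 \<or> C = C2" "0 \<le> t" for x C t :: real
    using mult_right_mono[OF _ that(3), of C "max C1 C2"] that(1,2) by fastforce
  have "\<forall>\<^sub>F n in sequentially. cmod (g n - g1 n) \<le> max C1 C2 * exp (- 2 * pi * real n * y0) \<and>
    cmod (g n - g2 n) \<le> max C1 C2 * exp (- 2 * pi * real n * y0) \<and>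
    cmod (a n - d n) \<le> max C1 C2 * exp (- 2 * pi * real n * y0)"
    using C1(2) C2(2)
  proof eventually_elim
    case (elim n)
    have t: "0 \<le> exp (- 2 * pi * real n * y0)" by simp
    show ?case using elim le[OF _ _ t] by blast
  qed
  moreover have "max C1 C2 > 0" using C1(1) by simp
  ultimately show ?thesis by blast
qed

section \<open>From square-summability to limits, and the reference points at both ends\<close>

lemma l2_space_tendsto:
  assumes a: "a \<in> l2_space n m"
  shows "(\<lambda>k. of_int (int k) powi n * a (int k)) \<longlonglongrightarrow> 0"
    and "(\<lambda>k. of_int (- int k) powi m * a (- int k)) \<longlonglongrightarrow> 0"
proof -
  have lim: "(\<lambda>k. f (h k)) \<longlonglongrightarrow> 0"
    if "(\<lambda>k. (cmod (f k))\<^sup>2) summable_on A" "A = range h" "inj h"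
    for f :: "int \<Rightarrow> complex" and h :: "nat \<Rightarrow> int" and A
  proof -
    have "((\<lambda>k. (cmod (f k))\<^sup>2) \<circ> h) summable_on UNIV"
      using that summable_on_reindex by metis
    then have "summable (\<lambda>k. (cmod (f (h k)))\<^sup>2)"
      by (simp add: o_def summable_on_UNIV_nonneg_real_iff)
    then have "(\<lambda>k. (cmod (f (h k)))\<^sup>2) \<longlonglongrightarrow> 0" by (rule summable_LIMSEQ_zero)
    from tendsto_real_sqrt[OF this] show ?thesis by (simp add: tendsto_norm_zero_iff)
  qed
  have "{k::int. k > 0} = range (\<lambda>k. int (Suc k))"
  proof (intro equalityI subsetI)
    fix k :: int assume "k \<in> {k. k > 0}"
    then have "k = int (Suc (nat (k - 1)))" by simp
    then show "k \<in> range (\<lambda>k. int (Suc k))" by blast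
  qed auto
  from lim[OF _ this, of "\<lambda>k. of_int k powi n * a k"]
  have "(\<lambda>k. of_int (int (Suc k)) powi n * a (int (Suc k))) \<longlonglongrightarrow> 0"
    using a by (simp add: l2_space_def inj_def)
  then show "(\<lambda>k. of_int (int k) powi n * a (int k)) \<longlonglongrightarrow> 0"
    by (rule LIMSEQ_imp_Suc)
  have "{k::int. k < 0} = range (\<lambda>k. - int (Suc k))"
  proof (intro equalityI subsetI)
    fix k :: int assume "k \<in> {k. k < 0}"
    then have "k = - int (Suc (nat (- k - 1)))" by simp
    then show "k \<in> range (\<lambda>k. - int (Suc k))" by blast
  qed auto
  from lim[OF _ this, of "\<lambda>k. of_int k powi m * a k"]
  have "(\<lambda>k. of_int (- int (Suc k)) powi m * a (- int (Suc k))) \<longlonglongrightarrow> 0"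
    using a by (simp add: l2_space_def inj_def)
  then show "(\<lambda>k. of_int (- int k) powi m * a (- int k)) \<longlonglongrightarrow> 0"
    by (rule LIMSEQ_imp_Suc)
qed

text \<open>With x = 2 \<pi> n and q = sqrt (x^2 - 1) the two values are (x + q)^2 and (x - q)^2,
  and (x + q) (x - q) = 1.\<close>

lemma lambda0_reciprocal:
  assumes "n \<ge> 1"
  shows "lambda0 (int n) * lambda0 (- int n) = 1"
proof -
  define x q where "x = 2 * pi * real n" and "q = sqrt (x\<^sup>2 - 1)"
  have "1 * 1 \<le> (2 * pi) * real n" using assms pi_gt3 by (intro mult_mono) auto
  then have "1 \<le> x\<^sup>2" by (simp add: x_def)
  then have q: "q\<^sup>2 = x\<^sup>2 - 1" by (simp add: q_def)
  have e: "lambda0 (int n) = 2 * x\<^sup>2 + 2 * x * q - 1" "lambda0 (- int n) = 2 * x\<^sup>2 - 2 * x * q - 1"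
    by (simp_all add: lambda0_def x_def q_def power_mult_distrib)
  have "lambda0 (int n) * lambda0 (- int n) = (2 * x\<^sup>2 - 1)\<^sup>2 - 4 * x\<^sup>2 * q\<^sup>2"
    unfolding e by (simp add: power2_eq_square algebra_simps)
  also have "\<dots> = 1" unfolding q by (simp add: power2_eq_square algebra_simps)
  finally show ?thesis .
qed

text \<open>Inversion near \<open>lambda0 (- n)\<close> multiplies an error by about
  \<open>(lambda0 n)\<^sup>2\<close>, of order n^4. So the weight 3 at negative indices corresponds
  to the weight -1 at positive ones, and the reflected points satisfy the same hypothesis.\<close>

lemma reciprocal_near_lambda0:
  fixes x :: "nat \<Rightarrow> complex"
  assumes x: "(\<lambda>n. of_nat n ^ 3 * (x n - of_real (lambda0 (- int n)))) \<longlonglongrightarrow> 0"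
  shows "(\<lambda>n. (inverse (x n) - of_real (lambda0 (int n))) / of_nat n) \<longlonglongrightarrow> 0"
    and "\<forall>\<^sub>F n in sequentially. cmod (x n) \<le> 1"
proof -
  define D where "D n = cmod (of_nat n ^ 3 * (x n - of_real (lambda0 (- int n))))" for n
  have D: "D \<longlonglongrightarrow> 0" using tendsto_norm[OF x] by (simp add: D_def[abs_def])
  have "\<forall>\<^sub>F n in sequentially. D n < 1/520" using D by (rule order_tendstoD) simp
  then have ev: "\<forall>\<^sub>F n in sequentially. cmod ((inverse (x n) - of_real (lambda0 (int n))) / of_nat n)
      \<le> 2 * 260\<^sup>2 * D n \<and> cmod (x n) \<le> 1"
    using eventually_ge_at_top[of 1]
  proof eventually_elim
    case (elim n)
    define \<delta> where "\<delta> = x n - of_real (lambda0 (- int n))"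
    define l where "l = lambda0 (int n)"
    have n: "1 \<le> real n" "1 \<le> (real n)\<^sup>2" using elim by (auto intro: one_le_power)
    have "(4 * pi * real n)\<^sup>2 \<le> (16 * real n)\<^sup>2"
      using pi_less_4 by (intro power_mono mult_right_mono) auto
    moreover have "(12 * real n)\<^sup>2 \<le> (4 * pi * real n)\<^sup>2"
      using pi_gt3 by (intro power_mono mult_right_mono) auto
    \<comment> \<open>(4 \<pi> n)^2 lies between 144 n^2 and 256 n^2, and \<open>lambda0\<close>
      differs from it by at most 3. The threshold 1/520 for \<open>D\<close> is half of 1/260, so
      that the relative error \<open>l * \<delta>\<close> is at most 1/2.\<close>
    ultimately have l: "2 \<le> l" "l \<le> 260 * (real n)\<^sup>2"
      using lambda0_near[OF elim(2)] n(2) unfolding l_def by (simp_all add: power_mult_distrib abs_le_iff)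
    have l': "of_real (lambda0 (- int n)) = 1 / complex_of_real l"
      using lambda0_reciprocal[OF elim(2)] l(1) unfolding l_def
      by (simp add: field_simps flip: of_real_mult)
    have Dd: "real n ^ 3 * cmod \<delta> = D n" by (simp add: D_def \<delta>_def norm_mult norm_power)
    have nn: "(real n)\<^sup>2 \<le> real n ^ 3" "1 \<le> real n ^ 3"
      using n by (auto intro: power_increasing one_le_power)
    have "l * cmod \<delta> \<le> 260 * (real n ^ 3 * cmod \<delta>)"
    proof -
      have "l \<le> 260 * real n ^ 3" using l(2) nn(1) by linarith
      then have "l * cmod \<delta> \<le> (260 * real n ^ 3) * cmod \<delta>" by (intro mult_right_mono) auto
      then show ?thesis by simp
    qed
    then have ld: "l * cmod \<delta> \<le> 1/2" using elim(1) unfolding Dd by simp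
    have x: "x n = (1 + l * \<delta>) / l" using l(1) by (simp add: \<delta>_def l' field_simps)
    have "cmod (1 + l * \<delta>) \<ge> 1 - l * cmod \<delta>"
      using norm_triangle_ineq2[of 1 "- (l * \<delta>)"] l(1) by (simp add: norm_mult)
    then have h: "1/2 \<le> cmod (1 + l * \<delta>)" using ld by linarith
    have eq: "inverse (x n) - of_real l = - ((of_real l)\<^sup>2 * \<delta>) / (1 + l * \<delta>)"
    proof -
      have "1 + l * \<delta> \<noteq> 0" using h by auto
      then show ?thesis unfolding x using l(1) by (simp add: field_simps power2_eq_square)
    qed
    have "cmod (inverse (x n) - of_real l) = (l\<^sup>2 * cmod \<delta>) / cmod (1 + l * \<delta>)"
      unfolding eq by (simp add: norm_divide norm_mult norm_power)
    also have "\<dots> \<le> (l\<^sup>2 * cmod \<delta>) / (1/2)"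
      using h by (intro divide_left_mono) auto
    also have "\<dots> = 2 * (l\<^sup>2 * cmod \<delta>)" by (simp only: divide_divide_eq_right div_by_1 mult.commute)
    also have "\<dots> \<le> 2 * ((260 * (real n)\<^sup>2)\<^sup>2 * cmod \<delta>)"
    proof (rule mult_left_mono)
      have "l\<^sup>2 \<le> (260 * (real n)\<^sup>2)\<^sup>2" using l by (intro power_mono) auto
      then show "l\<^sup>2 * cmod \<delta> \<le> (260 * (real n)\<^sup>2)\<^sup>2 * cmod \<delta>" by (rule mult_right_mono) simp
    qed simp
    also have "\<dots> = 2 * 260\<^sup>2 * D n * real n"
      unfolding Dd[symmetric] by (simp add: power2_eq_square power3_eq_cube)
    finally have "cmod ((inverse (x n) - of_real l) / of_nat n) \<le> 2 * 260\<^sup>2 * D n"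
      using n(1) by (simp add: norm_divide divide_le_eq)
    moreover have "cmod (x n) \<le> 1"
    proof -
      have "cmod (1 + l * \<delta>) \<le> 1 + l * cmod \<delta>"
        using norm_triangle_ineq[of 1 "l * \<delta>"] l(1) by (simp add: norm_mult)
      then show ?thesis unfolding x using ld l(1) by (simp add: norm_divide divide_le_eq)
    qed
    ultimately show ?case by (simp add: l_def)
  qed
  have "(\<lambda>n. 2 * 260\<^sup>2 * D n) \<longlonglongrightarrow> 0" using tendsto_mult_right_zero[OF D] by simp
  then show "(\<lambda>n. (inverse (x n) - of_real (lambda0 (int n))) / of_nat n) \<longlonglongrightarrow> 0"
    by (rule Lim_null_comparison[rotated]) (use ev in \<open>auto elim: eventually_mono\<close>)
  show "\<forall>\<^sub>F n in sequentially. cmod (x n) \<le> 1" using ev by (auto elim: eventually_mono)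
qed

text \<open>(a - \<sigma>) (a + \<sigma>) = a^2 - 1 = a (a - d), with |a + \<sigma>| at least 3/2
  and |a| at most 3/2. Closeness to \<open>\<sigma>\<close> is what decides between the two square
  roots of 1.\<close>

lemma near_square_root_of_1:
  fixes a d \<sigma> :: complex
  assumes ad: "a * d = 1" and \<sigma>: "\<sigma>\<^sup>2 = 1" and near: "cmod (a - \<sigma>) \<le> 1/2"
  shows "cmod (a - \<sigma>) \<le> cmod (a - d)"
proof -
  have s: "cmod \<sigma> = 1" using \<sigma> by (metis norm_ge_zero norm_one norm_power power2_eq_1_iff abs_of_nonneg real_sqrt_abs real_sqrt_one)
  have a: "cmod a \<le> 3/2" using norm_triangle_ineq[of "a - \<sigma>" \<sigma>] near s by simp
  have "cmod (2 * \<sigma>) \<le> cmod (a + \<sigma>) + cmod (a - \<sigma>)"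
    using norm_triangle_ineq4[of "a + \<sigma>" "a - \<sigma>"] by simp
  then have b: "3/2 \<le> cmod (a + \<sigma>)" using near s by (simp add: norm_mult)
  have "cmod (a - \<sigma>) * (3/2) \<le> cmod (a - \<sigma>) * cmod (a + \<sigma>)" using b by (intro mult_left_mono) auto
  also have "\<dots> = cmod (a * (a - d))"
    using ad \<sigma> by (simp add: power2_eq_square algebra_simps flip: norm_mult)
  also have "\<dots> \<le> 3/2 * cmod (a - d)"
    unfolding norm_mult using a by (intro mult_right_mono) auto
  finally show ?thesis by simp
qed

lemma enumerates_multiplicity_pos:
  assumes "enumerates I x m" "i \<in> I"
  shows "m (x i) > 0"
proof -
  have "finite {j\<in>I. x j = x i}" "card {j\<in>I. x j = x i} = m (x i)"
    using assms(1) by (auto simp: enumerates_def)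
  moreover have "i \<in> {j\<in>I. x j = x i}" using assms(2) by simp
  ultimately show ?thesis by (metis card_gt_0_iff empty_iff)
qed

lemma mon_tr_eq: "mon_tr u l = mon_a u l + snd (col 2 (monodromy u l))"
  by (simp add: mon_tr_def mon_a_def trace_def sum_2 col_def)

lemma is_mon_monodromy:
  assumes Y: "0 < Y" "Y < r" and sol: "sinh_gordon_solution (strip r) u"
    and per: "simply_periodic (strip r) u"
  shows "sinh_gordon_rectangle.is_mon (\<lambda>x y. u (Complex x y)) (\<lambda>x y. pdy u (Complex x y)) l
    (mon_a u l) (fst (col 2 (monodromy u l))) (mon_c u l) (snd (col 2 (monodromy u l)))"
proof -
  interpret R: sinh_gordon_rectangle Y "\<lambda>x y. u (Complex x y)" "\<lambda>x y. pdx u (Complex x y)"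
    "\<lambda>x y. pdy u (Complex x y)" "\<lambda>x y. pdx (pdx u) (Complex x y)"
    "\<lambda>x y. pdx (pdy u) (Complex x y)" "\<lambda>x y. pdy (pdy u) (Complex x y)"
    by (rule rectangle_of_solution[OF assms])
  have A: "alpha u l (of_real t) 1 = mat_of (R.connU l t 0)" for t
    by (simp add: mat_eq_iff_col col_mat_of alpha_def alpha_dx_def R.connU_def cscale_def mat2_def
        col_def vector_2 complex_of_real_def)
  have "continuous_on {0..1} ((\<lambda>p. R.connU l (fst p) (snd p)) \<circ> (\<lambda>x. (x, 0)))"
    by (intro continuous_on_compose continuous_intros continuous_on_subset[OF R.cont_conn(1)])
       (use Y in auto)
  then have cont: "continuous_on {0..1} (\<lambda>t. R.connU l t 0)" by (simp add: o_def)
  show ?thesis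
    unfolding R.is_mon_def
  proof (intro allI impI)
    fix v assume "R.xsol l 0 v"
    then have "v 1 = mv2 ((mon_a u l, fst (col 2 (monodromy u l))), (mon_c u l, snd (col 2 (monodromy u l)))) (v 0)"
      by (intro monodromy_solution[OF A cont]) (simp_all add: R.xsol_def)
    then show "v 1 = (mon_a u l * fst (v 0) + fst (col 2 (monodromy u l)) * snd (v 0),
        mon_c u l * fst (v 0) + snd (col 2 (monodromy u l)) * snd (v 0))"
      by (simp add: mv2_def)
  qed
qed

theorem theorem8p2:
  fixes y0 \<epsilon> :: real
    and u :: "complex \<Rightarrow> complex"
    and \<kappa> :: "int \<Rightarrow> nat \<Rightarrow> complex"
    and lam mu :: "int \<Rightarrow> complex"
  assumes "y0 > 0" and "\<epsilon> > 0"
    and "sinh_gordon_solution (strip (y0 + \<epsilon>)) u"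
    and "simply_periodic (strip (y0 + \<epsilon>)) u"
    and "curve_singularities u = {}"
    and "branch_point_enumeration u \<kappa>"
    and "divisor_enumeration u lam mu"
  shows "\<exists>C>0. \<exists>s :: int \<Rightarrow> real. (\<lambda>n. of_real (s n)) \<in> l2_space 0 0 \<and>
    (\<forall>n. cmod (\<kappa> n 1 - \<kappa> n 2)
             \<le> C * exp (- 2 * pi * (1 - s n) * \<bar>of_int n\<bar> * y0) \<and>
         cmod (lam n - (\<kappa> n 1 + \<kappa> n 2) / 2)
             \<le> C * exp (- 2 * pi * (1 - s n) * \<bar>of_int n\<bar> * y0) \<and>
         cmod (mu n - (-1) powi n)
             \<le> C * exp (- pi * (1 - s n) * \<bar>of_int n\<bar> * y0))"
proof -
  \<comment> \<open>Halfway into the margin: the closed rectangle of half-height \<open>Y\<close>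
    lies inside the open strip, and \<open>Y\<close> still exceeds \<open>y0\<close>.\<close>
  define Y where "Y = y0 + \<epsilon> / 2"
  have Y: "0 < Y" "Y < y0 + \<epsilon>" and y0: "0 < y0" "y0 < Y" using assms(1,2) by (simp_all add: Y_def)
  interpret R: sinh_gordon_rectangle Y "\<lambda>x y. u (Complex x y)" "\<lambda>x y. pdx u (Complex x y)"
    "\<lambda>x y. pdy u (Complex x y)" "\<lambda>x y. pdx (pdx u) (Complex x y)"
    "\<lambda>x y. pdx (pdy u) (Complex x y)" "\<lambda>x y. pdy (pdy u) (Complex x y)"
    by (rule rectangle_of_solution[OF Y assms(3,4)])
  \<comment> \<open>The reflected solution takes care of the negative indices.\<close>
  interpret R': sinh_gordon_rectangle Y "\<lambda>x y. - u (Complex x (- y))" "\<lambda>x y. - pdx u (Complex x (- y))"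
    "\<lambda>x y. pdy u (Complex x (- y))" "\<lambda>x y. - pdx (pdx u) (Complex x (- y))"
    "\<lambda>x y. pdx (pdy u) (Complex x (- y))" "\<lambda>x y. - pdy (pdy u) (Complex x (- y))"
    by (rule R.reflected)
  define b d where "b l = fst (col 2 (monodromy u l))" and "d l = snd (col 2 (monodromy u l))" for l
  have mon: "R.is_mon l (mon_a u l) (b l) (mon_c u l) (d l)" for l
    unfolding b_def d_def by (rule is_mon_monodromy[OF Y assms(3,4)])
  have kap: "\<kappa> k \<nu> \<noteq> 0" "(mon_a u (\<kappa> k \<nu>) + d (\<kappa> k \<nu>))\<^sup>2 = 4" if "\<nu> \<in> {1, 2}" for k \<nu>
  proof -
    have "zero_mult (\<lambda>l. (mon_tr u l)\<^sup>2 - 4) (\<kappa> k \<nu>) > 0"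
      using enumerates_multiplicity_pos[of "UNIV \<times> {1, 2}" "\<lambda>(k, \<nu>). \<kappa> k \<nu>" _ "(k, \<nu>)"] assms(6) that
      by (auto simp: branch_point_enumeration_def)
    then show "\<kappa> k \<nu> \<noteq> 0" "(mon_a u (\<kappa> k \<nu>) + d (\<kappa> k \<nu>))\<^sup>2 = 4"
      by (auto simp: zero_mult_def mon_tr_eq d_def split: if_splits)
  qed
  have div: "lam k \<noteq> 0" "mon_c u (lam k) = 0" "mon_a u (lam k) = mu k" "mu k * d (lam k) = 1" for k
  proof -
    have "spectral_divisor u (lam k, mu k) > 0"
      using enumerates_multiplicity_pos[of UNIV "\<lambda>k. (lam k, mu k)" _ k] assms(7)
      by (simp add: divisor_enumeration_def)
    then have *: "(lam k, mu k) \<in> spectral_curve u" "mu k = mon_a u (lam k)" "zero_mult (mon_c u) (lam k) > 0"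
      by (auto simp: spectral_divisor_def split: if_splits)
    then show "lam k \<noteq> 0" "mon_c u (lam k) = 0" "mon_a u (lam k) = mu k"
      by (auto simp: zero_mult_def split: if_splits)
    \<comment> \<open>For \<open>mu = a\<close> the equation of the curve, a^2 - (a + d) a + 1 = 0,
      reduces to a d = 1.\<close>
    show "mu k * d (lam k) = 1"
      using *(1) unfolding *(2)
      by (simp add: spectral_curve_def curve_fun_def mon_tr_eq d_def power2_eq_square algebra_simps)
  qed
  have m: "R.is_mon (lam k) (mu k) (b (lam k)) 0 (d (lam k))" for k
    using mon[of "lam k"] by (simp add: div)
  have "R.spectral_point (\<kappa> k \<nu>)" if "\<nu> \<in> {1, 2}" for k \<nu>
    unfolding R.spectral_point_def using mon kap(2)[OF that] by blast
  then have sp: "R.spectral_point (\<kappa> k 1)" "R.spectral_point (\<kappa> k 2)" for k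
    by blast+
  have m': "R'.is_mon (inverse (lam k)) (mu k) (b (lam k) * lam k) 0 (d (lam k))" for k
    using R.is_mon_reflected[OF m div(1)] by simp
  have "R'.spectral_point (inverse (\<kappa> k \<nu>))" if "\<nu> \<in> {1, 2}" for k \<nu>
    unfolding R'.spectral_point_def using R.is_mon_reflected[OF mon kap(1)[OF that]] kap(2)[OF that] by blast
  then have sp': "R'.spectral_point (inverse (\<kappa> k 1))" "R'.spectral_point (inverse (\<kappa> k 2))" for k
    by blast+

  have l2: "(\<lambda>k. lam k - of_real (lambda0 k)) \<in> l2_space (-1) 3"
    "(\<lambda>k. \<kappa> k 1 - of_real (lambda0 k)) \<in> l2_space (-1) 3"
    "(\<lambda>k. \<kappa> k 2 - of_real (lambda0 k)) \<in> l2_space (-1) 3"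
    "(\<lambda>k. mu k - (-1) powi k) \<in> l2_space 0 0"
    using assms(6,7) by (auto simp: branch_point_enumeration_def divisor_enumeration_def)
  have lim_pos: "(\<lambda>n. (x (int n) - of_real (lambda0 (int n))) / of_nat n) \<longlonglongrightarrow> 0"
    if "(\<lambda>k. x k - of_real (lambda0 k)) \<in> l2_space (-1) 3" for x :: "int \<Rightarrow> complex"
    using l2_space_tendsto(1)[OF that] by (simp add: power_int_minus divide_inverse mult.commute)
  have lim_neg: "(\<lambda>n. of_nat n ^ 3 * (x (- int n) - of_real (lambda0 (- int n)))) \<longlonglongrightarrow> 0"
    if "(\<lambda>k. x k - of_real (lambda0 k)) \<in> l2_space (-1) 3" for x :: "int \<Rightarrow> complex"
    using tendsto_minus[OF l2_space_tendsto(2)[OF that]] by simp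

  \<comment> \<open>The three bounds at one index with the sequence \<open>s\<close> equal to 0. The
    predicate is monotone in \<open>C\<close> and satisfiable at each single index, so finitely many
    exceptions can be absorbed into the constant.\<close>
  define G where "G C k \<longleftrightarrow> cmod (\<kappa> k 1 - \<kappa> k 2) \<le> C * exp (- 2 * pi * \<bar>real_of_int k\<bar> * y0) \<and>
    cmod (lam k - (\<kappa> k 1 + \<kappa> k 2) / 2) \<le> C * exp (- 2 * pi * \<bar>real_of_int k\<bar> * y0) \<and>
    cmod (mu k - (-1) powi k) \<le> C * exp (- pi * \<bar>real_of_int k\<bar> * y0)" for C k
  have G_mono: "G C' k" if "G C k" "C \<le> C'" for C C' k
    using that unfolding G_def by (meson exp_ge_zero mult_right_mono order_trans)
  have G_ex: "\<exists>C. G C k" for k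
  proof -
    have bnd: "x \<le> C * exp t" if "x / exp t \<le> C" for x t C :: real
      using that by (simp add: divide_le_eq)
    define p q r where "p = cmod (\<kappa> k 1 - \<kappa> k 2) / exp (- 2 * pi * \<bar>real_of_int k\<bar> * y0)"
      and "q = cmod (lam k - (\<kappa> k 1 + \<kappa> k 2) / 2) / exp (- 2 * pi * \<bar>real_of_int k\<bar> * y0)"
      and "r = cmod (mu k - (-1) powi k) / exp (- pi * \<bar>real_of_int k\<bar> * y0)"
    have "p \<le> max p (max q r)" "q \<le> max p (max q r)" "r \<le> max p (max q r)" by simp_all
    then have "G (max p (max q r)) k" unfolding G_def p_def q_def r_def by (intro conjI bnd)
    then show ?thesis by blast
  qed
  \<comment> \<open>The divisor point is the common reference for both branch points, which costs
    the factor 2. For \<open>mu\<close> even the rate 2 \<pi> is available, and it is weakened to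
    the stated \<pi>.\<close>
  have G_I: "G (2 * C) k"
    if "cmod (lam k - \<kappa> k 1) \<le> C * exp (- 2 * pi * \<bar>real_of_int k\<bar> * y0)"
      "cmod (lam k - \<kappa> k 2) \<le> C * exp (- 2 * pi * \<bar>real_of_int k\<bar> * y0)"
      "cmod (mu k - d (lam k)) \<le> C * exp (- 2 * pi * \<bar>real_of_int k\<bar> * y0)"
      "cmod (mu k - (-1) powi k) \<le> 1/2" "C > 0" for C k
  proof -
    define E where "E = exp (- 2 * pi * \<bar>real_of_int k\<bar> * y0)"
    define T where "T = C * E"
    have t: "cmod (lam k - \<kappa> k 1) \<le> T" "cmod (lam k - \<kappa> k 2) \<le> T" "0 \<le> T"
      using that by (simp_all add: T_def E_def)
    have "cmod (\<kappa> k 1 - \<kappa> k 2) \<le> cmod (lam k - \<kappa> k 2) + cmod (lam k - \<kappa> k 1)"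
      using norm_triangle_ineq4[of "lam k - \<kappa> k 2" "lam k - \<kappa> k 1"] by simp
    then have 1: "cmod (\<kappa> k 1 - \<kappa> k 2) \<le> 2 * T" using t by linarith
    have eq: "lam k - (\<kappa> k 1 + \<kappa> k 2) / 2 = ((lam k - \<kappa> k 1) + (lam k - \<kappa> k 2)) / 2"
      by (simp add: field_simps)
    have "cmod (lam k - (\<kappa> k 1 + \<kappa> k 2) / 2) \<le> (cmod (lam k - \<kappa> k 1) + cmod (lam k - \<kappa> k 2)) / 2"
      unfolding eq norm_divide norm_numeral by (rule divide_right_mono[OF norm_triangle_ineq]) simp
    also have "\<dots> \<le> (T + T) / 2" by (intro divide_right_mono add_mono t) simp
    also have "\<dots> \<le> 2 * T" using t(3) by simp
    finally have 2: "cmod (lam k - (\<kappa> k 1 + \<kappa> k 2) / 2) \<le> 2 * T" .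
    have "((-1) powi k :: complex)\<^sup>2 = 1" by (simp add: power2_eq_square)
    from near_square_root_of_1[OF div(4) this that(4)] have "cmod (mu k - (-1) powi k) \<le> C * E"
      using that(3) by (simp add: E_def)
    also have "\<dots> \<le> (2 * C) * exp (- pi * \<bar>real_of_int k\<bar> * y0)"
    proof (rule mult_mono)
      have "0 \<le> y0 * \<bar>real_of_int k\<bar>" using y0(1) by simp
      then show "E \<le> exp (- pi * \<bar>real_of_int k\<bar> * y0)" by (simp add: E_def)
    qed (use that(5) in \<open>simp_all add: E_def\<close>)
    finally show ?thesis using 1 2 by (simp add: G_def T_def E_def)
  qed

  obtain C1 where C1: "C1 > 0" "\<forall>\<^sub>F n in sequentially. cmod (lam (int n) - \<kappa> (int n) 1) \<le> C1 * exp (- 2 * pi * real n * y0) \<and>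
    cmod (lam (int n) - \<kappa> (int n) 2) \<le> C1 * exp (- 2 * pi * real n * y0) \<and>
    cmod (mu (int n) - d (lam (int n))) \<le> C1 * exp (- 2 * pi * real n * y0)"
    using R.spectral_data_exponentially_close[OF y0 lim_pos[OF l2(1)] lim_pos[OF l2(2)] lim_pos[OF l2(3)] m sp]
    by blast
  have "\<forall>\<^sub>F n in sequentially. cmod (mu (int n) - (-1) powi int n) < 1/2"
    using tendsto_norm_zero[OF l2_space_tendsto(1)[OF l2(4)]] by (intro order_tendstoD(2)[of _ 0]) simp_all
  then have pos: "\<forall>\<^sub>F n in sequentially. G (2 * C1) (int n)"
    using C1(2) by eventually_elim (use C1(1) in \<open>auto intro!: G_I\<close>)

  note inv = reciprocal_near_lambda0[OF lim_neg]
  obtain C2 where C2: "C2 > 0" "\<forall>\<^sub>F n in sequentially.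
    cmod (inverse (lam (- int n)) - inverse (\<kappa> (- int n) 1)) \<le> C2 * exp (- 2 * pi * real n * y0) \<and>
    cmod (inverse (lam (- int n)) - inverse (\<kappa> (- int n) 2)) \<le> C2 * exp (- 2 * pi * real n * y0) \<and>
    cmod (mu (- int n) - d (lam (- int n))) \<le> C2 * exp (- 2 * pi * real n * y0)"
    using R'.spectral_data_exponentially_close[OF y0 inv(1)[OF l2(1)] inv(1)[OF l2(2)] inv(1)[OF l2(3)] m' sp']
    by blast
  have "\<forall>\<^sub>F n in sequentially. cmod (mu (- int n) - (-1) powi (- int n)) < 1/2"
    using tendsto_norm_zero[OF l2_space_tendsto(2)[OF l2(4)]] by (intro order_tendstoD(2)[of _ 0]) simp_all
  then have neg: "\<forall>\<^sub>F n in sequentially. G (2 * C2) (- int n)"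
    using C2(2) inv(2)[OF l2(1)] inv(2)[OF l2(2)] inv(2)[OF l2(3)]
  proof eventually_elim
    case (elim n)
    \<comment> \<open>The reflected estimate concerns reciprocals. At this end the points themselves
      lie in the unit disc, where inverting back does not increase distances.\<close>
    have inv_le: "cmod (x - y) \<le> cmod (inverse x - inverse y)"
      if "x \<noteq> 0" "y \<noteq> 0" "cmod x \<le> 1" "cmod y \<le> 1" for x y :: complex
    proof -
      have "x - y = x * y * (inverse y - inverse x)" using that by (simp add: field_simps)
      then have "cmod (x - y) = cmod x * cmod y * cmod (inverse x - inverse y)"
        by (metis norm_minus_commute norm_mult)
      also have "\<dots> \<le> 1 * cmod (inverse x - inverse y)"
        using that mult_mono[of "cmod x" 1 "cmod y" 1] by (intro mult_right_mono) auto
      finally show ?thesis by simp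
    qed
    have "cmod (lam (- int n) - \<kappa> (- int n) 1) \<le> C2 * exp (- 2 * pi * real n * y0)"
      "cmod (lam (- int n) - \<kappa> (- int n) 2) \<le> C2 * exp (- 2 * pi * real n * y0)"
      using elim inv_le[OF div(1)[of "- int n"] kap(1)[of 1 "- int n"]]
        inv_le[OF div(1)[of "- int n"] kap(1)[of 2 "- int n"]] by force+
    then show ?case using elim C2(1) by (intro G_I) simp_all
  qed
  from eventually_conj[OF pos neg] obtain N where N: "\<And>n. n \<ge> N \<Longrightarrow> G (2 * C1) (int n) \<and> G (2 * C2) (- int n)"
    by (auto simp: eventually_at_top_linorder)
  obtain c where c: "\<And>k. G (c k) k" using G_ex by metis
  \<comment> \<open>The tail constants for both ends together with the maximum over the finitely
    many indices between \<open>- N\<close> and \<open>N\<close>.\<close>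
  define C where "C = max (2 * C1) (max (2 * C2) (Max (c ` {- int N..int N})))"
  have "G C k" for k
  proof (cases "k \<in> {- int N..int N}")
    case True
    then have "c k \<le> Max (c ` {- int N..int N})" by (intro Max_ge) auto
    then show ?thesis by (intro G_mono[OF c]) (simp add: C_def)
  next
    case False
    then have "k = int (nat k) \<and> nat k \<ge> N \<or> k = - int (nat (- k)) \<and> nat (- k) \<ge> N" by auto
    then have "G (2 * C1) k \<or> G (2 * C2) k" using N by metis
    then show ?thesis by (auto elim!: G_mono simp: C_def)
  qed
  moreover have "C > 0" using C1(1) by (simp add: C_def)
  moreover have "(\<lambda>n::int. of_real 0) \<in> l2_space 0 0" by (simp add: l2_space_def)
  ultimately show ?thesis
    unfolding G_def by (intro exI[of _ C] conjI exI[of _ "\<lambda>_::int. 0::real"]) simp_all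
qed

end
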